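(* There is a natural bijection between the set of isomorphism classes of connected irreducible universal Weyl groupoids of rank two with $2n$ objects which admit a finite root system, and the triangulations of a convex $n$-gon by non-intersecting diagonals, up to the symmetry of the dihedral group $\mathbb{D}_n$ (of order $2n$).
   Context: Cartan schemes (rank two). Let $I$ be a set with $|I|=2$, $A$ a non-empty set, $\rho_i:A\to A$ a map for each $i\in I$, and $C^a=(c^a_{jk})_{j,k\in I}$ an integer matrix for each $a\in A$. The quadruple $\mathcal{C}=(I,A,(\rho_i)_{i\in I},(C^a)_{a\in A})$ is a Cartan scheme of rank two if every $C^a$ is a generalized Cartan matrix ($c^a_{ii}=2$; $c^a_{ij}\le 0$ for $i\ne j$; $c^a_{ij}=0$ implies $c^a_{ji}=0$), $\rho_i^2=\mathrm{id}$ for all $i$, and $c^a_{ij}=c^{\rho_i(a)}_{ij}$ for all $a\in A$, $i,j\in I$. Let $(\alpha_i)_{i\in I}$ be the standard basis of $\mathbb{Z}^I$ and let $\sigma_i^a\in\mathrm{Aut}(\mathbb{Z}^I)$ be given by $\sigma_i^a(\alpha_j)=\alpha_j-c^a_{ij}\alpha_i$. The Weyl groupoid $\mathcal{W}(\mathcal{C})$ is the category with object set $A$ whose morphisms are generated by the maps $\sigma_i^a$, regarded as elements of $\mathrm{Hom}(a,\rho_i(a))$. It is connected if it is connected as a groupoid, universal if the group $\mathrm{End}(a)$ is trivial for each object $a\in A$, and irreducible if none of the generalized Cartan matrices $C^a$ is decomposable. A root system of type $\mathcal{C}$ is a family $(R^a)_{a\in A}$ of subsets of $\mathbb{Z}^I$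 such that, with $R^a_+=R^a\cap\mathbb{N}_0^I$, for all $a\in A$ and $i,j\in I$: (R1) $R^a=R^a_+\cup -R^a_+$; (R2) $R^a\cap\mathbb{Z}\alpha_i=\{\alpha_i,-\alpha_i\}$; (R3) $\sigma_i^a(R^a)=R^{\rho_i(a)}$; (R4) if $i\ne j$ and $m=|R^a\cap(\mathbb{N}_0\alpha_i+\mathbb{N}_0\alpha_j)|$ is finite then $(\rho_i\rho_j)^m(a)=a$. It is finite if all $R^a$ are finite. "Admits a finite root system" means that there is a finite root system of type $\mathcal{C}$. Isomorphism of Weyl groupoids means equivalence of the underlying Cartan schemes: bijections $\varphi_0:I\to I'$ and $\varphi_1:A\to A'$ with $\varphi_1(\rho_i(a))=\rho'_{\varphi_0(i)}(\varphi_1(a))$ and $c^{a}_{ij}=c'^{\varphi_1(a)}_{\varphi_0(i)\varphi_0(j)}$ for all $i,j\in I$, $a\in A$. *)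

theory Defs
  imports Complex_Main
begin

section \<open>Cartan schemes of rank two\<close>

text \<open>A quadruple (I, A, rho, C). The functions are total in HOL; only their values on the
  carrier sets index and objs are ever referred to.\<close>

record ('i, 'a) cartan_data =
  index :: "'i set"
  objs :: "'a set"
  rho :: "'i \<Rightarrow> 'a \<Rightarrow> 'a"
  cartan :: "'a \<Rightarrow> 'i \<Rightarrow> 'i \<Rightarrow> int"

definition generalized_cartan_matrix :: "'i set \<Rightarrow> ('i \<Rightarrow> 'i \<Rightarrow> int) \<Rightarrow> bool" where
  "generalized_cartan_matrix I c \<longleftrightarrow>
     (\<forall>i\<in>I. c i i = 2) \<and>
     (\<forall>i\<in>I. \<forall>j\<in>I. i \<noteq> j \<longrightarrow> c i j \<le> 0) \<and>
     (\<forall>i\<in>I. \<forall>j\<in>I. c i j = 0 \<longrightarrow> c j i = 0)"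

definition decomposable :: "'i set \<Rightarrow> ('i \<Rightarrow> 'i \<Rightarrow> int) \<Rightarrow> bool" where
  "decomposable I c \<longleftrightarrow>
     (\<exists>J K. J \<noteq> {} \<and> K \<noteq> {} \<and> J \<inter> K = {} \<and> J \<union> K = I \<and>
            (\<forall>j\<in>J. \<forall>k\<in>K. c j k = 0 \<and> c k j = 0))"

definition cartan_scheme_rank_two :: "('i, 'a) cartan_data \<Rightarrow> bool" where
  "cartan_scheme_rank_two C \<longleftrightarrow>
     card (index C) = 2 \<and> objs C \<noteq> {} \<and>
     (\<forall>i\<in>index C. \<forall>a\<in>objs C. rho C i a \<in> objs C) \<and>
     (\<forall>a\<in>objs C. generalized_cartan_matrix (index C) (cartan C a)) \<and>
     (\<forall>i\<in>index C. \<forall>a\<in>objs C. rho C i (rho C i a) = a) \<and>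
     (\<forall>a\<in>objs C. \<forall>i\<in>index C. \<forall>j\<in>index C. cartan C a i j = cartan C (rho C i a) i j)"

definition equivalent_schemes :: "('i, 'a) cartan_data \<Rightarrow> ('j, 'b) cartan_data \<Rightarrow> bool" where
  "equivalent_schemes C D \<longleftrightarrow>
     (\<exists>\<phi>0 \<phi>1. bij_betw \<phi>0 (index C) (index D) \<and> bij_betw \<phi>1 (objs C) (objs D) \<and>
        (\<forall>i\<in>index C. \<forall>a\<in>objs C. \<phi>1 (rho C i a) = rho D (\<phi>0 i) (\<phi>1 a)) \<and>
        (\<forall>i\<in>index C. \<forall>j\<in>index C. \<forall>a\<in>objs C.
            cartan C a i j = cartan D (\<phi>1 a) (\<phi>0 i) (\<phi>0 j)))"


section \<open>The Weyl groupoid\<close>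

text \<open>The lattice of integer vectors indexed by I is modelled by the integer functions
  vanishing outside I.\<close>

definition lattice_on :: "'i set \<Rightarrow> ('i \<Rightarrow> int) set" where
  "lattice_on I = {v. \<forall>i. i \<notin> I \<longrightarrow> v i = 0}"

definition simple_root :: "'i \<Rightarrow> 'i \<Rightarrow> int" where
  "simple_root i = (\<lambda>k. if k = i then 1 else 0)"

text \<open>The linear map sending the j-th basis vector to itself minus c i j times the i-th one,
  where c is the Cartan matrix at a, evaluated at an arbitrary vector.\<close>

definition reflection ::
    "('i, 'a) cartan_data \<Rightarrow> 'i \<Rightarrow> 'a \<Rightarrow> ('i \<Rightarrow> int) \<Rightarrow> ('i \<Rightarrow> int)" where
  "reflection C i a v =
     (\<lambda>k. v k - (\<Sum>j\<in>index C. v j * cartan C a i j) * simple_root i k)"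

text \<open>weyl_hom C a b f: the map f is a morphism from a to b. The groupoid inverse of the
  reflection i at a is the reflection i at rho i a, so the generated category is
  already a groupoid.\<close>

inductive weyl_hom ::
    "('i, 'a) cartan_data \<Rightarrow> 'a \<Rightarrow> 'a \<Rightarrow> (('i \<Rightarrow> int) \<Rightarrow> ('i \<Rightarrow> int)) \<Rightarrow> bool"
  for C :: "('i, 'a) cartan_data" where
  weyl_id: "a \<in> objs C \<Longrightarrow> weyl_hom C a a id"
| weyl_gen: "a \<in> objs C \<Longrightarrow> i \<in> index C \<Longrightarrow> weyl_hom C a (rho C i a) (reflection C i a)"
| weyl_comp: "weyl_hom C a b f \<Longrightarrow> weyl_hom C b c g \<Longrightarrow> weyl_hom C a c (g \<circ> f)"

definition weyl_connected :: "('i, 'a) cartan_data \<Rightarrow> bool" where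
  "weyl_connected C \<longleftrightarrow> (\<forall>a\<in>objs C. \<forall>b\<in>objs C. \<exists>f. weyl_hom C a b f)"

definition weyl_universal :: "('i, 'a) cartan_data \<Rightarrow> bool" where
  "weyl_universal C \<longleftrightarrow>
     (\<forall>a\<in>objs C. \<forall>f. weyl_hom C a a f \<longrightarrow> (\<forall>v\<in>lattice_on (index C). f v = v))"

definition weyl_irreducible :: "('i, 'a) cartan_data \<Rightarrow> bool" where
  "weyl_irreducible C \<longleftrightarrow> (\<forall>a\<in>objs C. \<not> decomposable (index C) (cartan C a))"


section \<open>Root systems\<close>

definition root_system :: "('i, 'a) cartan_data \<Rightarrow> ('a \<Rightarrow> ('i \<Rightarrow> int) set) \<Rightarrow> bool" where
  "root_system C R \<longleftrightarrow>
     (\<forall>a\<in>objs C. R a \<subseteq> lattice_on (index C)) \<and>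
     (\<forall>a\<in>objs C.
        let Rpos = {v \<in> R a. \<forall>i\<in>index C. 0 \<le> v i}
        in R a = Rpos \<union> (\<lambda>v k. - v k) ` Rpos) \<and>
     (\<forall>a\<in>objs C. \<forall>i\<in>index C.
        R a \<inter> range (\<lambda>(z::int) k. z * simple_root i k)
          = {simple_root i, (\<lambda>k. - simple_root i k)}) \<and>
     (\<forall>a\<in>objs C. \<forall>i\<in>index C. reflection C i a ` R a = R (rho C i a)) \<and>
     (\<forall>a\<in>objs C. \<forall>i\<in>index C. \<forall>j\<in>index C. i \<noteq> j \<longrightarrow>
        (let S = R a \<inter> {(\<lambda>k. int x * simple_root i k + int y * simple_root j k) | x y. True}
         in finite S \<longrightarrow> ((rho C i \<circ> rho C j) ^^ card S) a = a))"

definition admits_finite_root_system :: "('i, 'a) cartan_data \<Rightarrow> bool" where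
  "admits_finite_root_system C \<longleftrightarrow>
     (\<exists>R. root_system C R \<and> (\<forall>a\<in>objs C. finite (R a)))"


section \<open>Isomorphism classes of Weyl groupoids\<close>

text \<open>A Weyl groupoid is represented by its Cartan scheme, since isomorphism of Weyl groupoids
  means equivalence of the underlying schemes.\<close>

definition weyl_groupoids :: "nat \<Rightarrow> ('i, 'a) cartan_data set" where
  "weyl_groupoids n =
     {C. cartan_scheme_rank_two C \<and> weyl_connected C \<and> weyl_irreducible C \<and>
         weyl_universal C \<and> card (objs C) = 2 * n \<and> admits_finite_root_system C}"

definition weyl_iso :: "nat \<Rightarrow> ('i, 'a) cartan_data rel" where
  "weyl_iso n =
     {(C, D). C \<in> weyl_groupoids n \<and> D \<in> weyl_groupoids n \<and> equivalent_schemes C D}"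

definition weyl_classes :: "nat \<Rightarrow> ('i, 'a) cartan_data set set" where
  "weyl_classes n = weyl_groupoids n // weyl_iso n"


section \<open>Triangulations of a convex n-gon\<close>

text \<open>The vertices are 0, ..., n - 1 in cyclic order.\<close>

definition sides :: "nat \<Rightarrow> nat set set" where
  "sides n = {{k, (k + 1) mod n} | k. k < n}"

definition diagonals :: "nat \<Rightarrow> nat set set" where
  "diagonals n = {e. e \<subseteq> {..<n} \<and> card e = 2} - sides n"

text \<open>By convexity, two diagonals meet in the interior iff their endpoints interlace. Only the
  case where d has the smallest endpoint is covered here; the other one arises by
  exchanging d and e.\<close>

definition interlaced :: "nat set \<Rightarrow> nat set \<Rightarrow> bool" where
  "interlaced d e \<longleftrightarrow> (\<exists>i j k l. d = {i, j} \<and> e = {k, l} \<and> i < k \<and> k < j \<and> j < l)"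

definition non_crossing :: "nat set set \<Rightarrow> bool" where
  "non_crossing T \<longleftrightarrow> (\<forall>d\<in>T. \<forall>e\<in>T. \<not> interlaced d e)"

text \<open>A non-crossing set of diagonals cuts the polygon into triangles iff no further diagonal
  can be added to it.\<close>

definition triangulations :: "nat \<Rightarrow> nat set set set" where
  "triangulations n =
     {T. T \<subseteq> diagonals n \<and> non_crossing T \<and>
         (\<forall>d \<in> diagonals n - T. \<not> non_crossing (insert d T))}"

text \<open>The dihedral group as permutations of the vertices: rotations and reflections.\<close>

definition dihedral :: "nat \<Rightarrow> (nat \<Rightarrow> nat) set" where
  "dihedral n = {(\<lambda>k. (r + k) mod n) | r. r < n} \<union> {(\<lambda>k. (r + (n - k)) mod n) | r. r < n}"

definition dihedral_rel :: "nat \<Rightarrow> nat set set rel" where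
  "dihedral_rel n =
     {(S, T). S \<in> triangulations n \<and> T \<in> triangulations n \<and>
              (\<exists>g\<in>dihedral n. T = (\<lambda>e. g ` e) ` S)}"

definition triangulation_classes :: "nat \<Rightarrow> nat set set set set" where
  "triangulation_classes n = triangulations n // dihedral_rel n"


section \<open>The natural correspondence\<close>

text \<open>The characteristic sequence of the scheme at the object a, starting in direction i:
  the negated (i, j)-entry at a, then the negated (j, i)-entry at rho i a, then the negated
  (i, j)-entry at rho j (rho i a), and so on.\<close>

fun char_seq :: "('i, 'a) cartan_data \<Rightarrow> 'i \<Rightarrow> 'i \<Rightarrow> 'a \<Rightarrow> nat \<Rightarrow> int" where
  "char_seq C i j a 0 = - cartan C a i j"
| "char_seq C i j a (Suc k) = char_seq C j i (rho C i a) k"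

text \<open>In a triangulation of a convex polygon, three vertices joined pairwise by sides or chosen
  diagonals always bound one of the triangles.\<close>

definition triangles_at :: "nat \<Rightarrow> nat set set \<Rightarrow> nat \<Rightarrow> nat" where
  "triangles_at n T v =
     card {t. t \<subseteq> {..<n} \<and> card t = 3 \<and> v \<in> t \<and>
              (\<forall>x\<in>t. \<forall>y\<in>t. x \<noteq> y \<longrightarrow> {x, y} \<in> sides n \<union> T)}"

text \<open>The Weyl groupoid of C belongs to T if some characteristic sequence of C counts, going
  around the polygon repeatedly, the triangles of T at the vertices.\<close>

definition belongs_to :: "nat \<Rightarrow> ('i, 'a) cartan_data \<Rightarrow> nat set set \<Rightarrow> bool" where
  "belongs_to n C T \<longleftrightarrow>
     (\<exists>a\<in>objs C. \<exists>i\<in>index C. \<exists>j\<in>index C. i \<noteq> j \<and>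
        (\<forall>k. char_seq C i j a k = int (triangles_at n T (k mod n))))"

definition natural_map :: "nat \<Rightarrow> ('i, 'a) cartan_data set \<Rightarrow> nat set set set" where
  "natural_map n X = {T \<in> triangulations n. \<exists>C\<in>X. belongs_to n C T}"

end

(* Number the objects of a scheme cyclically and let W k be the simple root of the k-th object that
   its k-th wall carries, all roots being moved to one lattice. Then W (k + 1) = c k W k - W (k - 1)
   for the characteristic sequence c. Finiteness and sign coherence of the roots force
   W (k + n) = - W k and det (W k) (W m) > 0 for k < m < k + n, where n is the number of positive
   roots; so W 0, ..., W (n - 1) are the vertices of a Farey polygon. Such a polygon has an ear, a
   vertex with c k = 1, and removing it subtracts 1 from c at the two neighbours. This is what
   cutting off an ear does to the numbers of triangles at the vertices of a triangulated n-gon, so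
   by induction the sequences c are exactly the triangle counts of triangulations. Conversely the
   vectors of a Farey polygon form a root system. *)

theory Submission
  imports Defs "HOL-Library.Product_Plus"
begin

text \<open>Indices run over the integers because three periods meet: \<open>W\<close> repeats only
  after 2n steps, like the objects, while determinants of two vertices ignore a common sign, so the
  characteristic sequence already repeats after n steps, like the vertices. That sequence depends on
  a starting object and a direction. A new start rotates it and the other direction reverses it,
  which is the origin of the dihedral group. As triangle counts determine the triangulation, both
  sides of the bijection can be compared through one periodic function of \<open>k\<close>, up to
  the substitutions of \<open>s * k + z\<close> for \<open>k\<close> with \<open>s\<close> equal to
  1 or -1. The number p of positive roots is tied to the 2n objects as follows: (R4) closes the walk
  around the objects after 2p steps, connectedness makes it meet every object, and universality
  forbids an earlier return. That the Cartan entries along the walk repeat after p steps is not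
  given; it has to be extracted from sign coherence.\<close>

section \<open>Crossing diagonals and maximal non-crossing sets\<close>

definition crossing :: "nat set \<Rightarrow> nat set \<Rightarrow> bool" where
  "crossing d e \<longleftrightarrow> interlaced d e \<or> interlaced e d"

lemma crossing_sym: "crossing d e \<longleftrightarrow> crossing e d"
  by (auto simp: crossing_def)

lemma not_interlaced_self: "\<not> interlaced d d"
  unfolding interlaced_def by (auto simp: doubleton_eq_iff)

lemma non_crossing_insert:
  "non_crossing (insert d T) \<longleftrightarrow> non_crossing T \<and> (\<forall>e\<in>T. \<not> crossing d e)"
  by (auto simp: non_crossing_def crossing_def not_interlaced_self)

text \<open>No diagonal interlaces with itself, so if inserting \<open>d\<close> spoils the
  non-crossing property, \<open>d\<close> crosses some member of \<open>T\<close>. Maximality thus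
  takes a form with a witness.\<close>

lemma triangulations_iff:
  "T \<in> triangulations n \<longleftrightarrow> T \<subseteq> diagonals n \<and> (\<forall>d\<in>T. \<forall>e\<in>T. \<not> crossing d e) \<and>
     (\<forall>d\<in>diagonals n - T. \<exists>e\<in>T. crossing d e)"
proof -
  have "non_crossing T \<longleftrightarrow> (\<forall>d\<in>T. \<forall>e\<in>T. \<not> crossing d e)"
    by (auto simp: non_crossing_def crossing_def)
  then show ?thesis unfolding triangulations_def mem_Collect_eq non_crossing_insert by meson
qed

lemma crossing_pairI: "i < k \<Longrightarrow> k < j \<Longrightarrow> j < l \<Longrightarrow> crossing {i, j} {k, l}"
  unfolding crossing_def interlaced_def by blast

lemma interlacedE:
  assumes "interlaced d e"
  obtains i j k l where "d = {i, j}" "e = {k, l}" "i < k" "k < j" "j < l"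
  using assms unfolding interlaced_def by blast

lemma diagonal_subset: "T \<in> triangulations n \<Longrightarrow> e \<in> T \<Longrightarrow> e \<subseteq> {..<n}"
  by (auto simp: triangulations_iff diagonals_def)

lemma sides_subset: "e \<in> sides n \<Longrightarrow> e \<subseteq> {..<n}"
  by (auto simp: sides_def)

lemma side_iff:
  "{x, y} \<in> sides n \<longleftrightarrow> x < n \<and> y < n \<and> (y = Suc x mod n \<or> x = Suc y mod n)"
  by (auto simp: sides_def doubleton_eq_iff)

lemma side_iff_less:
  assumes "x < y"
  shows "{x, y} \<in> sides n \<longleftrightarrow> y < n \<and> (y = Suc x \<or> x = 0 \<and> Suc y = n)"
  using assms by (auto simp: side_iff mod_Suc split: if_splits)

lemma diagonal_iff_less:
  assumes "x < y"
  shows "{x, y} \<in> diagonals n \<longleftrightarrow> y < n \<and> y \<noteq> Suc x \<and> (x = 0 \<longrightarrow> Suc y \<noteq> n)"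
  using assms side_iff_less[OF assms, of n] by (auto simp: diagonals_def)

lemma diagonalE:
  assumes "d \<in> diagonals n"
  obtains x y where "d = {x, y}" "x < y" "y < n" "y \<noteq> Suc x" "x = 0 \<Longrightarrow> Suc y \<noteq> n"
proof -
  obtain a b where ab: "d = {a, b}" "a \<noteq> b"
    using assms by (auto simp: diagonals_def card_2_iff)
  have "d = {min a b, max a b}" "min a b < max a b" using ab by (auto simp: min_def max_def)
  then show thesis using that assms diagonal_iff_less by metis
qed

section \<open>The dihedral action\<close>

text \<open>A rotation for \<open>s = 1\<close>, a reflection for \<open>s = -1\<close>. Integer
  parameters avoid truncated subtraction and make composition that of affine maps.\<close>

definition act :: "nat \<Rightarrow> int \<Rightarrow> int \<Rightarrow> nat \<Rightarrow> nat" where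
  "act n s z x = nat ((s * int x + z) mod int n)"

definition tact :: "nat \<Rightarrow> int \<Rightarrow> int \<Rightarrow> nat set set \<Rightarrow> nat set set" where
  "tact n s z T = (\<lambda>e. act n s z ` e) ` T"

lemma act_less: "0 < n \<Longrightarrow> act n s z x < n"
  by (simp add: act_def nat_less_iff)

lemma act_act:
  assumes "0 < n"
  shows "act n s z (act n s' z' x) = act n (s * s') (s * z' + z) x"
proof -
  have "(s * ((s' * int x + z') mod int n) + z) mod int n = (s * (s' * int x + z') + z) mod int n"
    by (metis mod_add_left_eq mod_mult_right_eq)
  then show ?thesis using assms by (simp add: act_def algebra_simps)
qed

lemma act_1_0: "x < n \<Longrightarrow> act n 1 0 x = x"
  by (simp add: act_def)

lemma act_mod: "act n s (z mod int n) x = act n s z x"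
  by (simp add: act_def mod_simps)

text \<open>The parameters of the inverse come from solving \<open>s * x + z = y\<close> with
  \<open>s * s = 1\<close>.\<close>

lemma act_inverse:
  assumes "x < n" "s = 1 \<or> s = -1"
  shows "act n s (- s * z) (act n s z x) = x" "act n s z (act n s (- s * z) x) = x"
  using assms act_act[of n s "- s * z" s z x] act_act[of n s z s "- s * z" x] act_1_0[of x n] by auto

text \<open>Only implications are demanded. For dihedral maps they turn into equivalences, since the
  inverse is again dihedral.\<close>

definition polygon_map :: "nat \<Rightarrow> (nat \<Rightarrow> nat) \<Rightarrow> bool" where
  "polygon_map n g \<longleftrightarrow> (\<forall>x<n. g x < n) \<and> (\<forall>e\<in>sides n. g ` e \<in> sides n) \<and>
     (\<forall>d e. d \<subseteq> {..<n} \<longrightarrow> e \<subseteq> {..<n} \<longrightarrow> crossing d e \<longrightarrow> crossing (g ` d) (g ` e))"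

lemma polygon_map_comp:
  assumes "polygon_map n f" "polygon_map n g"
  shows "polygon_map n (\<lambda>x. f (g x))"
proof -
  have [simp]: "(\<lambda>x. f (g x)) ` e = f ` (g ` e)" for e by auto
  have "g ` d \<subseteq> {..<n}" if "d \<subseteq> {..<n}" for d
    using assms(2) that by (auto simp: polygon_map_def)
  then show ?thesis using assms unfolding polygon_map_def by (simp add: image_subset_iff)
qed

lemma polygon_map_cong:
  assumes "polygon_map n f" "\<And>x. x < n \<Longrightarrow> f x = g x"
  shows "polygon_map n g"
proof -
  have "f ` e = g ` e" if "e \<subseteq> {..<n}" for e using assms(2) that by (auto intro!: image_cong)
  moreover have "\<forall>e\<in>sides n. g ` e \<in> sides n"
    using assms(1) sides_subset calculation by (metis polygon_map_def)
  ultimately show ?thesis using assms unfolding polygon_map_def by simp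
qed

lemma polygon_mapI:
  assumes "\<And>x. x < n \<Longrightarrow> g x < n"
    and "\<And>x. x < n \<Longrightarrow> {g x, g (Suc x mod n)} \<in> sides n"
    and "\<And>i j k l. i < k \<Longrightarrow> k < j \<Longrightarrow> j < l \<Longrightarrow> l < n \<Longrightarrow> crossing {g i, g j} {g k, g l}"
  shows "polygon_map n g"
proof -
  have il: "crossing (g ` d) (g ` e)" if "e \<subseteq> {..<n}" "interlaced d e" for d e
    using that(2)
  proof (rule interlacedE)
    fix i j k l assume "d = {i, j}" "e = {k, l}" "i < k" "k < j" "j < l"
    then show ?thesis using that(1) assms(3)[of i k j l] by simp
  qed
  have "crossing (g ` d) (g ` e)" if "d \<subseteq> {..<n}" "e \<subseteq> {..<n}" "crossing d e" for d e
    using that il[of d e] il[of e d] crossing_sym[of "g ` d"] unfolding crossing_def by metis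
  moreover have "g ` e \<in> sides n" if "e \<in> sides n" for e
    using that assms(2) by (auto simp: sides_def)
  ultimately show ?thesis using assms(1) by (auto simp: polygon_map_def)
qed

lemma polygon_map_rotate1:
  assumes "0 < n" shows "polygon_map n (act n 1 1)"
proof -
  have act1: "act n 1 1 x = Suc x mod n" for x
    by (metis act_def mult_1 nat_int of_nat_Suc add.commute zmod_int)
  show ?thesis
  proof (rule polygon_mapI)
    fix i j k l :: nat assume *: "i < k" "k < j" "j < l" "l < n"
    show "crossing {act n 1 1 i, act n 1 1 j} {act n 1 1 k, act n 1 1 l}"
    \<comment> \<open>If \<open>l\<close> is the last vertex it is sent to 0, and the image of
      \<open>{k, l}\<close> becomes the pair with the smallest endpoint.\<close>
    proof (cases "Suc l = n")
      case True
      then show ?thesis using * crossing_pairI[of 0 "Suc i" "Suc k" "Suc j"]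
        by (simp add: act1 crossing_sym insert_commute)
    next
      case False
      then show ?thesis using * crossing_pairI[of "Suc i" "Suc k" "Suc j" "Suc l"]
        by (simp add: act1)
    qed
  qed (use assms in \<open>auto simp: act1 side_iff\<close>)
qed

text \<open>The map is \<open>x\<close> to \<open>n - 1 - x\<close>. It reverses the chain
  \<open>i < k < j < l\<close>, which then starts in the image of \<open>{k, l}\<close>.\<close>

lemma polygon_map_reverse:
  assumes "0 < n" shows "polygon_map n (act n (-1) (-1))"
proof -
  have "polygon_map n (\<lambda>x. n - 1 - x)"
  proof (rule polygon_mapI)
    fix i j k l :: nat assume *: "i < k" "k < j" "j < l" "l < n"
    then show "crossing {n - 1 - i, n - 1 - j} {n - 1 - k, n - 1 - l}"
      using crossing_pairI[of "n - 1 - l" "n - 1 - j" "n - 1 - k" "n - 1 - i"]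
      by (simp add: crossing_sym insert_commute)
  qed (use assms in \<open>auto simp: side_iff mod_Suc\<close>)
  then show ?thesis
  proof (rule polygon_map_cong)
    fix x assume "x < n"
    have "(- 1 * int x + - 1) mod int n = (int n + (- int x - 1)) mod int n" by simp
    also have "\<dots> = int (n - 1 - x)" using \<open>x < n\<close> by (subst mod_pos_pos_trivial) auto
    finally show "n - 1 - x = act n (- 1) (- 1) x" by (simp only: act_def nat_int)
  qed
qed

text \<open>Rotation by one step and the reversal generate the group: a reflection with parameter
  \<open>z\<close> is the reversal followed by rotation by \<open>z + 1\<close>.\<close>

lemma polygon_map_act:
  assumes "0 < n" "s = 1 \<or> s = -1" shows "polygon_map n (act n s z)"
proof -
  have nat1: "polygon_map n (act n 1 (int m))" for m
  proof (induction m)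
    case 0
    show ?case by (rule polygon_map_cong[where f = id]) (auto simp: polygon_map_def act_1_0)
  next
    case (Suc m)
    show ?case
      using polygon_map_comp[OF polygon_map_rotate1[OF assms(1)] Suc]
      by (simp add: act_act assms add.commute)
  qed
  have rot: "polygon_map n (act n 1 z)" for z
    by (rule polygon_map_cong[OF nat1[of "nat (z mod int n)"]]) (use assms(1) in \<open>simp add: act_mod\<close>)
  show ?thesis
    using assms(2) rot polygon_map_comp[OF rot[of "z + 1"] polygon_map_reverse[OF assms(1)]]
    using assms(1) by (auto simp: act_act)
qed

lemma inj_on_act: "0 < n \<Longrightarrow> s = 1 \<or> s = -1 \<Longrightarrow> inj_on (act n s z) {..<n}"
  by (rule inj_on_inverseI[where g = "act n s (- s * z)"]) (use act_inverse in auto)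

lemma act_image_inverse:
  assumes "e \<subseteq> {..<n}" "s = 1 \<or> s = -1"
  shows "act n s (- s * z) ` act n s z ` e = e" "act n s z ` act n s (- s * z) ` e = e"
proof -
  have "act n s (- s * z) (act n s z x) = x" "act n s z (act n s (- s * z) x) = x" if "x \<in> e" for x
    using act_inverse[OF _ assms(2), of x n z] assms(1) that by blast+
  then show "act n s (- s * z) ` act n s z ` e = e" "act n s z ` act n s (- s * z) ` e = e"
    unfolding image_image by (metis (no_types, lifting) image_cong image_ident)+
qed

lemma tact_inverse:
  assumes "T \<subseteq> Pow {..<n}" "s = 1 \<or> s = -1"
  shows "tact n s (- s * z) (tact n s z T) = T" "tact n s z (tact n s (- s * z) T) = T"
proof -
  have "act n s (- s * z) ` act n s z ` e = e" "act n s z ` act n s (- s * z) ` e = e" if "e \<in> T" for e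
    using act_image_inverse[OF _ assms(2), of e n z] assms(1) that by blast+
  then show "tact n s (- s * z) (tact n s z T) = T" "tact n s z (tact n s (- s * z) T) = T"
    unfolding tact_def image_image by (metis (no_types, lifting) image_cong image_ident)+
qed

lemma act_image_subset: "0 < n \<Longrightarrow> act n s z ` e \<subseteq> {..<n}"
  by (auto simp: act_less)

lemma act_diagonal:
  assumes "0 < n" "s = 1 \<or> s = -1" "d \<in> diagonals n"
  shows "act n s z ` d \<in> diagonals n"
proof -
  have d: "d \<subseteq> {..<n}" "card d = 2" "d \<notin> sides n" using assms(3) by (auto simp: diagonals_def)
  have "card (act n s z ` d) = 2"
    using card_image[of "act n s z" d] inj_on_act[OF assms(1,2)] d inj_on_subset by metis
  moreover have "act n s z ` d \<notin> sides n"
    using polygon_map_act[OF assms(1,2), of "- s * z"] d act_image_inverse[OF d(1) assms(2)]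
    unfolding polygon_map_def by metis
  ultimately show ?thesis using act_image_subset[OF assms(1)] by (simp add: diagonals_def)
qed

lemma act_crossing_iff:
  assumes "0 < n" "s = 1 \<or> s = -1" "d \<subseteq> {..<n}" "e \<subseteq> {..<n}"
  shows "crossing (act n s z ` d) (act n s z ` e) \<longleftrightarrow> crossing d e"
  using polygon_map_act[OF assms(1,2), of "- s * z"] polygon_map_act[OF assms(1,2), of z]
    act_image_inverse(1)[OF _ assms(2), of _ n] act_image_subset[OF assms(1), of s z] assms(3,4)
  unfolding polygon_map_def by metis

lemma tact_triangulation:
  assumes "0 < n" "s = 1 \<or> s = -1" "T \<in> triangulations n"
  shows "tact n s z T \<in> triangulations n"
proof -
  have T: "T \<subseteq> diagonals n" "\<And>d e. d \<in> T \<Longrightarrow> e \<in> T \<Longrightarrow> \<not> crossing d e"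
    "\<And>d. d \<in> diagonals n \<Longrightarrow> d \<notin> T \<Longrightarrow> \<exists>e\<in>T. crossing d e"
    using assms(3) by (auto simp: triangulations_iff)
  have sub: "e \<subseteq> {..<n}" if "e \<in> T" for e using that assms(3) diagonal_subset by blast
  have "\<exists>e\<in>tact n s z T. crossing d e" if d: "d \<in> diagonals n" "d \<notin> tact n s z T" for d
  proof -
    \<comment> \<open>Maximality is tested on the preimage of \<open>d\<close>, where that of
      \<open>T\<close> applies.\<close>
    define d' where "d' = act n s (- s * z) ` d"
    have ds: "d \<subseteq> {..<n}" using d by (simp add: diagonals_def)
    have dd: "d = act n s z ` d'" unfolding d'_def using act_image_inverse(2)[OF ds assms(2)] by simp
    have "d' \<in> diagonals n" unfolding d'_def by (rule act_diagonal[OF assms(1,2) d(1)])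
    moreover have "d' \<notin> T" using d(2) dd by (auto simp: tact_def)
    ultimately obtain e where "e \<in> T" "crossing d' e" using T(3) by blast
    then have "crossing d (act n s z ` e)"
      using act_crossing_iff[OF assms(1,2), of d' e] sub act_image_subset[OF assms(1)] dd d'_def by metis
    then show ?thesis using \<open>e \<in> T\<close> by (auto simp: tact_def)
  qed
  moreover have "tact n s z T \<subseteq> diagonals n"
    using T(1) act_diagonal[OF assms(1,2)] by (auto simp: tact_def)
  moreover have "\<not> crossing d e" if "d \<in> tact n s z T" "e \<in> tact n s z T" for d e
    using that T(2) act_crossing_iff[OF assms(1,2)] sub by (auto simp: tact_def)
  ultimately show ?thesis by (auto simp: triangulations_iff)
qed

text \<open>Taking images maps triangles injectively to triangles, which bounds the count from one
  side; the inverse map supplies the other bound.\<close>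

lemma triangles_at_act_le:
  assumes "0 < n" "s = 1 \<or> s = -1" "T \<subseteq> Pow {..<n}" "v < n"
  shows "triangles_at n T v \<le> triangles_at n (tact n s z T) (act n s z v)"
  unfolding triangles_at_def
proof (rule card_inj_on_le[where f = "\<lambda>t. act n s z ` t"])
  let ?A = "{t. t \<subseteq> {..<n} \<and> card t = 3 \<and> v \<in> t \<and>
              (\<forall>x\<in>t. \<forall>y\<in>t. x \<noteq> y \<longrightarrow> {x, y} \<in> sides n \<union> T)}"
  let ?B = "{t. t \<subseteq> {..<n} \<and> card t = 3 \<and> act n s z v \<in> t \<and>
              (\<forall>x\<in>t. \<forall>y\<in>t. x \<noteq> y \<longrightarrow> {x, y} \<in> sides n \<union> tact n s z T)}"
  show "inj_on (\<lambda>t. act n s z ` t) ?A"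
  proof (rule inj_onI)
    fix t t' assume "t \<in> ?A" "t' \<in> ?A" "act n s z ` t = act n s z ` t'"
    then show "t = t'" using inj_on_image_eq_iff[OF inj_on_act[OF assms(1,2)], of t t' z] by simp
  qed
  show "finite ?B" by (rule finite_subset[of _ "Pow {..<n}"]) auto
  show "(\<lambda>t. act n s z ` t) ` ?A \<subseteq> ?B"
  proof (rule image_subsetI)
    fix t assume t: "t \<in> ?A"
    have "card (act n s z ` t) = 3"
      using t card_image[OF inj_on_subset[OF inj_on_act[OF assms(1,2), of z], of t]] by simp
    moreover have "{act n s z x, act n s z y} \<in> sides n \<union> tact n s z T"
      if "x \<in> t" "y \<in> t" "act n s z x \<noteq> act n s z y" for x y
    proof -
      have "x \<noteq> y" using that(3) by auto
      then have "{x, y} \<in> sides n \<union> T" using t that(1,2) by simp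
      moreover have "\<forall>e\<in>sides n. act n s z ` e \<in> sides n"
        using polygon_map_act[OF assms(1,2), of z] unfolding polygon_map_def by simp
      ultimately have "act n s z ` {x, y} \<in> sides n \<union> tact n s z T"
        unfolding tact_def by blast
      then show ?thesis by simp
    qed
    ultimately show "act n s z ` t \<in> ?B"
      using t act_image_subset[OF assms(1), of s z t] by blast
  qed
qed

lemma triangles_at_act:
  assumes "0 < n" "s = 1 \<or> s = -1" "T \<subseteq> Pow {..<n}" "v < n"
  shows "triangles_at n (tact n s z T) (act n s z v) = triangles_at n T v"
proof -
  have "tact n s z T \<subseteq> Pow {..<n}"
    using act_image_subset[OF assms(1), of s z] by (simp add: tact_def image_subset_iff)
  then have "triangles_at n (tact n s z T) (act n s z v)
        \<le> triangles_at n (tact n s (- s * z) (tact n s z T)) (act n s (- s * z) (act n s z v))"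
    using triangles_at_act_le[OF assms(1,2) _ act_less[OF assms(1)]] by blast
  then show ?thesis
    using triangles_at_act_le[OF assms, of z] tact_inverse[OF assms(3,2)] act_inverse[OF assms(4,2)]
    by simp
qed

section \<open>Ears of triangulations\<close>

lemma triangulation_nonempty:
  assumes "4 \<le> n" "T \<in> triangulations n"
  shows "T \<noteq> {}"
proof -
  have "{0, 2} \<in> diagonals n" using assms(1) by (subst diagonal_iff_less) auto
  then show ?thesis using assms(2) by (auto simp: triangulations_iff)
qed

text \<open>A diagonal of minimal length cuts off a single vertex.\<close>

lemma ear_exists:
  assumes "4 \<le> n" "T \<in> triangulations n"
  obtains v where "v < n" "v \<notin> \<Union>T"
proof -
  have TD: "T \<subseteq> diagonals n" and nc: "\<And>d e. d \<in> T \<Longrightarrow> e \<in> T \<Longrightarrow> \<not> crossing d e"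
    and mx: "\<And>d. d \<in> diagonals n \<Longrightarrow> d \<notin> T \<Longrightarrow> \<exists>e\<in>T. crossing d e"
    using assms(2) by (auto simp: triangulations_iff)
  define P where "P m \<longleftrightarrow> (\<exists>i. {i, i + m} \<in> T \<and> 0 < m)" for m
  obtain d where "d \<in> T" using triangulation_nonempty[OF assms] by blast
  then obtain x y where "d = {x, y}" "x < y" using TD by (metis diagonalE subsetD)
  then have "P (y - x)" using \<open>d \<in> T\<close> unfolding P_def by (intro exI[of _ x]) auto
  then have "P (LEAST m. P m)" by (rule LeastI)
  then obtain i m where m: "{i, i + m} \<in> T" "0 < m" and least: "\<And>m'. P m' \<Longrightarrow> m \<le> m'"
    using that Least_le[of P] unfolding P_def by blast
  have dg: "{i, i + m} \<in> diagonals n" using m TD by blast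
  then have im: "i + m < n" "m \<noteq> 1" "i = 0 \<Longrightarrow> Suc m \<noteq> n"
    using m(2) by (auto simp: diagonal_iff_less)
  have "m = 2"
  proof (rule ccontr)
    assume "m \<noteq> 2"
    then have m3: "3 \<le> m" using m(2) im by linarith
    \<comment> \<open>The shortened pair \<open>{i, j}\<close> is not in \<open>T\<close> by
      minimality, so some \<open>e\<close> in \<open>T\<close> crosses it. As \<open>e\<close> does
      not cross \<open>{i, i + m}\<close>, it must end in \<open>i + m\<close>, and then it is
      shorter than \<open>m\<close>.\<close>
    define j where "j = i + m - 1"
    have ij: "i < j" "Suc i \<noteq> j" "Suc j = i + m" using m3 by (auto simp: j_def)
    have "{i, j} \<in> diagonals n" using ij im by (subst diagonal_iff_less) auto
    moreover have "{i, j} \<notin> T"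
    proof
      assume "{i, j} \<in> T"
      then have "P (j - i)" using ij unfolding P_def by (intro exI[of _ i]) auto
      then show False using least[of "j - i"] ij by linarith
    qed
    ultimately obtain e where e: "e \<in> T" "crossing {i, j} e" using mx by blast
    obtain p q where pq: "e = {p, q}" "p < q" using e TD by (metis diagonalE subsetD)
    have "\<not> crossing {i, i + m} e" using nc m e by blast
    then have "\<not> (i < p \<and> p < i + m \<and> i + m < q)" "\<not> (p < i \<and> i < q \<and> q < i + m)"
      using crossing_pairI[of i p "i + m" q] crossing_pairI[of p i q "i + m"] crossing_sym pq by auto
    moreover have "i < p \<and> p < j \<and> j < q \<or> p < i \<and> i < q \<and> q < j"
      using e(2) ij(1) pq unfolding crossing_def
      by (auto elim!: interlacedE simp: doubleton_eq_iff)
    ultimately have "q = i + m" "i < p" "p < j" using ij by linarith+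
    then have "P (m - (p - i))" using e(1) pq ij unfolding P_def by (intro exI[of _ p]) (auto simp: add.commute)
    then show False using least[of "m - (p - i)"] \<open>i < p\<close> m by simp
  qed
  \<comment> \<open>\<open>Suc i\<close> is the only vertex strictly between the ends of
    \<open>{i, i + 2}\<close>, so a member of \<open>T\<close> ending there would cross that
    diagonal or be a side.\<close>
  have "Suc i \<notin> e" if e: "e \<in> T" for e
  proof
    assume "Suc i \<in> e"
    obtain p q where pq: "e = {p, q}" "p < q" "q < n" "q \<noteq> Suc p"
      using e TD by (metis diagonalE subsetD)
    have "\<not> crossing {i, i + m} e" using nc m e by blast
    then have "\<not> (i < p \<and> p < i + m \<and> i + m < q)" "\<not> (p < i \<and> i < q \<and> q < i + m)"
      using crossing_pairI[of i p "i + m" q] crossing_pairI[of p i q "i + m"] crossing_sym pq by auto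
    then show False using \<open>m = 2\<close> \<open>Suc i \<in> e\<close> pq by auto
  qed
  then show thesis using that[of "Suc i"] im \<open>m = 2\<close> by auto
qed

section \<open>Attaching and removing an ear at the last vertex\<close>

lemma side_Suc_iff:
  assumes "2 \<le> n" "x < n" "y < n"
  shows "{x, y} \<in> sides (Suc n) \<longleftrightarrow> {x, y} \<in> sides n \<and> {x, y} \<noteq> {0, n - 1} \<or> n = 2 \<and> {x, y} = {0, 1}"
  using assms by (auto simp: side_iff mod_Suc doubleton_eq_iff split: if_splits)

lemma side_Suc_last_iff:
  assumes "2 \<le> n" "x \<le> n"
  shows "{x, n} \<in> sides (Suc n) \<longleftrightarrow> x = 0 \<or> x = n - 1"
  using assms by (auto simp: side_iff mod_Suc split: if_splits)

text \<open>Vertex \<open>n\<close> is inserted into the closing side, which thereby becomes the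
  diagonal cutting off the new ear; no other pair of old vertices changes its status.\<close>

lemma diagonal_Suc_iff:
  assumes "3 \<le> n" "d \<subseteq> {..<n}"
  shows "d \<in> diagonals (Suc n) \<longleftrightarrow> d \<in> diagonals n \<or> d = {0, n - 1}"
proof -
  have *: "{x, y} \<in> diagonals (Suc n) \<longleftrightarrow> {x, y} \<in> diagonals n \<or> {x, y} = {0, n - 1}"
    if "x < y" "y < n" for x y
    using that assms(1) by (auto simp: diagonal_iff_less doubleton_eq_iff)
  show ?thesis
  proof
    assume d: "d \<in> diagonals (Suc n)"
    then obtain x y where "d = {x, y}" "x < y" using diagonalE by metis
    then show "d \<in> diagonals n \<or> d = {0, n - 1}" using * d assms by auto
  next
    assume "d \<in> diagonals n \<or> d = {0, n - 1}"
    then have "\<exists>x y. d = {x, y} \<and> x < y \<and> y < n"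
    proof
      assume "d = {0, n - 1}"
      then show ?thesis using assms(1) by (intro exI[of _ 0] exI[of _ "n - 1"]) auto
    qed (blast elim: diagonalE)
    then obtain x y where "d = {x, y}" "x < y" "y < n" by blast
    then show "d \<in> diagonals (Suc n)" using * \<open>d \<in> diagonals n \<or> d = {0, n - 1}\<close> by simp
  qed
qed

text \<open>The pair consists of the smallest and the largest vertex, so no endpoint inside
  \<open>{..<n}\<close> lies beyond it.\<close>

lemma not_crossing_last_side: "e \<subseteq> {..<n} \<Longrightarrow> \<not> crossing {0, n - 1} e"
  unfolding crossing_def by (auto elim!: interlacedE simp: doubleton_eq_iff)

lemma add_ear:
  assumes "3 \<le> n" "T \<in> triangulations n"
  shows "insert {0, n - 1} T \<in> triangulations (Suc n)"
proof -
  have T: "T \<subseteq> diagonals n" "\<And>d e. d \<in> T \<Longrightarrow> e \<in> T \<Longrightarrow> \<not> crossing d e"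
    "\<And>d. d \<in> diagonals n \<Longrightarrow> d \<notin> T \<Longrightarrow> \<exists>e\<in>T. crossing d e"
    using assms(2) by (auto simp: triangulations_iff)
  have sub: "e \<subseteq> {..<n}" if "e \<in> insert {0, n - 1} T" for e
    using that diagonal_subset[OF assms(2)] assms(1) by auto
  have "insert {0, n - 1} T \<subseteq> diagonals (Suc n)"
    using diagonal_Suc_iff[OF assms(1) sub] T(1) by auto
  moreover have "\<not> crossing d e" if "d \<in> insert {0, n - 1} T" "e \<in> insert {0, n - 1} T" for d e
    using that T(2)[of d e] not_crossing_last_side[OF sub, of d] not_crossing_last_side[OF sub, of e]
      crossing_sym[of d e] by auto
  moreover have "\<exists>e\<in>insert {0, n - 1} T. crossing d e"
    if d: "d \<in> diagonals (Suc n) - insert {0, n - 1} T" for d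
  proof (cases "d \<subseteq> {..<n}")
    case True
    then show ?thesis using d diagonal_Suc_iff[OF assms(1) True] T(3) by blast
  next
    case False
    obtain x y where xy: "d = {x, y}" "x < y" "y < Suc n" "y \<noteq> Suc x" "x = 0 \<Longrightarrow> Suc y \<noteq> Suc n"
      using d diagonalE by (metis DiffD1)
    then have "y = n" using False by (auto simp: less_Suc_eq)
    \<comment> \<open>\<open>x\<close> lies strictly between 0 and \<open>n - 1\<close>, since
      either of these values would make \<open>{x, n}\<close> a side.\<close>
    then have "crossing {0, n - 1} d"
      using xy crossing_pairI[of 0 x "n - 1" n] assms(1) by fastforce
    then show ?thesis using crossing_sym by blast
  qed
  ultimately show ?thesis by (auto simp: triangulations_iff)
qed

text \<open>Maximality puts \<open>{0, n - 1}\<close> into \<open>T\<close>: no member of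
  \<open>T\<close> reaches vertex \<open>n\<close>, and nothing on the other vertices crosses that
  pair.\<close>

lemma remove_ear:
  assumes "3 \<le> n" "T \<in> triangulations (Suc n)" "n \<notin> \<Union>T"
  obtains S where "S \<in> triangulations n" "T = insert {0, n - 1} S"
proof -
  have T: "T \<subseteq> diagonals (Suc n)" "\<And>d e. d \<in> T \<Longrightarrow> e \<in> T \<Longrightarrow> \<not> crossing d e"
    "\<And>d. d \<in> diagonals (Suc n) \<Longrightarrow> d \<notin> T \<Longrightarrow> \<exists>e\<in>T. crossing d e"
    using assms(2) by (auto simp: triangulations_iff)
  have sub: "e \<subseteq> {..<n}" if "e \<in> T" for e
    using that diagonal_subset[OF assms(2), of e] assms(3) by (force simp: less_Suc_eq)
  have s: "{0, n - 1} \<subseteq> {..<n}" using assms(1) by auto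
  have in_T: "{0, n - 1} \<in> T"
  proof (rule ccontr)
    assume "{0, n - 1} \<notin> T"
    then obtain e where "e \<in> T" "crossing {0, n - 1} e"
      using T(3)[of "{0, n - 1}"] diagonal_Suc_iff[OF assms(1) s] by blast
    then show False using not_crossing_last_side[OF sub] by blast
  qed
  have "\<exists>e\<in>T - {{0, n - 1}}. crossing d e" if d: "d \<in> diagonals n - (T - {{0, n - 1}})" for d
  proof -
    have ds: "d \<subseteq> {..<n}" using d by (auto simp: diagonals_def)
    have "{0, n - 1} \<notin> diagonals n" using assms(1) by (subst diagonal_iff_less) auto
    then have "d \<in> diagonals (Suc n)" "d \<notin> T" using d diagonal_Suc_iff[OF assms(1) ds] by auto
    then show ?thesis using T(3) not_crossing_last_side[OF ds] crossing_sym by blast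
  qed
  moreover have "T - {{0, n - 1}} \<subseteq> diagonals n"
    using T(1) sub diagonal_Suc_iff[OF assms(1)] by blast
  ultimately have "T - {{0, n - 1}} \<in> triangulations n"
    using T(2) by (auto simp: triangulations_iff)
  then show thesis using that[of "T - {{0, n - 1}}"] in_T by blast
qed

text \<open>The pair \<open>{0, n - 1}\<close> is a side of the smaller polygon and a chosen
  diagonal of the larger one, hence an edge in both. So triangles avoiding \<open>n\<close> are
  unchanged, and \<open>n\<close>, joined only to these two vertices, contributes a single new
  one.\<close>

lemma triangles_at_add_ear:
  assumes "3 \<le> n" "T \<in> triangulations n"
  shows "triangles_at (Suc n) (insert {0, n - 1} T) n = 1"
    and "v < n \<Longrightarrow> triangles_at (Suc n) (insert {0, n - 1} T) v =
       triangles_at n T v + (if v = 0 \<or> v = n - 1 then 1 else 0)"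
proof -
  let ?T = "insert {0, n - 1} T"
  have sub: "e \<subseteq> {..<n}" if "e \<in> ?T" for e
    using that diagonal_subset[OF assms(2)] assms(1) by auto
  have edge: "{x, y} \<in> sides (Suc n) \<union> ?T \<longleftrightarrow> {x, y} \<in> sides n \<union> T" if "x < n" "y < n" for x y
  proof -
    have "{0, n - 1} \<in> sides n" using assms(1) by (subst side_iff_less) auto
    then show ?thesis using side_Suc_iff[of n x y] that assms(1) by (cases "{x, y} = {0, n - 1}") simp_all
  qed
  have edge_last: "{x, n} \<in> sides (Suc n) \<union> ?T \<longleftrightarrow> x = 0 \<or> x = n - 1" if "x \<le> n" for x
  proof -
    have "{x, n} \<notin> ?T" using sub[of "{x, n}"] by (metis insert_subset lessThan_iff less_irrefl)
    then show ?thesis using side_Suc_last_iff[of n x] that assms(1) by simp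
  qed
  define E where "E = {t. t \<subseteq> {..<Suc n} \<and> card t = 3 \<and>
              (\<forall>x\<in>t. \<forall>y\<in>t. x \<noteq> y \<longrightarrow> {x, y} \<in> sides (Suc n) \<union> ?T)}"
  have E_last: "t \<in> E \<and> n \<in> t \<longleftrightarrow> t = {0, n - 1, n}" for t
  proof
    assume t: "t \<in> E \<and> n \<in> t"
    have "t \<subseteq> {0, n - 1, n}"
    proof
      fix x assume "x \<in> t"
      then show "x \<in> {0, n - 1, n}"
        using t edge_last[of x] by (cases "x = n") (auto simp: E_def)
    qed
    moreover have "card {0, n - 1, n} = 3" using assms(1) by auto
    ultimately show "t = {0, n - 1, n}" using t by (intro card_subset_eq) (auto simp: E_def)
  next
    assume t: "t = {0, n - 1, n}"
    have "{0, n - 1} \<in> sides (Suc n) \<union> ?T" "{0, n} \<in> sides (Suc n) \<union> ?T"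
      "{n - 1, n} \<in> sides (Suc n) \<union> ?T"
      using edge_last[of 0] edge_last[of "n - 1"] by simp_all
    moreover have "{x, y} = {0, n - 1} \<or> {x, y} = {0, n} \<or> {x, y} = {n - 1, n}"
      if "x \<in> t" "y \<in> t" "x \<noteq> y" for x y
      using that unfolding t by blast
    ultimately have "\<forall>x\<in>t. \<forall>y\<in>t. x \<noteq> y \<longrightarrow> {x, y} \<in> sides (Suc n) \<union> ?T" by metis
    then show "t \<in> E \<and> n \<in> t" using assms(1) t unfolding E_def by auto
  qed
  have E_first: "t \<in> E \<and> n \<notin> t \<longleftrightarrow> t \<subseteq> {..<n} \<and> card t = 3 \<and>
              (\<forall>x\<in>t. \<forall>y\<in>t. x \<noteq> y \<longrightarrow> {x, y} \<in> sides n \<union> T)" for t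
  proof -
    have "t \<subseteq> {..<Suc n} \<and> n \<notin> t \<longleftrightarrow> t \<subseteq> {..<n}" by (auto simp: less_Suc_eq)
    moreover have "{x, y} \<in> sides (Suc n) \<union> ?T \<longleftrightarrow> {x, y} \<in> sides n \<union> T"
      if "t \<subseteq> {..<n}" "x \<in> t" "y \<in> t" for x y
      using edge that by (meson lessThan_iff subsetD)
    ultimately show ?thesis unfolding E_def mem_Collect_eq by metis
  qed
  have tri: "triangles_at (Suc n) ?T u = card {t \<in> E. u \<in> t}" for u
    unfolding triangles_at_def E_def by (intro arg_cong[where f = card]) auto
  have "{t \<in> E. n \<in> t} = {{0, n - 1, n}}" using E_last by blast
  then show "triangles_at (Suc n) ?T n = 1" unfolding tri by simp
  assume v: "v < n"
  define A where "A = {t. t \<subseteq> {..<n} \<and> card t = 3 \<and> v \<in> t \<and>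
              (\<forall>x\<in>t. \<forall>y\<in>t. x \<noteq> y \<longrightarrow> {x, y} \<in> sides n \<union> T)}"
  define B where "B = {t. t = {0, n - 1, n} \<and> v \<in> t}"
  have "{t \<in> E. v \<in> t} = {t. (t \<in> E \<and> n \<notin> t) \<and> v \<in> t} \<union> {t. (t \<in> E \<and> n \<in> t) \<and> v \<in> t}" by blast
  then have "{t \<in> E. v \<in> t} = A \<union> B"
    unfolding E_first E_last A_def B_def by (simp only: conj_ac Collect_disj_eq)
  moreover have "A \<inter> B = {}" by (auto simp: A_def B_def)
  moreover have "finite A" unfolding A_def by (rule finite_subset[of _ "Pow {..<n}"]) auto
  moreover have "finite B" unfolding B_def by simp
  ultimately have "card {t \<in> E. v \<in> t} = card A + card B" by (simp add: card_Un_disjoint)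
  moreover have "B = (if v = 0 \<or> v = n - 1 then {{0, n - 1, n}} else {})"
    using v by (auto simp: B_def)
  ultimately show "triangles_at (Suc n) ?T v =
       triangles_at n T v + (if v = 0 \<or> v = n - 1 then 1 else 0)"
    unfolding tri by (simp add: triangles_at_def A_def)
qed

section \<open>Ear induction, and uniqueness from the triangle counts\<close>

lemma triangulations_3: "triangulations 3 = {{}}"
proof -
  have "diagonals 3 = {}" by (auto elim!: diagonalE)
  then show ?thesis by (auto simp: triangulations_iff)
qed

lemma triangles_at_3:
  assumes "v < 3" shows "triangles_at 3 {} v = 1"
proof -
  have all3: "t = {0, 1, 2}" if "t \<subseteq> {..<3}" "card t = 3" for t :: "nat set"
    using that card_subset_eq[of "{..<3}" t] by auto
  have sides3: "{0, 1} \<in> sides 3" "{1, 2} \<in> sides 3" "{0, 2} \<in> sides 3"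
    by (simp_all add: side_iff)
  have "{t. t \<subseteq> {..<3} \<and> card t = 3 \<and> v \<in> t \<and>
      (\<forall>x\<in>t. \<forall>y\<in>t. x \<noteq> y \<longrightarrow> {x, y} \<in> sides 3 \<union> {})} = {{0, 1, 2}}"
  proof (intro set_eqI iffI)
    fix t :: "nat set" assume t: "t \<in> {{0, 1, 2}}"
    have "x < 3 \<and> y < 3 \<and> x \<noteq> y \<longrightarrow> {x, y} \<in> sides 3" for x y :: nat
    proof -
      have "x < 3 \<Longrightarrow> x = 0 \<or> x = 1 \<or> x = 2" for x :: nat by linarith
      then show ?thesis using sides3 by (metis insert_commute)
    qed
    then show "t \<in> {t. t \<subseteq> {..<3} \<and> card t = 3 \<and> v \<in> t \<and>
      (\<forall>x\<in>t. \<forall>y\<in>t. x \<noteq> y \<longrightarrow> {x, y} \<in> sides 3 \<union> {})}"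
      using t assms by auto
  qed (use all3 in blast)
  then show ?thesis by (simp add: triangles_at_def)
qed

text \<open>An ear may sit at any vertex, while \<open>remove_ear\<close> wants it at the last one.
  The case \<open>act\<close> pays for rotating the ear there and back.\<close>

lemma triangulation_induct [consumes 2, case_names triangle ear act]:
  assumes "3 \<le> n" "T \<in> triangulations n"
    and "P 3 {}"
    and "\<And>n T. 3 \<le> n \<Longrightarrow> T \<in> triangulations n \<Longrightarrow> P n T \<Longrightarrow> P (Suc n) (insert {0, n - 1} T)"
    and "\<And>n T z. 3 \<le> n \<Longrightarrow> T \<in> triangulations n \<Longrightarrow> P n T \<Longrightarrow> P n (tact n 1 z T)"
  shows "P n T"
  using assms(1,2)
proof (induction n arbitrary: T rule: dec_induct)
  case base
  then show ?case using triangulations_3 assms(3) by simp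
next
  case (step n)
  obtain v where v: "v < Suc n" "v \<notin> \<Union>T" using ear_exists[of "Suc n" T] step by auto
  define z where "z = int n - int v"
  define S where "S = tact (Suc n) 1 z T"
  have sub: "T \<subseteq> Pow {..<Suc n}" using diagonal_subset[OF step.prems] by blast
  have S: "S \<in> triangulations (Suc n)" unfolding S_def using tact_triangulation step.prems by simp
  have "act (Suc n) 1 z v = n" by (simp add: act_def z_def)
  moreover have "inj_on (act (Suc n) 1 z) {..<Suc n}" by (simp add: inj_on_act)
  ultimately have "n \<notin> act (Suc n) 1 z ` e" if "e \<in> T" for e
    using v sub that inj_on_image_mem_iff[of "act (Suc n) 1 z" "{..<Suc n}" v e] by (auto dest: subsetD)
  then have "n \<notin> \<Union>S" unfolding S_def tact_def by blast
  then obtain S' where S': "S' \<in> triangulations n" "S = insert {0, n - 1} S'"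
    using remove_ear[of n S] S step by auto
  have "P (Suc n) S" using S' assms(4) step by simp
  then have "P (Suc n) (tact (Suc n) 1 (- 1 * z) S)" using assms(5) S step by simp
  then show ?case unfolding S_def by (subst (asm) tact_inverse(1)[OF sub]) auto
qed

text \<open>In the ear case the ends of the new diagonal gain a triangle. Positivity of the old
  counts, carried through the same induction, lifts theirs to at least 2, so the implication is
  vacuous there.\<close>

lemma triangles_at_1_ear:
  assumes "3 \<le> n" "T \<in> triangulations n" "v < n"
  shows "1 \<le> triangles_at n T v" "triangles_at n T v = 1 \<Longrightarrow> v \<notin> \<Union>T"
proof -
  have "\<forall>v<n. 1 \<le> triangles_at n T v \<and> (triangles_at n T v = 1 \<longrightarrow> v \<notin> \<Union>T)"
    using assms(1,2)
  proof (induction rule: triangulation_induct)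
    case triangle
    then show ?case by (simp add: triangles_at_3)
  next
    case (ear n T)
    have "1 \<le> triangles_at n T v" if "v < n" for v using that ear(3) by simp
    from this[of 0] this[of "n - 1"] have "0 < triangles_at n T 0" "0 < triangles_at n T (n - 1)"
      using ear(1) by simp_all
    then show ?case using triangles_at_add_ear[OF ear(1,2)] diagonal_subset[OF ear(2)] ear(1,3)
      by (auto simp: less_Suc_eq)
  next
    case (act n T z)
    have sub: "T \<subseteq> Pow {..<n}" using diagonal_subset[OF act(2)] by blast
    show ?case
    proof (intro allI impI)
      fix v assume "v < n"
      define u where "u = act n 1 (- 1 * z) v"
      have u: "u < n" "act n 1 z u = v"
        using act_less act_inverse(2)[OF \<open>v < n\<close>, of 1] act(1) by (auto simp: u_def)
      then have eq: "triangles_at n (tact n 1 z T) v = triangles_at n T u"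
        using triangles_at_act[of n 1 T u z] sub act(1) by auto
      have "v \<in> act n 1 z ` e \<Longrightarrow> u \<in> e" if "e \<in> T" for e
        using inj_on_act[of n 1 z] u sub that act(1) by (auto dest!: inj_onD)
      then show "1 \<le> triangles_at n (tact n 1 z T) v \<and>
          (triangles_at n (tact n 1 z T) v = 1 \<longrightarrow> v \<notin> \<Union>(tact n 1 z T))"
        unfolding eq using act(3) u by (auto simp: tact_def)
    qed
  qed
  then show "1 \<le> triangles_at n T v" "triangles_at n T v = 1 \<Longrightarrow> v \<notin> \<Union>T" using assms(3) by auto
qed

lemma tact_inj:
  assumes "0 < n" "s = 1 \<or> s = -1" "S \<subseteq> Pow {..<n}" "T \<subseteq> Pow {..<n}" "tact n s z S = tact n s z T"
  shows "S = T"
  using tact_inverse(1)[OF assms(3,2)] tact_inverse(1)[OF assms(4,2)] assms(5) by metis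

text \<open>Some vertex of \<open>S\<close> has count 1; equal counts make it an ear of
  \<open>T\<close> too. Cutting it off both leaves equal counts on a smaller polygon.\<close>

theorem triangulation_eqI:
  assumes "3 \<le> n" "S \<in> triangulations n" "T \<in> triangulations n"
    and "\<And>v. v < n \<Longrightarrow> triangles_at n S v = triangles_at n T v"
  shows "S = T"
  using assms
proof (induction n arbitrary: S T rule: dec_induct)
  case base
  then show ?case using triangulations_3 by simp
next
  case (step n)
  have sub: "S \<subseteq> Pow {..<Suc n}" "T \<subseteq> Pow {..<Suc n}"
    using diagonal_subset step.prems(1,2) by blast+
  have one: "\<exists>v<Suc n. triangles_at (Suc n) S v = 1"
    using step(1) step.prems(1)
  proof -
    have "3 \<le> Suc n" using step(1) by simp
    from this step.prems(1) show ?thesis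
    proof (induction rule: triangulation_induct)
      case triangle
      then show ?case using triangles_at_3[of 0] by force
    next
      case (ear n T)
      then show ?case using triangles_at_add_ear(1)[OF ear(1,2)] by blast
    next
      case (act n T z)
      then show ?case
        using triangles_at_act[of n 1 T _ z] act_less[of n 1 z] diagonal_subset[OF act(2)]
        by (metis PowI less_le_trans subsetI zero_less_numeral)
    qed
  qed
  then obtain v where v: "v < Suc n" "triangles_at (Suc n) S v = 1" by blast
  define z where "z = int n - int v"
  define S1 T1 where "S1 = tact (Suc n) 1 z S" and "T1 = tact (Suc n) 1 z T"
  have tri: "S1 \<in> triangulations (Suc n)" "T1 \<in> triangulations (Suc n)"
    unfolding S1_def T1_def using tact_triangulation step.prems by simp_all
  have z: "act (Suc n) 1 z v = n" using v by (simp add: act_def z_def)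
  have eq: "triangles_at (Suc n) S1 u = triangles_at (Suc n) T1 u" if "u < Suc n" for u
  proof -
    define x where "x = act (Suc n) 1 (- 1 * z) u"
    have "x < Suc n" "act (Suc n) 1 z x = u"
      using act_less act_inverse(2)[OF that, of 1] by (auto simp: x_def)
    then show ?thesis
      using triangles_at_act[of "Suc n" 1 S x z] triangles_at_act[of "Suc n" 1 T x z] sub step.prems(3)
      by (auto simp: S1_def T1_def)
  qed
  have "triangles_at (Suc n) S1 n = 1"
    using triangles_at_act[of "Suc n" 1 S v z] sub v z by (simp add: S1_def)
  then have ears: "n \<notin> \<Union>S1" "n \<notin> \<Union>T1"
    using triangles_at_1_ear(2)[of "Suc n" _ n] tri eq[of n] step(1) by simp_all
  obtain S2 T2 where S2: "S2 \<in> triangulations n" "S1 = insert {0, n - 1} S2"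
    and T2: "T2 \<in> triangulations n" "T1 = insert {0, n - 1} T2"
    using remove_ear[OF step(1)] tri ears by metis
  have "triangles_at n S2 u = triangles_at n T2 u" if "u < n" for u
    using triangles_at_add_ear(2)[OF step(1) S2(1) that] triangles_at_add_ear(2)[OF step(1) T2(1) that]
      eq[of u] that S2(2) T2(2) by simp
  then have "S2 = T2" using step.IH S2(1) T2(1) by blast
  then show ?case using tact_inj[of "Suc n" 1 S T z] sub S2 T2 S1_def T1_def by simp
qed

section \<open>Farey polygons\<close>

definition det2 :: "int \<times> int \<Rightarrow> int \<times> int \<Rightarrow> int" where
  "det2 u v = fst u * snd v - snd u * fst v"

lemma det2_simps [simp]:
  "det2 u u = 0" "det2 (- u) v = - det2 u v" "det2 u (- v) = - det2 u v"
  by (simp_all add: det2_def)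

lemma det2_diff: "det2 (u - u') v = det2 u v - det2 u' v" "det2 u (v - v') = det2 u v - det2 u v'"
  by (simp_all add: det2_def algebra_simps)

lemma det2_commute: "det2 u v = - det2 v u"
  by (simp add: det2_def)

text \<open>Cramer's rule for a basis of determinant 1.\<close>

lemma det2_expand:
  assumes "det2 u v = 1"
  shows "fst r = det2 r v * fst u + det2 u r * fst v" "snd r = det2 r v * snd u + det2 u r * snd v"
  using assms unfolding det2_def by algebra+

text \<open>Only W 0, ..., W (n - 1) are vertices; their antiperiodic continuation turns rotations of the
  polygon into shifts of the index.\<close>

definition farey_polygon :: "nat \<Rightarrow> (int \<Rightarrow> int \<times> int) \<Rightarrow> bool" where
  "farey_polygon n W \<longleftrightarrow> (\<forall>k. W (k + int n) = - W k) \<and> (\<forall>k. det2 (W k) (W (k + 1)) = 1) \<and>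
     (\<forall>k m. k < m \<longrightarrow> m < k + int n \<longrightarrow> 0 < det2 (W k) (W m))"

text \<open>The coefficient of \<open>W k\<close> in the three-term recurrence; these numbers form
  the quiddity cycle of a Conway-Coxeter frieze.\<close>

definition quiddity :: "(int \<Rightarrow> int \<times> int) \<Rightarrow> int \<Rightarrow> int" where
  "quiddity W k = det2 (W (k - 1)) (W (k + 1))"

text \<open>What a Farey polygon demands of one period. The last condition is the edge from
  \<open>w (n - 1)\<close> to the next vertex \<open>- w 0\<close>.\<close>

definition farey_window :: "nat \<Rightarrow> (nat \<Rightarrow> int \<times> int) \<Rightarrow> bool" where
  "farey_window n w \<longleftrightarrow> (\<forall>i j. i < j \<longrightarrow> j < n \<longrightarrow> 0 < det2 (w i) (w j)) \<and>
     (\<forall>i. Suc i < n \<longrightarrow> det2 (w i) (w (Suc i)) = 1) \<and> det2 (w 0) (w (n - 1)) = 1"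

text \<open>At both ends one neighbour lies in the adjacent period: the predecessor of
  \<open>w 0\<close> is \<open>- w (n - 1)\<close> and the successor of \<open>w (n - 1)\<close> is
  \<open>- w 0\<close>. The sign is absorbed by exchanging the arguments.\<close>

definition window_quiddity :: "nat \<Rightarrow> (nat \<Rightarrow> int \<times> int) \<Rightarrow> nat \<Rightarrow> int" where
  "window_quiddity n w j = (if j = 0 then det2 (w 1) (w (n - 1))
     else if j = n - 1 then det2 (w 0) (w (n - 2)) else det2 (w (j - 1)) (w (j + 1)))"

definition antiperiodic :: "nat \<Rightarrow> (nat \<Rightarrow> int \<times> int) \<Rightarrow> int \<Rightarrow> int \<times> int" where
  "antiperiodic n w k = (if even (k div int n) then w (nat (k mod int n)) else - w (nat (k mod int n)))"

lemma antiperiodic_eq: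
  assumes "r < n"
  shows "antiperiodic n w (q * int n + int r) = (if even q then w r else - w r)"
  using assms by (simp add: antiperiodic_def)

text \<open>Leaving the period changes the sign of one argument, and exchanging the arguments
  changes it back; the result is a determinant of window vectors in increasing order.\<close>

lemma det2_antiperiodic:
  assumes "r < n" "r < s" "s < r + n"
  shows "det2 (antiperiodic n w (q * int n + int r)) (antiperiodic n w (q * int n + int s)) =
    (if s < n then det2 (w r) (w s) else det2 (w (s - n)) (w r))"
proof (cases "s < n")
  case True
  then show ?thesis using antiperiodic_eq[OF assms(1)] antiperiodic_eq[OF True] by simp
next
  case False
  then have "q * int n + int s = (q + 1) * int n + int (s - n)" "s - n < n"
    using assms by (auto simp: algebra_simps of_nat_diff)
  then have "antiperiodic n w (q * int n + int s) = (if even q then - w (s - n) else w (s - n))"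
    by (simp only: antiperiodic_eq) simp
  then show ?thesis
    using antiperiodic_eq[OF assms(1), of w q] False det2_commute[of "w r" "w (s - n)"] by simp
qed

lemma int_divE:
  fixes k :: int
  assumes "0 < n"
  obtains q r where "r < n" "k = q * int n + int r"
proof (rule that)
  show "nat (k mod int n) < n" using assms by (simp add: nat_less_iff)
  show "k = (k div int n) * int n + int (nat (k mod int n))" using assms by simp
qed

lemma farey_polygon_antiperiodic:
  assumes "2 \<le> n" "farey_window n w"
  shows "farey_polygon n (antiperiodic n w)"
proof -
  have w: "\<And>i j. i < j \<Longrightarrow> j < n \<Longrightarrow> 0 < det2 (w i) (w j)"
    "\<And>i. Suc i < n \<Longrightarrow> det2 (w i) (w (Suc i)) = 1" "det2 (w 0) (w (n - 1)) = 1"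
    using assms(2) by (auto simp: farey_window_def)
  have n: "0 < n" using assms(1) by simp
  have "antiperiodic n w (k + int n) = - antiperiodic n w k" for k
    using assms(1) by (simp add: antiperiodic_def)
  moreover have "det2 (antiperiodic n w k) (antiperiodic n w (k + 1)) = 1" for k
  proof -
    obtain q r where k: "r < n" "k = q * int n + int r" using int_divE[OF n] by blast
    have "det2 (antiperiodic n w (q * int n + int r)) (antiperiodic n w (q * int n + int (Suc r))) = 1"
    proof (cases "Suc r < n")
      case False
      then have "Suc r = n" using k(1) by simp
      then show ?thesis using assms(1) w(3) by (subst det2_antiperiodic) auto
    qed (use w(2)[of r] assms(1) in \<open>subst det2_antiperiodic; auto\<close>)
    moreover have "k + 1 = q * int n + int (Suc r)" using k by simp
    ultimately show ?thesis by (simp only: k(2))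
  qed
  moreover have "0 < det2 (antiperiodic n w k) (antiperiodic n w m)" if "k < m" "m < k + int n" for k m
  proof -
    obtain q r where k: "r < n" "k = q * int n + int r" using int_divE[OF n] by blast
    define s where "s = nat (m - q * int n)"
    have s: "m = q * int n + int s" "r < s" "s < r + n" using that k by (auto simp: s_def)
    then show ?thesis
      using det2_antiperiodic[OF k(1) s(2,3), of w q] k w(1)[of r s] w(1)[of "s - n" r]
      by (cases "s < n") auto
  qed
  ultimately show ?thesis by (auto simp: farey_polygon_def)
qed

lemma quiddity_antiperiodic:
  assumes "3 \<le> n" "j < n"
  shows "quiddity (antiperiodic n w) (int j) = window_quiddity n w j"
proof (cases "j = 0")
  case True
  have *: "(- 1) * int n + int (n - 1) = - 1" "(- 1) * int n + int (n + 1) = 1"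
    using assms(1) by (auto simp: of_nat_diff)
  have "quiddity (antiperiodic n w) (int j) = det2 (antiperiodic n w ((- 1) * int n + int (n - 1)))
      (antiperiodic n w ((- 1) * int n + int (n + 1)))"
    unfolding * using True by (simp add: quiddity_def)
  also have "\<dots> = window_quiddity n w j"
    using assms True by (subst det2_antiperiodic) (auto simp: window_quiddity_def)
  finally show ?thesis .
next
  case False
  then have "quiddity (antiperiodic n w) (int j) =
     det2 (antiperiodic n w (0 * int n + int (j - 1))) (antiperiodic n w (0 * int n + int (j + 1)))"
    using assms by (simp add: quiddity_def of_nat_diff add.commute)
  also have "\<dots> = window_quiddity n w j"
  proof (cases "j = n - 1")
    case True
    then have *: "j - 1 = n - 2" "j + 1 - n = 0" "\<not> j + 1 < n" using assms by auto
    show ?thesis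
      using assms False True * by (subst det2_antiperiodic) (auto simp: window_quiddity_def)
  next
    case j: False
    then have "j + 1 < n" using assms by auto
    then show ?thesis using assms False j by (subst det2_antiperiodic) (auto simp: window_quiddity_def)
  qed
  finally show ?thesis .
qed

lemma farey_polygon_eq_antiperiodic:
  assumes "0 < n" "farey_polygon n W"
  shows "W = antiperiodic n (\<lambda>i. W (int i))"
proof
  fix k
  obtain q r where k: "r < n" "k = q * int n + int r" using int_divE[OF assms(1)] by blast
  have anti: "W (k + int n) = - W k" for k using assms(2) by (simp add: farey_polygon_def)
  have "W (q * int n + int r) = (if even q then W (int r) else - W (int r))" for q
  proof (induction q rule: int_induct[where k = 0])
    case (step1 i)
    then show ?case using anti[of "i * int n + int r"] by (simp add: algebra_simps)
  next
    case (step2 i)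
    then show ?case using anti[of "(i - 1) * int n + int r"]
      by (simp add: algebra_simps split: if_splits)
  qed simp
  then show "W k = antiperiodic n (\<lambda>i. W (int i)) k" using k by (simp add: antiperiodic_eq)
qed

lemma farey_window_restrict:
  assumes "2 \<le> n" "farey_polygon n W"
  shows "farey_window n (\<lambda>i. W (int i))"
proof -
  have W: "\<And>k. W (k + int n) = - W k" "\<And>k. det2 (W k) (W (k + 1)) = 1"
    "\<And>k m. k < m \<Longrightarrow> m < k + int n \<Longrightarrow> 0 < det2 (W k) (W m)"
    using assms(2) by (auto simp: farey_polygon_def)
  have "det2 (W 0) (W (int (n - 1))) = 1"
    using W(1)[of 0] W(2)[of "int n - 1"] det2_commute[of "W 0"] assms(1) by (simp add: of_nat_diff)
  then show ?thesis using W(2)[of "int _"] W(3) by (auto simp: farey_window_def add.commute)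
qed

lemma quiddity_restrict:
  assumes "3 \<le> n" "farey_polygon n W" "j < n"
  shows "quiddity W (int j) = window_quiddity n (\<lambda>i. W (int i)) j"
  using farey_polygon_eq_antiperiodic[OF _ assms(2)] quiddity_antiperiodic[OF assms(1,3)] assms(1)
  by (metis less_le_trans zero_less_numeral)

text \<open>Both arguments of the determinant change sign when the index grows by
  \<open>n\<close>.\<close>

lemma quiddity_mod:
  assumes "0 < n" "farey_polygon n W"
  shows "quiddity W (k mod int n) = quiddity W k"
proof -
  have anti: "W (k + int n) = - W k" for k using assms(2) by (simp add: farey_polygon_def)
  have "quiddity W (k + int n) = quiddity W k" for k
    using anti[of "k - 1"] anti[of "k + 1"] by (simp add: quiddity_def algebra_simps)
  then have "quiddity W (q * int n + r) = quiddity W r" for q r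
  proof (induction q rule: int_induct[where k = 0])
    case (step1 i)
    then show ?case by (metis add.assoc add.commute distrib_left mult.commute mult.right_neutral)
  next
    case (step2 i)
    have "(i - 1) * int n + r + int n = i * int n + r" by (simp add: algebra_simps)
    then show ?case using step2 by metis
  qed simp
  from this[of "k div int n" "k mod int n"] show ?thesis by simp
qed

lemma quiddity_pos: "3 \<le> n \<Longrightarrow> farey_polygon n W \<Longrightarrow> 0 < quiddity W k"
  by (simp add: farey_polygon_def quiddity_def)

text \<open>\<open>W (k + 1)\<close> is expanded in the basis \<open>W (k - 1)\<close>,
  \<open>W k\<close>; the coefficient of \<open>W (k - 1)\<close> is
  \<open>det2 (W (k + 1)) (W k) = -1\<close>.\<close>

lemma farey_recurrence:
  assumes "farey_polygon n W"
  shows "fst (W (k + 1)) = quiddity W k * fst (W k) - fst (W (k - 1))"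
    "snd (W (k + 1)) = quiddity W k * snd (W k) - snd (W (k - 1))"
proof -
  have W: "det2 (W k) (W (k + 1)) = 1" for k using assms(1) by (simp add: farey_polygon_def)
  show "fst (W (k + 1)) = quiddity W k * fst (W k) - fst (W (k - 1))"
    "snd (W (k + 1)) = quiddity W k * snd (W k) - snd (W (k - 1))"
    using det2_expand[of "W (k - 1)" "W k" "W (k + 1)"] W[of k] W[of "k - 1"]
      det2_commute[of "W k" "W (k + 1)"] by (simp_all add: quiddity_def)
qed

text \<open>Without an ear the determinants with vertex 0 would keep growing along the polygon.\<close>

lemma farey_ear_exists:
  assumes "3 \<le> n" "farey_polygon n W"
  obtains k where "quiddity W k = 1"
proof -
  have W: "\<And>k. W (k + int n) = - W k" "\<And>k. det2 (W k) (W (k + 1)) = 1"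
    "\<And>k m. k < m \<Longrightarrow> m < k + int n \<Longrightarrow> 0 < det2 (W k) (W m)"
    using assms(2) by (auto simp: farey_polygon_def)
  define f where "f m = det2 (W 0) (W (int m))" for m
  have rec: "f (Suc (Suc m)) = quiddity W (int m + 1) * f (Suc m) - f m" for m
  proof -
    have "int (Suc (Suc m)) = int m + 1 + 1" "int (Suc m) = int m + 1" "int m = int m + 1 - 1" by simp_all
    then show ?thesis
      unfolding f_def det2_def using farey_recurrence[OF assms(2), of "int m + 1"]
      by (simp only: right_diff_distrib) (simp add: algebra_simps)
  qed
  have "\<exists>k. quiddity W k = 1"
  proof (rule ccontr)
    assume "\<nexists>k. quiddity W k = 1"
    then have ge2: "2 \<le> quiddity W k" for k
      using quiddity_pos[OF assms, of k] by (metis int_one_le_iff_zero_less order_le_less one_add_one zless_imp_add1_zle)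
    \<comment> \<open>With quiddities at least 2 the recurrence makes \<open>f\<close> convex, so no
      increment falls below the first one, which is 1.\<close>
    have "int m \<le> f m \<and> f m + 1 \<le> f (Suc m)" if "Suc m < n" for m
      using that
    proof (induction m)
      case 0
      show ?case using W(2)[of 0] by (simp add: f_def)
    next
      case (Suc m)
      have IH: "int m \<le> f m" "f m + 1 \<le> f (Suc m)" using Suc by simp_all
      have mul: "2 * f (Suc m) \<le> quiddity W (int m + 1) * f (Suc m)"
        using IH by (intro mult_right_mono ge2) auto
      have "f (Suc m) + 1 \<le> f (Suc (Suc m))" unfolding rec using IH mul by linarith
      then show ?case using IH by simp
    qed
    \<comment> \<open>Growth asks for a value of at least \<open>n - 1\<close>, but the closing edge
      of the polygon has determinant 1.\<close>
    from this[of "n - 2"] have "int (n - 2) + 1 \<le> f (n - 1)"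
      using assms(1) by (simp add: Suc_diff_Suc numeral_2_eq_2)
    moreover have "f (n - 1) = 1"
      using farey_window_restrict[OF _ assms(2)] assms(1) by (simp add: farey_window_def f_def)
    ultimately show False using assms(1) by simp
  qed
  then show thesis using that by blast
qed

text \<open>The new vertex is the mediant of \<open>w (n - 1)\<close> and \<open>- w 0\<close>, the
  ends of the closing edge in the antiperiodic continuation. Hence its determinant with
  \<open>w i\<close> is a sum of two determinants of old vertices.\<close>

lemma farey_window_add_ear:
  assumes "3 \<le> n" "farey_window n w" "w n = w (n - 1) - w 0"
  shows "farey_window (Suc n) w" "window_quiddity (Suc n) w n = 1"
    "j < n \<Longrightarrow> window_quiddity (Suc n) w j = window_quiddity n w j + (if j = 0 \<or> j = n - 1 then 1 else 0)"
proof -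
  have w: "\<And>i j. i < j \<Longrightarrow> j < n \<Longrightarrow> 0 < det2 (w i) (w j)"
    "\<And>i. Suc i < n \<Longrightarrow> det2 (w i) (w (Suc i)) = 1" "det2 (w 0) (w (n - 1)) = 1"
    using assms(2) by (auto simp: farey_window_def)
  have pos: "0 < det2 (w i) (w n)" if "i < n" for i
  proof -
    have "det2 (w i) (w n) = det2 (w i) (w (n - 1)) + det2 (w 0) (w i)"
      using det2_commute[of "w 0" "w i"] by (simp add: assms(3) det2_diff)
    moreover have "i = 0 \<or> i = n - 1 \<or> 0 < i \<and> i < n - 1" using that by auto
    ultimately show ?thesis using w(1)[of 0 i] w(1)[of i "n - 1"] w(3) that by auto
  qed
  have last: "det2 (w (n - 1)) (w n) = 1" "det2 (w 0) (w n) = 1"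
    using w(3) det2_commute[of "w (n - 1)" "w 0"] by (simp_all add: assms(3) det2_diff)
  have "det2 (w i) (w (Suc i)) = 1" if "Suc i < Suc n" for i
    using that w(2)[of i] last(1) by (cases "Suc i = n") auto
  then show "farey_window (Suc n) w"
    using w(1) pos last(2) by (auto simp: farey_window_def less_Suc_eq)
  show "window_quiddity (Suc n) w n = 1" using assms(1) w(3) by (simp add: window_quiddity_def)
  have "det2 (w 1) (w n) = det2 (w 1) (w (n - 1)) + 1"
    using w(2)[of 0] assms(1) det2_commute[of "w 0" "w 1"] by (simp add: assms(3) det2_diff)
  moreover have "det2 (w (n - 2)) (w n) = det2 (w 0) (w (n - 2)) + 1"
    using w(2)[of "n - 2"] assms(1) det2_commute[of "w 0" "w (n - 2)"]
    by (simp add: assms(3) det2_diff Suc_diff_Suc numeral_2_eq_2)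
  moreover have "n - 1 - 1 = n - 2" "n - 1 + 1 = n" using assms(1) by auto
  ultimately show "j < n \<Longrightarrow>
      window_quiddity (Suc n) w j = window_quiddity n w j + (if j = 0 \<or> j = n - 1 then 1 else 0)"
    using assms(1) by (auto simp: window_quiddity_def)
qed

text \<open>Quiddity 1 at \<open>n\<close> says \<open>det2 (w 0) (w (n - 1)) = 1\<close>. This
  closes the shorter window and makes \<open>w 0\<close>, \<open>w (n - 1)\<close> a basis in which
  \<open>w n\<close> can be expanded.\<close>

lemma farey_window_remove_ear:
  assumes "3 \<le> n" "farey_window (Suc n) w" "window_quiddity (Suc n) w n = 1"
  shows "farey_window n w" "w n = w (n - 1) - w 0"
proof -
  have w: "\<And>i j. i < j \<Longrightarrow> j < Suc n \<Longrightarrow> 0 < det2 (w i) (w j)"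
    "\<And>i. Suc i < Suc n \<Longrightarrow> det2 (w i) (w (Suc i)) = 1" "det2 (w 0) (w n) = 1"
    using assms(2) by (auto simp: farey_window_def)
  have 1: "det2 (w 0) (w (n - 1)) = 1" using assms by (simp add: window_quiddity_def)
  then show "farey_window n w" using w by (auto simp: farey_window_def)
  have "det2 (w n) (w (n - 1)) = -1"
    using w(2)[of "n - 1"] assms(1) det2_commute[of "w n" "w (n - 1)"] by simp
  then show "w n = w (n - 1) - w 0"
    using det2_expand[OF 1, of "w n"] w(3) by (simp add: prod_eq_iff)
qed

section \<open>Farey polygons and triangulations\<close>

text \<open>Periodic extension of the counts to all integers, on which the dihedral group acts by
  \<open>k\<close> to \<open>s * k + z\<close>.\<close>

definition triangle_count :: "nat \<Rightarrow> nat set set \<Rightarrow> int \<Rightarrow> int" where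
  "triangle_count n T k = int (triangles_at n T (nat (k mod int n)))"

lemma triangle_count_tact:
  assumes "0 < n" "s = 1 \<or> s = -1" "T \<in> triangulations n"
  shows "triangle_count n (tact n s z T) (s * k + z) = triangle_count n T k"
proof -
  have "(s * (k mod int n) + z) mod int n = (s * k + z) mod int n"
    by (metis mod_add_left_eq mod_mult_right_eq)
  then have "act n s z (nat (k mod int n)) = nat ((s * k + z) mod int n)"
    using assms(1) by (simp add: act_def)
  moreover have "T \<subseteq> Pow {..<n}" using diagonal_subset[OF assms(3)] by blast
  moreover have "nat (k mod int n) < n" using assms(1) by (simp add: nat_less_iff)
  ultimately show ?thesis
    using triangles_at_act[OF assms(1,2), of T "nat (k mod int n)" z] by (simp add: triangle_count_def)
qed

lemma triangle_count_eqI: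
  assumes "3 \<le> n" "S \<in> triangulations n" "T \<in> triangulations n"
    and "\<And>k. triangle_count n S k = triangle_count n T k"
  shows "S = T"
proof (rule triangulation_eqI[OF assms(1-3)])
  fix v assume "v < n"
  then show "triangles_at n S v = triangles_at n T v"
    using assms(4)[of "int v"] by (simp add: triangle_count_def)
qed

lemma farey_polygon_shift: "farey_polygon n W \<Longrightarrow> farey_polygon n (\<lambda>k. W (k + z))"
  by (simp add: farey_polygon_def) (metis add.assoc add.commute add_less_cancel_left)

lemma quiddity_shift: "quiddity (\<lambda>k. W (k + z)) k = quiddity W (k + z)"
  by (simp add: quiddity_def algebra_simps)

definition realises :: "nat \<Rightarrow> (int \<Rightarrow> int \<times> int) \<Rightarrow> nat set set \<Rightarrow> bool" where
  "realises n W T \<longleftrightarrow> farey_polygon n W \<and> T \<in> triangulations n \<and>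
     (\<forall>k. quiddity W k = triangle_count n T k)"

lemma realises_windowI:
  assumes "0 < n" "farey_polygon n W" "T \<in> triangulations n"
    and "\<And>j. j < n \<Longrightarrow> quiddity W (int j) = int (triangles_at n T j)"
  shows "realises n W T"
proof -
  have "quiddity W k = triangle_count n T k" for k
    using quiddity_mod[OF assms(1,2), of k] assms(4)[of "nat (k mod int n)"] assms(1)
    by (simp add: triangle_count_def nat_less_iff)
  then show ?thesis using assms by (simp add: realises_def)
qed

lemma realises_shift:
  assumes "0 < n" "realises n (\<lambda>k. W (k + z)) T"
  shows "realises n W (tact n 1 z T)"
proof -
  have T: "T \<in> triangulations n" and fp: "farey_polygon n (\<lambda>k. W (k + z))"
    using assms(2) by (simp_all add: realises_def)
  have "quiddity W k = triangle_count n (tact n 1 z T) k" for k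
    using triangle_count_tact[OF assms(1) _ T, of 1 z "k - z"] assms(2) quiddity_shift[of W z "k - z"]
    by (simp add: realises_def)
  then show ?thesis
    using tact_triangulation[OF assms(1) _ T] farey_polygon_shift[OF fp, of "- z"]
    by (simp add: realises_def)
qed

text \<open>One sequence \<open>w\<close> serves both lengths: \<open>antiperiodic n\<close> reads
  only the entries below \<open>n\<close>, so the new vertex can be stored at position
  \<open>n\<close>.\<close>

lemma realises_ear:
  assumes "3 \<le> n" "realises n (antiperiodic n w) T" "farey_window n w" "w n = w (n - 1) - w 0"
  shows "realises (Suc n) (antiperiodic (Suc n) w) (insert {0, n - 1} T)"
proof (rule realises_windowI)
  have T: "T \<in> triangulations n" and q: "\<And>k. quiddity (antiperiodic n w) k = triangle_count n T k"
    using assms(2) by (simp_all add: realises_def)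
  show "farey_polygon (Suc n) (antiperiodic (Suc n) w)"
    using farey_window_add_ear(1)[OF assms(1,3,4)] farey_polygon_antiperiodic assms(1) by simp
  show "insert {0, n - 1} T \<in> triangulations (Suc n)" by (rule add_ear[OF assms(1) T])
  fix j assume j: "j < Suc n"
  show "quiddity (antiperiodic (Suc n) w) (int j) = int (triangles_at (Suc n) (insert {0, n - 1} T) j)"
  proof (cases "j = n")
    case True
    then show ?thesis
      using quiddity_antiperiodic[of "Suc n" j w] farey_window_add_ear(2)[OF assms(1,3,4)]
        triangles_at_add_ear(1)[OF assms(1) T] assms(1) by simp
  next
    case False
    then have "j < n" using j by simp
    then show ?thesis
      using quiddity_antiperiodic[of "Suc n" j w] farey_window_add_ear(3)[OF assms(1,3,4), of j]
        triangles_at_add_ear(2)[OF assms(1) T, of j] assms(1) q[of "int j"]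
        quiddity_antiperiodic[OF assms(1), of j w] by (simp add: triangle_count_def)
  qed
qed simp

theorem farey_polygon_realises:
  assumes "3 \<le> n" "farey_polygon n W"
  shows "\<exists>T. realises n W T"
  using assms
proof (induction n arbitrary: W rule: dec_induct)
  case base
  \<comment> \<open>In a triangle any two vertices are adjacent, so all three quiddities are
    determinants of edges.\<close>
  have "realises 3 W {}"
  proof (rule realises_windowI)
    fix j :: nat assume j: "j < 3"
    have "farey_window 3 (\<lambda>i. W (int i))" using farey_window_restrict[OF _ base] by simp
    then show "quiddity W (int j) = int (triangles_at 3 {} j)"
      using quiddity_restrict[OF _ base j] triangles_at_3[OF j] j
      by (auto simp: farey_window_def window_quiddity_def numeral_3_eq_3 less_Suc_eq numeral_2_eq_2)
  qed (use base triangulations_3 in auto)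
  then show ?case by blast
next
  case (step n)
  obtain k where k: "quiddity W k = 1" using farey_ear_exists[OF _ step.prems] step(1) by auto
  \<comment> \<open>The shift moves the ear from \<open>k\<close> to \<open>n\<close>, the last of
    the \<open>n + 1\<close> vertices.\<close>
  define z where "z = k - int n"
  define V where "V = (\<lambda>i. W (i + z))"
  define w where "w = (\<lambda>i. V (int i))"
  have V: "farey_polygon (Suc n) V" unfolding V_def by (rule farey_polygon_shift[OF step.prems])
  have "quiddity V (int n) = 1" using k by (simp add: V_def quiddity_shift z_def)
  then have "window_quiddity (Suc n) w n = 1"
    using quiddity_restrict[OF _ V, of n] step(1) by (simp add: w_def)
  moreover have "farey_window (Suc n) w"
    unfolding w_def using farey_window_restrict[OF _ V] step(1) by simp
  ultimately have w: "farey_window n w" "w n = w (n - 1) - w 0"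
    using farey_window_remove_ear[OF step(1)] by blast+
  then obtain T where "realises n (antiperiodic n w) T"
    using step.IH farey_polygon_antiperiodic step(1) by force
  then have "realises (Suc n) (antiperiodic (Suc n) w) (insert {0, n - 1} T)"
    using realises_ear step(1) w by blast
  then have "realises (Suc n) V (insert {0, n - 1} T)"
    using farey_polygon_eq_antiperiodic[OF _ V] by (simp add: w_def)
  then show ?case using realises_shift[of "Suc n" W z] unfolding V_def by blast
qed

theorem triangulation_realised:
  assumes "3 \<le> n" "T \<in> triangulations n"
  shows "\<exists>W. realises n W T"
  using assms
proof (induction rule: triangulation_induct)
  case triangle
  \<comment> \<open>The basic Farey triangle, with slopes 0, 1 and infinity.\<close>
  define w :: "nat \<Rightarrow> int \<times> int" where "w i = (if i = 0 then (1, 0) else if i = 1 then (1, 1) else (0, 1))" for i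
  have "farey_window 3 w" by (auto simp: farey_window_def w_def det2_def)
  then have "farey_polygon 3 (antiperiodic 3 w)" by (simp add: farey_polygon_antiperiodic)
  moreover have "quiddity (antiperiodic 3 w) (int j) = int (triangles_at 3 {} j)" if "j < 3" for j
    using quiddity_antiperiodic[of 3 j w] triangles_at_3[OF that] that
    by (auto simp: window_quiddity_def w_def det2_def)
  ultimately have "realises 3 (antiperiodic 3 w) {}"
    using realises_windowI[of 3 "antiperiodic 3 w" "{}"] triangulations_3 by simp
  then show ?case by blast
next
  case (ear n T)
  then obtain W where W: "realises n W T" by blast
  define w where "w = (\<lambda>i. W (int i))(n := W (int (n - 1)) - W 0)"
  have fp: "farey_polygon n W" using W by (simp add: realises_def)
  have "farey_window n (\<lambda>i. W (int i))" using farey_window_restrict[OF _ fp] ear(1) by simp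
  moreover have w_eq: "w i = W (int i)" if "i < n" for i using that by (simp add: w_def)
  ultimately have fw: "farey_window n w"
    using ear(1) w_eq[of 0] w_eq[of "n - 1"] by (simp add: farey_window_def)
  have "antiperiodic n w = antiperiodic n (\<lambda>i. W (int i))"
    using ear(1) by (simp add: antiperiodic_def fun_eq_iff w_eq nat_less_iff)
  then have "realises n (antiperiodic n w) T"
    using W farey_polygon_eq_antiperiodic[OF _ fp] ear(1) by simp
  moreover have "w n = w (n - 1) - w 0"
    using ear(1) w_eq[of 0] w_eq[of "n - 1"] by (simp add: w_def)
  ultimately show ?case using realises_ear[OF ear(1)] fw by blast
next
  case (act n T z)
  then obtain W where "realises n W T" by blast
  then have "realises n (\<lambda>k. W (k + - z + z)) T" by simp
  then have "realises n (\<lambda>k. W (k + - z)) (tact n 1 z T)"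
    using realises_shift[of n "\<lambda>k. W (k + - z)" z T] act(1) by simp
  then show ?case by blast
qed

section \<open>Dihedral equivalence\<close>

text \<open>Agreement is claimed on vertices only, since the reflections in \<open>dihedral\<close>
  are written with truncated subtraction.\<close>

lemma dihedral_act:
  assumes "0 < n"
  shows "g \<in> dihedral n \<Longrightarrow> \<exists>s z. (s = 1 \<or> s = -1) \<and> (\<forall>x<n. g x = act n s z x)"
    and "s = 1 \<or> s = -1 \<Longrightarrow> \<exists>g\<in>dihedral n. \<forall>x<n. g x = act n s z x"
proof -
  have rot: "(r + x) mod n = act n 1 (int r) x" for r x
    by (simp add: act_def add.commute nat_int flip: of_nat_add zmod_int)
  have refl: "(r + (n - x)) mod n = act n (- 1) (int r) x" if "x < n" for r x
  proof -
    have "(- 1 * int x + int r) mod int n = (int n + (- 1 * int x + int r)) mod int n" by simp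
    also have "\<dots> = int (r + (n - x)) mod int n" using that by (simp add: of_nat_diff algebra_simps)
    finally show ?thesis by (metis act_def nat_int zmod_int)
  qed
  show "g \<in> dihedral n \<Longrightarrow> \<exists>s z. (s = 1 \<or> s = -1) \<and> (\<forall>x<n. g x = act n s z x)"
    unfolding dihedral_def using rot refl by blast
  define r where "r = nat (z mod int n)"
  have r: "r < n" "\<And>s x. act n s (int r) x = act n s z x"
    using assms by (simp_all add: r_def nat_less_iff act_mod)
  have *: "(\<lambda>k. (r + k) mod n) \<in> dihedral n" "(\<lambda>k. (r + (n - k)) mod n) \<in> dihedral n"
    using r(1) by (auto simp: dihedral_def)
  show "\<exists>g\<in>dihedral n. \<forall>x<n. g x = act n s z x" if "s = 1 \<or> s = -1"
    using that
  proof
    assume "s = 1"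
    then show ?thesis using * rot r(2) by (intro bexI[of _ "\<lambda>k. (r + k) mod n"]) auto
  next
    assume "s = -1"
    then show ?thesis using * refl r(2) by (intro bexI[of _ "\<lambda>k. (r + (n - k)) mod n"]) auto
  qed
qed

text \<open>As counts determine triangulations, dihedral equivalence becomes an identity between
  functions on the integers, the form in which characteristic sequences can be compared.\<close>

lemma dihedral_rel_iff:
  assumes "3 \<le> n"
  shows "(S, T) \<in> dihedral_rel n \<longleftrightarrow> S \<in> triangulations n \<and> T \<in> triangulations n \<and>
    (\<exists>s z. (s = 1 \<or> s = -1) \<and> (\<forall>k. triangle_count n T (s * k + z) = triangle_count n S k))"
proof -
  have n: "0 < n" using assms by simp
  have im: "(\<lambda>e. g ` e) ` S = tact n s z S"
    if "S \<in> triangulations n" "\<forall>x<n. g x = act n s z x" for S g s z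
    unfolding tact_def
    by (intro image_cong) (use that diagonal_subset[OF that(1)] in auto)
  have "(\<exists>g\<in>dihedral n. T = (\<lambda>e. g ` e) ` S) \<longleftrightarrow> (\<exists>s z. (s = 1 \<or> s = -1) \<and> T = tact n s z S)"
    if "S \<in> triangulations n"
    using dihedral_act[OF n] im[OF that] by metis
  moreover have eq: "T = tact n s z S \<longleftrightarrow> (\<forall>k. triangle_count n T (s * k + z) = triangle_count n S k)"
    if "S \<in> triangulations n" "T \<in> triangulations n" "s = 1 \<or> s = -1" for s z
  proof
    assume eq: "\<forall>k. triangle_count n T (s * k + z) = triangle_count n S k"
    have "triangle_count n T k = triangle_count n (tact n s z S) k" for k
    proof -
      \<comment> \<open>Every integer is hit by the substitution, because
        \<open>s * s = 1\<close>.\<close>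
      have "k = s * (s * (k - z)) + z" using that(3) by auto
      then show ?thesis using eq triangle_count_tact[OF n that(3,1)] by metis
    qed
    then show "T = tact n s z S"
      using triangle_count_eqI[OF assms that(2) tact_triangulation[OF n that(3,1)]] by blast
  qed (use triangle_count_tact[OF n that(3,1)] in simp)
  ultimately have "(\<exists>g\<in>dihedral n. T = (\<lambda>e. g ` e) ` S) \<longleftrightarrow>
      (\<exists>s z. (s = 1 \<or> s = -1) \<and> (\<forall>k. triangle_count n T (s * k + z) = triangle_count n S k))"
    if "S \<in> triangulations n" "T \<in> triangulations n" using that eq[OF that] by (simp cong: conj_cong)
  then show ?thesis
    by (simp only: dihedral_rel_def mem_Collect_eq case_prod_conv cong: conj_cong)
qed

lemma equiv_dihedral_rel:
  assumes "3 \<le> n" shows "equiv (triangulations n) (dihedral_rel n)"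
proof (rule equivI)
  show "dihedral_rel n \<subseteq> triangulations n \<times> triangulations n" by (auto simp: dihedral_rel_def)
  show "refl_on (triangulations n) (dihedral_rel n)"
    unfolding refl_on_def dihedral_rel_iff[OF assms]
    by (metis add.right_neutral mult_1)
  show "sym (dihedral_rel n)"
  proof (rule symI)
    fix S T assume "(S, T) \<in> dihedral_rel n"
    then obtain s z where *: "S \<in> triangulations n" "T \<in> triangulations n" "s = 1 \<or> s = -1"
      "\<And>k. triangle_count n T (s * k + z) = triangle_count n S k"
      unfolding dihedral_rel_iff[OF assms] by blast
    have "triangle_count n S (s * k + - s * z) = triangle_count n T k" for k
      using *(4)[of "s * k + - s * z"] *(3) by auto
    then show "(T, S) \<in> dihedral_rel n" using * unfolding dihedral_rel_iff[OF assms] by blast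
  qed
  show "trans (dihedral_rel n)"
  proof (rule transI)
    fix S T U assume "(S, T) \<in> dihedral_rel n" "(T, U) \<in> dihedral_rel n"
    then obtain s z s' z' where *: "S \<in> triangulations n" "U \<in> triangulations n"
      "s = 1 \<or> s = -1" "s' = 1 \<or> s' = -1"
      "\<And>k. triangle_count n T (s * k + z) = triangle_count n S k"
      "\<And>k. triangle_count n U (s' * k + z') = triangle_count n T k"
      unfolding dihedral_rel_iff[OF assms] by blast
    have "triangle_count n U ((s' * s) * k + (s' * z + z')) = triangle_count n S k" for k
      using *(6)[of "s * k + z"] *(5)[of k] by (simp add: algebra_simps)
    moreover have "s' * s = 1 \<or> s' * s = -1" using *(3,4) by auto
    ultimately show "(S, U) \<in> dihedral_rel n" using * unfolding dihedral_rel_iff[OF assms] by blast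
  qed
qed

section \<open>Schemes with a cyclic chart\<close>

definition alt :: "'i \<Rightarrow> 'i \<Rightarrow> int \<Rightarrow> 'i" where
  "alt i j k = (if even k then i else j)"

lemma alt_shift [simp]: "alt i j (k + 2) = alt i j k" "alt i j (k - 1) = alt i j (k + 1)"
  by (simp_all add: alt_def)

lemma alt_neq: "i \<noteq> j \<Longrightarrow> alt i j k \<noteq> alt i j (k + 1)"
  by (simp add: alt_def)

lemma alt_set: "{i, j} = {alt i j k, alt i j (k + 1)}"
  by (auto simp: alt_def)

text \<open>The objects occupy \<open>2 * n\<close> places on a circle, and the label for moving on
  alternates. The wall between \<open>h (k - 1)\<close> and \<open>h k\<close> has one label, and
  \<open>- c (k - 1)\<close> is the off-diagonal entry of that row at both objects.\<close>

definition cyclic_chart ::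
    "nat \<Rightarrow> ('i, 'a) cartan_data \<Rightarrow> 'i \<Rightarrow> 'i \<Rightarrow> (int \<Rightarrow> 'a) \<Rightarrow> (int \<Rightarrow> int) \<Rightarrow> bool" where
  "cyclic_chart n C i j h c \<longleftrightarrow> index C = {i, j} \<and> i \<noteq> j \<and> objs C = range h \<and>
     (\<forall>k m. h k = h m \<longleftrightarrow> 2 * int n dvd k - m) \<and>
     (\<forall>k. rho C (alt i j k) (h k) = h (k + 1) \<and> rho C (alt i j (k + 1)) (h k) = h (k - 1)) \<and>
     (\<forall>k. cartan C (h k) (alt i j k) (alt i j k) = 2 \<and>
          cartan C (h k) (alt i j (k + 1)) (alt i j (k + 1)) = 2 \<and>
          cartan C (h k) (alt i j k) (alt i j (k + 1)) = - c k \<and>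
          cartan C (h k) (alt i j (k + 1)) (alt i j k) = - c (k - 1))"

locale farey_scheme =
  fixes n :: nat and C :: "('i, 'a) cartan_data" and i j h W
  assumes n3: "3 \<le> n"
    and chart: "cyclic_chart n C i j h (quiddity W)"
    and farey: "farey_polygon n W"
begin

lemma index_C: "index C = {i, j}" and i_neq_j: "i \<noteq> j" and objs_C: "objs C = range h"
  and h_eq_iff: "h k = h m \<longleftrightarrow> 2 * int n dvd k - m"
  and rho_up: "rho C (alt i j k) (h k) = h (k + 1)"
  and rho_down: "rho C (alt i j (k + 1)) (h k) = h (k - 1)"
  and cartan_diag: "cartan C (h k) (alt i j k) (alt i j k) = 2"
    "cartan C (h k) (alt i j (k + 1)) (alt i j (k + 1)) = 2"
  and cartan_up: "cartan C (h k) (alt i j k) (alt i j (k + 1)) = - quiddity W k"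
  and cartan_down: "cartan C (h k) (alt i j (k + 1)) (alt i j k) = - quiddity W (k - 1)"
  using chart by (simp_all add: cyclic_chart_def)

lemma W_anti: "W (k + int n) = - W k" and W_det: "det2 (W k) (W (k + 1)) = 1"
  and W_pos: "k < m \<Longrightarrow> m < k + int n \<Longrightarrow> 0 < det2 (W k) (W m)"
  using farey by (auto simp: farey_polygon_def)

lemma W_det': "det2 (W (k - 1)) (W k) = 1"
  using W_det[of "k - 1"] by simp

lemma W_reduce: "\<exists>m'. k \<le> m' \<and> m' < k + int n \<and> (W m = W m' \<or> W m = - W m')"
proof -
  have eq: "(\<lambda>l. W (l + k)) = antiperiodic n (\<lambda>l. W (int l + k))"
    using farey_polygon_eq_antiperiodic[OF _ farey_polygon_shift[OF farey]] n3 by simp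
  have "0 < n" using n3 by simp
  then obtain q r where *: "r < n" "m - k = q * int n + int r" using int_divE by blast
  have "W (m - k + k) = (if even q then W (int r + k) else - W (int r + k))"
    using fun_cong[OF eq, of "m - k"] antiperiodic_eq[OF *(1)] *(2) by simp
  then show ?thesis using *(1) by (intro exI[of _ "int r + k"]) auto
qed

lemma W_cong: "2 * int n dvd k - m \<Longrightarrow> W k = W m"
proof -
  assume "2 * int n dvd k - m"
  then obtain q where q: "k = m + 2 * int n * q" by (metis dvdE add.commute diff_add_cancel)
  have step: "W (l + 2 * int n) = W l" for l
    using W_anti[of l] W_anti[of "l + int n"] by (simp add: algebra_simps)
  have "W (m + 2 * int n * q) = W m"
  proof (induction q rule: int_induct[where k = 0])
    case (step1 q)
    then show ?case using step[of "m + 2 * int n * q"] by (simp add: algebra_simps)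
  next
    case (step2 q)
    then show ?case using step[of "m + 2 * int n * (q - 1)"] by (simp add: algebra_simps)
  qed simp
  then show ?thesis using q by simp
qed

lemma index_cases:
  assumes "x \<in> index C"
  obtains "x = alt i j k" | "x = alt i j (k + 1)"
  using assms alt_set[of i j k] index_C by auto

lemma reflection_up:
  "reflection C (alt i j k) (h k) v =
     v(alt i j k := quiddity W k * v (alt i j (k + 1)) - v (alt i j k))"
  using alt_neq[OF i_neq_j, of k] cartan_diag[of k] cartan_up[of k]
  by (auto simp: reflection_def index_C alt_set[of i j k] simple_root_def fun_eq_iff algebra_simps)

lemma reflection_down:
  "reflection C (alt i j (k + 1)) (h k) v =
     v(alt i j (k + 1) := quiddity W (k - 1) * v (alt i j k) - v (alt i j (k + 1)))"
  using alt_neq[OF i_neq_j, of k] cartan_diag[of k] cartan_down[of k]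
  by (auto simp: reflection_def index_C alt_set[of i j k] simple_root_def fun_eq_iff algebra_simps)

text \<open>The simple roots at h k are W k and - W (k - 1), in one lattice for all objects.\<close>

definition phi :: "int \<Rightarrow> ('i \<Rightarrow> int) \<Rightarrow> int \<times> int" where
  "phi k v = (v (alt i j k) * fst (W k) - v (alt i j (k + 1)) * fst (W (k - 1)),
              v (alt i j k) * snd (W k) - v (alt i j (k + 1)) * snd (W (k - 1)))"

text \<open>The inverse of \<open>phi k\<close>: Cramer's rule for the basis \<open>W k\<close>,
  \<open>- W (k - 1)\<close>.\<close>

definition psi :: "int \<Rightarrow> int \<times> int \<Rightarrow> 'i \<Rightarrow> int" where
  "psi k r = (\<lambda>x. if x = alt i j k then det2 (W (k - 1)) r
                  else if x = alt i j (k + 1) then det2 (W k) r else 0)"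

lemma phi_coords: "det2 (W (k - 1)) (phi k v) = v (alt i j k)" "det2 (W k) (phi k v) = v (alt i j (k + 1))"
proof -
  have "fst (W (k - 1)) * snd (W k) - snd (W (k - 1)) * fst (W k) = 1"
    using W_det'[of k] by (simp add: det2_def)
  then show "det2 (W (k - 1)) (phi k v) = v (alt i j k)" "det2 (W k) (phi k v) = v (alt i j (k + 1))"
    unfolding det2_def phi_def fst_conv snd_conv by algebra+
qed

lemma psi_lattice: "psi k r \<in> lattice_on (index C)"
  using alt_set[of i j k] by (auto simp: psi_def lattice_on_def index_C)

lemma phi_psi: "phi k (psi k r) = r"
  using det2_expand[OF W_det', of r k] alt_neq[OF i_neq_j, of k] det2_commute[of r "W k"]
  by (simp add: phi_def psi_def prod_eq_iff)

lemma psi_phi: "v \<in> lattice_on (index C) \<Longrightarrow> psi k (phi k v) = v"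
  using alt_set[of i j k] by (auto simp: psi_def phi_coords lattice_on_def index_C fun_eq_iff)

lemma phi_uminus: "phi k (\<lambda>x. - v x) = - phi k v"
  by (simp add: phi_def prod_eq_iff)

text \<open>\<open>phi\<close> is indexed by places but depends on the object alone:
  \<open>2 * n\<close> is even, which keeps the labels, and it is a period of
  \<open>W\<close>.\<close>

lemma phi_cong: "h k = h m \<Longrightarrow> phi k = phi m"
proof -
  assume "h k = h m"
  then have d: "2 * int n dvd k - m" by (simp add: h_eq_iff)
  then have "even (k - m)" using dvd_mult_left by blast
  then have "alt i j k = alt i j m" "alt i j (k + 1) = alt i j (m + 1)" by (auto simp: alt_def)
  moreover have "W k = W m" "W (k - 1) = W (m - 1)" using W_cong[of k m] W_cong[of "k - 1" "m - 1"] d by auto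
  ultimately show ?thesis by (simp add: phi_def fun_eq_iff)
qed

text \<open>The reflection undoes the change of basis given by the recurrence, so the vector stays
  fixed in the common lattice.\<close>

lemma phi_up: "phi (k + 1) (reflection C (alt i j k) (h k) v) = phi k v"
proof -
  have "alt i j (k + 1 + 1) = alt i j k" by (simp add: alt_def)
  then show ?thesis
    unfolding phi_def reflection_up farey_recurrence[OF farey, of k]
    using alt_neq[OF i_neq_j, of k] by (simp add: prod_eq_iff) (simp add: algebra_simps)
qed

lemma phi_down: "phi (k - 1) (reflection C (alt i j (k + 1)) (h k) v) = phi k v"
proof -
  have "fst (W k) = quiddity W (k - 1) * fst (W (k - 1)) - fst (W (k - 1 - 1))"
    "snd (W k) = quiddity W (k - 1) * snd (W (k - 1)) - snd (W (k - 1 - 1))"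
    using farey_recurrence[OF farey, of "k - 1"] by simp_all
  then show ?thesis
    unfolding phi_def reflection_down
    using alt_neq[OF i_neq_j, of k] by (simp add: prod_eq_iff) (simp add: algebra_simps)
qed

section \<open>Morphisms in the common lattice; universality, connectedness, irreducibility\<close>

lemma reflection_lattice:
  assumes "x \<in> index C" "v \<in> lattice_on (index C)"
  shows "reflection C x a v \<in> lattice_on (index C)"
  using assms by (auto simp: reflection_def lattice_on_def simple_root_def)

text \<open>Seen in the common lattice every morphism is the identity, which gives universality. The
  third claim is part of the induction because a composite needs a place for its middle
  object.\<close>

lemma weyl_hom_phi:
  assumes "weyl_hom C a b f"
  shows "h k = a \<Longrightarrow> h m = b \<Longrightarrow> phi m (f v) = phi k v"
    and "v \<in> lattice_on (index C) \<Longrightarrow> f v \<in> lattice_on (index C)"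
    and "b \<in> objs C"
  using assms
proof (induction arbitrary: k m v)
  case (weyl_id a)
  {
    case 1
    then show ?case using phi_cong[of k m] by simp
  next
    case 2
    then show ?case by simp
  next
    case 3
    then show ?case using weyl_id by simp
  }
next
  case (weyl_gen a x)
  {
    case 1
    show ?case using weyl_gen(2)
    proof (cases rule: index_cases[where k = k])
      case 1
      then show ?thesis using \<open>h k = a\<close> \<open>h m = rho C x a\<close> phi_up[of k v] rho_up[of k] phi_cong[of m "k + 1"]
        by simp
    next
      case 2
      then show ?thesis using \<open>h k = a\<close> \<open>h m = rho C x a\<close> phi_down[of k v] rho_down[of k] phi_cong[of m "k - 1"]
        by simp
    qed
  next
    case 2
    then show ?case using reflection_lattice weyl_gen by simp
  next
    case 3
    obtain k where k: "a = h k" using weyl_gen(1) objs_C by auto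
    show ?case using weyl_gen(2)
      by (cases rule: index_cases[where k = k]) (use k rho_up rho_down objs_C in auto)
  }
next
  case (weyl_comp a b f c g)
  {
    case 1
    obtain l where "h l = b" using weyl_comp.IH(3) objs_C by auto
    then show ?case using weyl_comp.IH(1)[of k l v] weyl_comp.IH(4)[of l m "f v"] 1 by simp
  next
    case 2
    then show ?case using weyl_comp.IH by simp
  next
    case 3
    then show ?case using weyl_comp.IH by simp
  }
qed

lemma universal: "weyl_universal C"
  unfolding weyl_universal_def
proof (intro ballI allI impI)
  fix a f v assume *: "a \<in> objs C" "weyl_hom C a a f" "v \<in> lattice_on (index C)"
  obtain k where "h k = a" using * objs_C by auto
  then have "phi k (f v) = phi k v" using weyl_hom_phi(1)[OF *(2)] by blast
  then show "f v = v" using psi_phi[OF *(3), of k] psi_phi[OF weyl_hom_phi(2)[OF *(2,3)], of k] by simp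
qed

lemma connected: "weyl_connected C"
proof -
  have "\<exists>f. weyl_hom C (h k) (h m) f" for k m
  proof (induction m rule: int_induct[where k = k])
    case base
    then show ?case using weyl_id[of "h k" C] objs_C by blast
  next
    case (step1 m)
    then obtain f where f: "weyl_hom C (h k) (h m) f" by blast
    have "weyl_hom C (h m) (h (m + 1)) (reflection C (alt i j m) (h m))"
      using weyl_gen[of "h m" C "alt i j m"] objs_C index_C alt_set[of i j m] by (simp add: rho_up)
    from weyl_comp[OF f this] show ?case by blast
  next
    case (step2 m)
    then obtain f where f: "weyl_hom C (h k) (h m) f" by blast
    have "weyl_hom C (h m) (h (m - 1)) (reflection C (alt i j (m + 1)) (h m))"
      using weyl_gen[of "h m" C "alt i j (m + 1)"] objs_C index_C alt_set[of i j m] by (simp add: rho_down)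
    from weyl_comp[OF f this] show ?case by blast
  qed
  then show ?thesis by (auto simp: weyl_connected_def objs_C)
qed

text \<open>All quiddities are positive. Strictness yields irreducibility and makes the axiom on
  vanishing entries vacuous.\<close>

lemma cartan_neg:
  assumes "x \<in> index C" "y \<in> index C" "x \<noteq> y" "a \<in> objs C"
  shows "cartan C a x y < 0"
proof -
  obtain k where k: "a = h k" using assms(4) objs_C by auto
  have "quiddity W m > 0" for m by (rule quiddity_pos[OF n3 farey])
  then have "cartan C a (alt i j k) (alt i j (k + 1)) < 0" "cartan C a (alt i j (k + 1)) (alt i j k) < 0"
    unfolding k cartan_up cartan_down by simp_all
  then show ?thesis
    by (cases rule: index_cases[OF assms(1), of k]; cases rule: index_cases[OF assms(2), of k])
      (use assms(3) in auto)
qed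

lemma irreducible: "weyl_irreducible C"
  unfolding weyl_irreducible_def decomposable_def
proof (intro ballI notI)
  fix a assume a: "a \<in> objs C" and "\<exists>J K. J \<noteq> {} \<and> K \<noteq> {} \<and> J \<inter> K = {} \<and> J \<union> K = index C \<and>
            (\<forall>x\<in>J. \<forall>y\<in>K. cartan C a x y = 0 \<and> cartan C a y x = 0)"
  then obtain J K x y where *: "x \<in> J" "y \<in> K" "J \<inter> K = {}" "J \<union> K = index C" "cartan C a x y = 0" by blast
  then have "x \<in> index C" "y \<in> index C" "x \<noteq> y" by auto
  then show False using cartan_neg[of x y a] a *(5) by simp
qed

lemma cartan_scheme: "cartan_scheme_rank_two C"
  unfolding cartan_scheme_rank_two_def generalized_cartan_matrix_def
proof (intro conjI ballI impI)
  show "card (index C) = 2" using index_C i_neq_j by simp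
  show "objs C \<noteq> {}" using objs_C by simp
next
  fix x a assume x: "x \<in> index C" and "a \<in> objs C"
  then obtain k where k: "a = h k" using objs_C by auto
  have up: "rho C (alt i j k) (h (k + 1)) = h k" using rho_down[of "k + 1"] by (simp add: add.assoc)
  have down: "rho C (alt i j (k + 1)) (h (k - 1)) = h k" using rho_up[of "k - 1"] by simp
  show "rho C x a \<in> objs C"
    by (cases rule: index_cases[OF x, of k]) (use k objs_C rho_up rho_down in auto)
  show "rho C x (rho C x a) = a"
    by (cases rule: index_cases[OF x, of k]) (use k rho_up[of k] rho_down[of k] up down in auto)
  show "cartan C a x x = 2"
    by (cases rule: index_cases[OF x, of k]) (use k cartan_diag in auto)
  fix y assume y: "y \<in> index C"
  show "x \<noteq> y \<Longrightarrow> cartan C a x y \<le> 0" using cartan_neg[OF x y] k objs_C by force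
  show "cartan C a x y = cartan C (rho C x a) x y"
    by (cases rule: index_cases[OF x, of k]; cases rule: index_cases[OF y, of k])
      (use k rho_up[of k] rho_down[of k] cartan_diag cartan_up cartan_down cartan_up[of "k - 1"]
        cartan_down[of "k + 1"] cartan_diag[of "k + 1"] cartan_diag[of "k - 1"] in \<open>auto simp: add.assoc\<close>)
next
  fix x y a assume *: "x \<in> index C" "y \<in> index C" "a \<in> objs C" "cartan C a x y = 0"
  show "cartan C a y x = 0"
  proof (cases "x = y")
    case False
    then show ?thesis using cartan_neg[OF *(1,2) _ *(3)] *(4) by simp
  qed (use * in simp)
qed

lemma card_objs: "card (objs C) = 2 * n"
proof -
  have "range h = h ` {0..<2 * int n}"
  proof (intro equalityI subsetI)
    fix a assume "a \<in> range h"
    then obtain k where "a = h k" by blast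
    also have "h k = h (k mod (2 * int n))" by (simp add: h_eq_iff dvd_eq_mod_eq_0 mod_simps)
    finally show "a \<in> h ` {0..<2 * int n}" using n3 by auto
  qed auto
  moreover have "inj_on h {0..<2 * int n}"
  proof (rule inj_onI)
    fix k m assume *: "k \<in> {0..<2 * int n}" "m \<in> {0..<2 * int n}" "h k = h m"
    have "k mod (2 * int n) = m mod (2 * int n)"
      using *(3) unfolding h_eq_iff mod_eq_dvd_iff .
    then show "k = m" using * by simp
  qed
  ultimately show ?thesis using objs_C by (simp add: card_image)
qed

section \<open>The root system formed by the vertices of the polygon\<close>

definition roots :: "'a \<Rightarrow> ('i \<Rightarrow> int) set" where
  "roots a = {v \<in> lattice_on (index C). \<exists>k m. h k = a \<and> phi k v = W m}"

text \<open>By \<open>phi_cong\<close> any place of the object may be used. Negatives are included,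
  as \<open>- W m\<close> is \<open>W (m + int n)\<close>.\<close>

lemma roots_iff: "v \<in> roots (h k) \<longleftrightarrow> v \<in> lattice_on (index C) \<and> phi k v \<in> range W"
  unfolding roots_def mem_Collect_eq image_iff by (metis phi_cong UNIV_I)

text \<open>The window from \<open>W k\<close> to \<open>W (k + n - 1) = - W (k - 1)\<close> begins
  and ends with the simple roots at \<open>h k\<close>; the bounds are the coordinates of its
  members there.\<close>

lemma nonneg_coords:
  assumes "k \<le> m" "m < k + int n"
  shows "0 \<le> det2 (W (k - 1)) (W m)" "0 \<le> det2 (W k) (W m)"
proof -
  show "0 \<le> det2 (W k) (W m)" using W_pos[of k m] assms by (cases "m = k") auto
  show "0 \<le> det2 (W (k - 1)) (W m)"
    using W_pos[of "k - 1" m] W_anti[of "k - 1"] assms by (cases "m = k - 1 + int n") auto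
qed

lemma nonneg_iff: "(\<forall>x\<in>index C. 0 \<le> v x) \<longleftrightarrow> 0 \<le> v (alt i j k) \<and> 0 \<le> v (alt i j (k + 1))"
  unfolding index_C alt_set[of i j k] by simp

text \<open>The strict inequality keeps the alternatives exclusive, so that a positive root must
  come from the window starting at \<open>k\<close>.\<close>

lemma root_sign:
  assumes "v \<in> roots (h k)"
  shows "(\<exists>m. k \<le> m \<and> m < k + int n \<and> phi k v = W m) \<and> (\<forall>x\<in>index C. 0 \<le> v x) \<or>
         (\<forall>x\<in>index C. 0 \<le> - v x) \<and> (\<exists>x\<in>index C. v x < 0)"
proof -
  obtain m0 where m0: "phi k v = W m0" using assms by (auto simp: roots_iff)
  obtain m where m: "k \<le> m" "m < k + int n" "phi k v = W m \<or> phi k v = - W m"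
    using W_reduce[of k m0] m0 by auto
  have coords: "v (alt i j k) = det2 (W (k - 1)) (phi k v)" "v (alt i j (k + 1)) = det2 (W k) (phi k v)"
    using phi_coords by simp_all
  from m(3) show ?thesis
  proof
    assume "phi k v = W m"
    then show ?thesis using coords nonneg_coords[OF m(1,2)] m nonneg_iff[of v k] by auto
  next
    assume *: "phi k v = - W m"
    have "v (alt i j k) < 0 \<or> v (alt i j (k + 1)) < 0"
    proof (cases "m = k")
      case True
      then show ?thesis using coords * W_det'[of k] by simp
    next
      case False
      then show ?thesis using coords * W_pos[of k m] m by simp
    qed
    then have "\<exists>x\<in>index C. v x < 0" unfolding index_C alt_set[of i j k] by auto
    then show ?thesis
      using coords * nonneg_coords[OF m(1,2)] nonneg_iff[of "\<lambda>x. - v x" k] by auto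
  qed
qed

lemma roots_uminus: "v \<in> roots (h k) \<Longrightarrow> (\<lambda>x. - v x) \<in> roots (h k)"
proof -
  assume "v \<in> roots (h k)"
  then obtain m where "v \<in> lattice_on (index C)" "phi k v = W m" by (auto simp: roots_iff)
  then have "(\<lambda>x. - v x) \<in> lattice_on (index C)" "phi k (\<lambda>x. - v x) = W (m + int n)"
    by (simp_all add: lattice_on_def phi_uminus W_anti)
  then show ?thesis by (metis roots_iff rangeI)
qed

lemma finite_roots: "finite (roots (h k))"
proof -
  have "range W \<subseteq> W ` {0..<int n} \<union> uminus ` W ` {0..<int n}"
    using W_reduce[of 0] by fastforce
  then have "finite (range W)" by (rule finite_subset) auto
  moreover have "roots (h k) \<subseteq> psi k ` range W"
  proof
    fix v assume "v \<in> roots (h k)"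
    then show "v \<in> psi k ` range W" using psi_phi[of v k] by (metis roots_iff image_eqI)
  qed
  ultimately show ?thesis using finite_surj by blast
qed

text \<open>If \<open>z\<close> times a simple root is some \<open>W l\<close>, then
  \<open>z\<close> divides \<open>det2 (W l) (W (l + 1)) = 1\<close>.\<close>

lemma roots_simple:
  assumes "x \<in> index C"
  shows "roots (h k) \<inter> range (\<lambda>(z::int) y. z * simple_root x y) = {simple_root x, (\<lambda>y. - simple_root x y)}"
proof -
  have lat: "(\<lambda>y. z * simple_root x y) \<in> lattice_on (index C)" for z
    using assms by (auto simp: lattice_on_def simple_root_def)
  \<comment> \<open>The simple root of \<open>x\<close> is \<open>W k\<close> or
    \<open>- W (k - 1)\<close>, depending on the label.\<close>
  obtain m s where ms: "s = 1 \<or> s = (-1::int)"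
    "\<And>z. phi k (\<lambda>y. z * simple_root x y) = (z * s * fst (W m), z * s * snd (W m))"
    using assms
  proof (cases rule: index_cases[where k = k])
    case 1
    then show ?thesis using that[of 1 k] alt_neq[OF i_neq_j, of k] by (auto simp: phi_def simple_root_def)
  next
    case 2
    then show ?thesis using that[of "-1" "k - 1"] alt_neq[OF i_neq_j, of k] by (auto simp: phi_def simple_root_def)
  qed
  have one: "z = 1 \<or> z = -1" if r: "(\<lambda>y. z * simple_root x y) \<in> roots (h k)" for z
  proof -
    obtain l where l: "(z * s * fst (W m), z * s * snd (W m)) = W l" using r unfolding roots_iff ms(2) by blast
    have "z * (s * det2 (W m) (W (l + 1))) = det2 (W l) (W (l + 1))"
      unfolding l[symmetric] by (simp add: det2_def algebra_simps)
    then have "z * (s * det2 (W m) (W (l + 1))) = 1" using W_det by simp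
    then show ?thesis using zmult_eq_1_iff by blast
  qed
  have "(\<lambda>y. z * simple_root x y) \<in> roots (h k)" if "z = 1 \<or> z = -1" for z
  proof -
    have "z * s = 1 \<or> z * s = -1" using ms(1) that by auto
    then have "phi k (\<lambda>y. z * simple_root x y) = W m \<or> phi k (\<lambda>y. z * simple_root x y) = W (m + int n)"
      unfolding ms(2) W_anti by (auto simp: prod_eq_iff)
    then show ?thesis using lat by (auto simp: roots_iff)
  qed
  from this[of 1] this[of "-1"] have "simple_root x \<in> roots (h k)" "(\<lambda>y. - simple_root x y) \<in> roots (h k)" by simp_all
  moreover have "simple_root x = (\<lambda>y. 1 * simple_root x y)" "(\<lambda>y. - simple_root x y) = (\<lambda>y. (-1) * simple_root x y)"
    by simp_all
  moreover have "v = simple_root x \<or> v = (\<lambda>y. - simple_root x y)"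
    if "v \<in> roots (h k) \<inter> range (\<lambda>(z::int) y. z * simple_root x y)" for v
    using that one by fastforce
  ultimately show ?thesis by (intro equalityI subsetI) blast+
qed

text \<open>The positive roots at \<open>h k\<close> are the vertices of the window starting at
  \<open>k\<close>; their number is the exponent in (R4).\<close>

lemma card_positive_roots:
  assumes "x \<in> index C" "y \<in> index C" "x \<noteq> y"
  shows "card (roots (h k) \<inter> {(\<lambda>z. int p * simple_root x z + int q * simple_root y z) | p q. True}) = n"
proof -
  have xy: "index C = {x, y}" using assms index_C by auto
  let ?N = "{(\<lambda>z. int p * simple_root x z + int q * simple_root y z) | p q. True}"
  have "v \<in> ?N \<longleftrightarrow> (\<forall>z\<in>index C. 0 \<le> v z)" if "v \<in> lattice_on (index C)" for v
  proof
    assume "\<forall>z\<in>index C. 0 \<le> v z"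
    then have "v = (\<lambda>z. int (nat (v x)) * simple_root x z + int (nat (v y)) * simple_root y z)"
      using that xy assms(3) by (auto simp: lattice_on_def simple_root_def fun_eq_iff)
    then show "v \<in> ?N" by blast
  qed (auto simp: simple_root_def)
  then have S: "v \<in> roots (h k) \<inter> ?N \<longleftrightarrow> v \<in> roots (h k) \<and> (\<forall>z\<in>index C. 0 \<le> v z)" for v
    by (auto simp: roots_iff)
  have "bij_betw (\<lambda>m. psi k (W m)) {k..<k + int n} (roots (h k) \<inter> ?N)"
    unfolding bij_betw_def
  proof
    show "inj_on (\<lambda>m. psi k (W m)) {k..<k + int n}"
    proof (rule inj_onI)
      fix m m' assume *: "m \<in> {k..<k + int n}" "m' \<in> {k..<k + int n}" "psi k (W m) = psi k (W m')"
      have "W m = W m'" using *(3) phi_psi by metis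
      then show "m = m'" using W_pos[of m m'] W_pos[of m' m] *(1,2) by (cases m m' rule: linorder_cases) auto
    qed
    show "(\<lambda>m. psi k (W m)) ` {k..<k + int n} = roots (h k) \<inter> ?N"
    proof (intro equalityI subsetI)
      fix v assume "v \<in> (\<lambda>m. psi k (W m)) ` {k..<k + int n}"
      then obtain m where m: "k \<le> m" "m < k + int n" "v = psi k (W m)" by auto
      have "v \<in> roots (h k)" using m(3) psi_lattice phi_psi by (simp add: roots_iff)
      moreover have "\<forall>z\<in>index C. 0 \<le> v z"
        unfolding nonneg_iff[of v k] using nonneg_coords[OF m(1,2)] alt_neq[OF i_neq_j, of k]
        by (simp add: m(3) psi_def)
      ultimately show "v \<in> roots (h k) \<inter> ?N" unfolding S by simp
    next
      fix v assume "v \<in> roots (h k) \<inter> ?N"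
      then have v: "v \<in> roots (h k)" "\<forall>z\<in>index C. 0 \<le> v z" unfolding S by simp_all
      then obtain m where "k \<le> m" "m < k + int n" "phi k v = W m"
        using root_sign[OF v(1)] by force
      then show "v \<in> (\<lambda>m. psi k (W m)) ` {k..<k + int n}"
        using psi_phi[of v k] v(1) by (intro image_eqI[of _ _ m]) (simp_all add: roots_iff)
    qed
  qed
  from bij_betw_same_card[OF this] show ?thesis by simp
qed

text \<open>Each factor moves two places, so the power goes once around the circle; the order of the
  labels decides the direction.\<close>

lemma rho_rho_power:
  assumes "x \<in> index C" "y \<in> index C" "x \<noteq> y"
  shows "((rho C x \<circ> rho C y) ^^ n) (h k) = h k"
proof -
  have alt2: "alt i j (k + 2 * int l) = alt i j k" "alt i j (k + 2 * int l + 1) = alt i j (k + 1)"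
    "alt i j (k - 2 * int l) = alt i j k" "alt i j (k - 2 * int l + 1) = alt i j (k + 1)" for l
    by (simp_all add: alt_def)
  have up: "((rho C (alt i j (k + 1)) \<circ> rho C (alt i j k)) ^^ l) (h k) = h (k + 2 * int l)" for l
  proof (induction l)
    case (Suc l)
    then show ?case
      using rho_up[of "k + 2 * int l"] rho_up[of "k + 2 * int l + 1"] alt2(1,2)[of l]
      by (simp add: algebra_simps)
  qed simp
  have down: "((rho C (alt i j k) \<circ> rho C (alt i j (k + 1))) ^^ l) (h k) = h (k - 2 * int l)" for l
  proof (induction l)
    case (Suc l)
    then show ?case
      using rho_down[of "k - 2 * int l"] rho_down[of "k - 2 * int l - 1"] alt2(3,4)[of l]
      by (simp add: algebra_simps)
  qed simp
  have "h (k + 2 * int n) = h k" "h (k - 2 * int n) = h k" by (simp_all add: h_eq_iff)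
  then show ?thesis
    by (cases rule: index_cases[OF assms(1), of k]; cases rule: index_cases[OF assms(2), of k])
      (use up[of n] down[of n] assms(3) in auto)
qed

text \<open>All objects pull back the same set \<open>range W\<close>, and a reflection does not
  move vectors of the common lattice; \<open>psi\<close> supplies preimages.\<close>

lemma reflection_roots:
  assumes "x \<in> index C"
  shows "reflection C x (h k) ` roots (h k) = roots (rho C x (h k))"
proof -
  obtain k' where k': "rho C x (h k) = h k'" "\<And>v. phi k' (reflection C x (h k) v) = phi k v"
    using assms by (cases rule: index_cases[where k = k]) (use rho_up rho_down phi_up phi_down in metis)+
  show ?thesis
  proof (intro equalityI subsetI)
    fix v assume "v \<in> reflection C x (h k) ` roots (h k)"
    then show "v \<in> roots (rho C x (h k))"
      using k' reflection_lattice[OF assms] by (auto simp: roots_iff)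
  next
    fix v assume v: "v \<in> roots (rho C x (h k))"
    define u where "u = psi k (phi k' v)"
    have u: "u \<in> lattice_on (index C)" "phi k u = phi k' v" unfolding u_def by (rule psi_lattice phi_psi)+
    have "v \<in> lattice_on (index C)" using v k' by (simp add: roots_iff)
    then have "reflection C x (h k) u = v"
      using k'(2)[of u] u psi_phi[of v k'] psi_phi[OF reflection_lattice[OF assms u(1)], of k'] by metis
    moreover have "u \<in> roots (h k)" using v u k' by (simp add: roots_iff)
    ultimately show "v \<in> reflection C x (h k) ` roots (h k)" by blast
  qed
qed

lemma roots_positive_negative:
  "roots (h k) = {v \<in> roots (h k). \<forall>x\<in>index C. 0 \<le> v x} \<union>
     (\<lambda>v x. - v x) ` {v \<in> roots (h k). \<forall>x\<in>index C. 0 \<le> v x}"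
proof (intro equalityI subsetI)
  fix v assume v: "v \<in> roots (h k)"
  show "v \<in> {v \<in> roots (h k). \<forall>x\<in>index C. 0 \<le> v x} \<union>
     (\<lambda>v x. - v x) ` {v \<in> roots (h k). \<forall>x\<in>index C. 0 \<le> v x}"
  proof (cases "\<forall>x\<in>index C. 0 \<le> v x")
    case False
    then have "\<forall>x\<in>index C. 0 \<le> - v x" using root_sign[OF v] by blast
    then show ?thesis
      using roots_uminus[OF v] by (intro UnI2 image_eqI[of _ _ "\<lambda>x. - v x"]) simp_all
  qed (use v in simp)
qed (use roots_uminus in auto)

lemma root_system_roots: "root_system C roots"
proof -
  have R4: "((rho C x \<circ> rho C y) ^^ card (roots (h k) \<inter>
      {(\<lambda>z. int p * simple_root x z + int q * simple_root y z) | p q. True})) (h k) = h k"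
    if "x \<in> index C" "y \<in> index C" "x \<noteq> y" for x y k
    using card_positive_roots[OF that] rho_rho_power[OF that] by simp
  have objsE: "\<exists>k. a = h k" if "a \<in> objs C" for a using that objs_C by auto
  show ?thesis
    unfolding root_system_def Let_def
  proof (intro conjI ballI impI)
    fix a assume "a \<in> objs C"
    then obtain k where k: "a = h k" using objsE by blast
    show "roots a \<subseteq> lattice_on (index C)" by (auto simp: roots_def)
    show "roots a = {v \<in> roots a. \<forall>i\<in>index C. 0 \<le> v i} \<union>
        (\<lambda>v k. - v k) ` {v \<in> roots a. \<forall>i\<in>index C. 0 \<le> v i}"
      unfolding k by (rule roots_positive_negative)
    fix x assume x: "x \<in> index C"
    show "roots a \<inter> range (\<lambda>z k. z * simple_root x k) = {simple_root x, \<lambda>k. - simple_root x k}"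
      unfolding k by (rule roots_simple[OF x])
    show "reflection C x a ` roots a = roots (rho C x a)"
      unfolding k by (rule reflection_roots[OF x])
    fix y assume "y \<in> index C" "x \<noteq> y"
    then show "((rho C x \<circ> rho C y) ^^ card (roots a \<inter>
        {\<lambda>k. int p * simple_root x k + int q * simple_root y k | p q. True})) a = a"
      unfolding k using R4[OF x] by blast
  qed
qed

theorem mem_weyl_groupoids: "C \<in> weyl_groupoids n"
  using cartan_scheme connected irreducible universal card_objs root_system_roots finite_roots
  by (auto simp: weyl_groupoids_def admits_finite_root_system_def objs_C)

end

section \<open>Root systems of rank two\<close>

text \<open>P is a finite set of roots in the coordinates of one object. Along the walk that applies the
  two reflections alternately, the simple roots of the k-th object are V (k + 1) and - V k,
  so r has the coordinates det2 (V k) r and det2 (V (k + 1)) r there.\<close>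

locale root_walk =
  fixes V :: "nat \<Rightarrow> int \<times> int" and c :: "nat \<Rightarrow> int" and P :: "(int \<times> int) set"
  assumes V_0: "V 0 = (0, - 1)" and V_1: "V (Suc 0) = (1, 0)"
    and fst_V: "fst (V (Suc (Suc k))) = c k * fst (V (Suc k)) - fst (V k)"
    and snd_V: "snd (V (Suc (Suc k))) = c k * snd (V (Suc k)) - snd (V k)"
    and same_sign: "r \<in> P \<Longrightarrow> 0 \<le> det2 (V k) r \<and> 0 \<le> det2 (V (Suc k)) r \<or>
                     det2 (V k) r \<le> 0 \<and> det2 (V (Suc k)) r \<le> 0"
    and simple: "r \<in> P \<Longrightarrow> det2 (V k) r = 0 \<Longrightarrow> r = V k \<or> r = - V k"
    and V_in: "V k \<in> P"
    and uminus_in: "r \<in> P \<Longrightarrow> - r \<in> P"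
    and finite_P: "finite P"
begin

text \<open>The positive roots at the starting object.\<close>

definition N :: "(int \<times> int) set" where
  "N = {r \<in> P. 0 \<le> fst r \<and> 0 \<le> snd r}"

lemma det2_start: "det2 (V 0) r = fst r" "det2 (V (Suc 0)) r = snd r"
  by (simp_all add: det2_def V_0 V_1)

lemma det2_step: "det2 (V (Suc (Suc k))) r = c k * det2 (V (Suc k)) r - det2 (V k) r"
  by (simp add: det2_def fst_V snd_V algebra_simps)

lemma det2_V: "det2 (V k) (V (Suc k)) = 1"
proof (induction k)
  case (Suc k)
  then show ?case using det2_step[of k "V (Suc k)"] det2_commute[of "V (Suc k)" "V (Suc (Suc k))"] by simp
qed (simp add: det2_start V_1)

lemma V_nonzero: "V k \<noteq> (0, 0)"
  using det2_V[of k] by (auto simp: det2_def)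

text \<open>A discrete intermediate value argument. The coordinates of \<open>r\<close> at one step
  have a common sign, so the first non-negative determinant is 0, which makes \<open>r\<close> equal
  to \<open>V t\<close> or \<open>- V t\<close>; the negative determinant just before excludes
  \<open>V t\<close>.\<close>

lemma sign_change_neg:
  assumes "r \<in> P" "det2 (V k) r < 0" "k \<le> l" "0 \<le> det2 (V l) r"
  obtains t where "k < t" "t \<le> l" "V t = - r"
proof -
  define t where "t = (LEAST t. k \<le> t \<and> 0 \<le> det2 (V t) r)"
  have t: "k \<le> t" "0 \<le> det2 (V t) r" "t \<le> l"
    using LeastI[of "\<lambda>t. k \<le> t \<and> 0 \<le> det2 (V t) r" l] Least_le[of "\<lambda>t. k \<le> t \<and> 0 \<le> det2 (V t) r" l] assms
    by (auto simp: t_def)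
  have "k \<noteq> t" using t(2) assms(2) by auto
  then have k: "k < t" using t(1) by simp
  then obtain u where u: "t = Suc u" "k \<le> u" by (cases t) auto
  have neg: "det2 (V u) r < 0"
  proof (rule ccontr)
    assume "\<not> det2 (V u) r < 0"
    then have "t \<le> u" unfolding t_def by (intro Least_le) (simp add: u)
    then show False using u by simp
  qed
  then have "det2 (V t) r = 0" using same_sign[OF assms(1), of u] t(2) u by auto
  then have "r = V t \<or> r = - V t" by (rule simple[OF assms(1)])
  moreover have "r \<noteq> V t" using neg det2_V[of u] u by auto
  ultimately show thesis using that[of t] k t by simp
qed

lemma sign_change_pos:
  assumes "r \<in> P" "0 < det2 (V k) r" "k \<le> l" "det2 (V l) r \<le> 0"
  obtains t where "k < t" "t \<le> l" "V t = r"
  using sign_change_neg[OF uminus_in[OF assms(1)], of k l] assms by auto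

section \<open>The positive roots met along the walk\<close>

lemma not_both_signs: "r \<in> N \<Longrightarrow> - r \<in> N \<Longrightarrow> r = (0, 0)"
  by (auto simp: N_def prod_eq_iff)

lemma zero_notin_N: "(0, 0) \<notin> N"
proof
  assume "(0, 0) \<in> N"
  then have "(0, 0) = V 0 \<or> (0, 0) = - V 0" using simple[of "(0, 0)" 0] by (simp add: N_def det2_def)
  then show False by (simp add: V_0)
qed

text \<open>In a finite set the walk repeats a vector. Between the two occurrences the determinant
  with it climbs from -1 to 0, so its negative is met on the way, which positivity forbids.\<close>

lemma leaves_N: "\<exists>k. V (Suc k) \<notin> N"
proof (rule ccontr)
  assume "\<nexists>k. V (Suc k) \<notin> N"
  then have all: "V (Suc k) \<in> N" for k by blast
  have "finite (range (\<lambda>k. V (Suc k)))"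
    using finite_P by (rule finite_subset[rotated]) (use V_in in auto)
  then have "\<not> inj (\<lambda>k. V (Suc k))" using finite_imageD infinite_UNIV_nat by blast
  then obtain k l where kl: "k < l" "V (Suc k) = V (Suc l)"
    by (metis injI linorder_neqE_nat)
  let ?r = "V (Suc k)"
  have "det2 (V (Suc (Suc k))) ?r < 0"
    using det2_V[of "Suc k"] det2_commute[of "V (Suc (Suc k))" ?r] by simp
  moreover have "0 \<le> det2 (V (Suc l)) ?r" using kl by simp
  ultimately obtain t where "Suc (Suc k) < t" "V t = - ?r"
    using sign_change_neg[OF V_in[of "Suc k"], of "Suc (Suc k)" "Suc l"] kl by auto
  then have "- ?r \<in> N" using all[of "t - 1"] by simp
  then show False using not_both_signs[OF all[of k]] V_nonzero by simp
qed

text \<open>It turns out to be the number of positive roots.\<close>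

definition p :: nat where "p = (LEAST k. V (Suc k) \<notin> N)"

lemma V_Suc_p: "V (Suc p) \<notin> N"
  unfolding p_def using leaves_N by (rule LeastI_ex)

lemma V_N: "1 \<le> k \<Longrightarrow> k \<le> p \<Longrightarrow> V k \<in> N"
  using not_less_Least[of "k - 1" "\<lambda>k. V (Suc k) \<notin> N"] by (simp add: p_def)

lemma p_pos: "1 \<le> p"
proof (rule ccontr)
  assume "\<not> 1 \<le> p"
  then have "p = 0" by simp
  then show False using V_Suc_p V_in[of "Suc 0"] by (simp add: N_def V_1)
qed

lemma V_Suc_p': "fst (V (Suc p)) \<le> 0" "snd (V (Suc p)) \<le> 0"
  using same_sign[OF V_in[of "Suc p"], of 0] V_Suc_p V_in[of "Suc p"]
  by (auto simp: det2_start N_def)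

text \<open>Otherwise the determinant with \<open>V k\<close> would climb from -1 to a non-negative
  value by step \<open>l\<close>, and \<open>- V k\<close> would be met inside
  \<open>N\<close>.\<close>

lemma det2_V_pos:
  assumes "1 \<le> k" "k < l" "l \<le> p"
  shows "0 < det2 (V k) (V l)"
proof (rule ccontr)
  assume "\<not> 0 < det2 (V k) (V l)"
  then have "0 \<le> det2 (V l) (V k)" using det2_commute[of "V k" "V l"] by simp
  moreover have "det2 (V (Suc k)) (V k) < 0" using det2_V[of k] det2_commute[of "V (Suc k)" "V k"] by simp
  ultimately obtain t where t: "Suc k < t" "t \<le> l" "V t = - V k"
    using sign_change_neg[OF V_in[of k], of "Suc k" l] assms by auto
  then have "- V k \<in> N" using V_N[of t] assms by simp
  then show False using not_both_signs[of "V k"] V_N[of k] V_nonzero[of k] assms by simp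
qed

text \<open>The simple roots at step \<open>p\<close> are \<open>V (Suc p)\<close> and
  \<open>- V p\<close>, both non-positive at the start. So positive and negative exchange their
  roles, as under the longest element of a Weyl group.\<close>

lemma N_end:
  assumes "r \<in> N" shows "det2 (V p) r \<le> 0" "det2 (V (Suc p)) r \<le> 0"
proof -
  have r: "r \<in> P" "0 \<le> fst r" "0 \<le> snd r" using assms by (auto simp: N_def)
  have "\<not> (0 \<le> det2 (V p) r \<and> 0 \<le> det2 (V (Suc p)) r)"
  proof
    assume *: "0 \<le> det2 (V p) r \<and> 0 \<le> det2 (V (Suc p)) r"
    have Vp: "0 \<le> fst (V p)" "0 \<le> snd (V p)" using V_N[of p] p_pos by (auto simp: N_def)
    have "fst r = det2 (V p) r * fst (V (Suc p)) - det2 (V (Suc p)) r * fst (V p)"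
      "snd r = det2 (V p) r * snd (V (Suc p)) - det2 (V (Suc p)) r * snd (V p)"
      using det2_expand[OF det2_V, of r p] det2_commute[of r "V (Suc p)"] by simp_all
    moreover have "det2 (V p) r * fst (V (Suc p)) \<le> 0" "det2 (V p) r * snd (V (Suc p)) \<le> 0"
      "0 \<le> det2 (V (Suc p)) r * fst (V p)" "0 \<le> det2 (V (Suc p)) r * snd (V p)"
      using * Vp V_Suc_p' by (simp_all add: mult_nonneg_nonpos)
    ultimately have "r = (0, 0)" using r by (auto simp: prod_eq_iff)
    then show False using assms zero_notin_N by simp
  qed
  then show "det2 (V p) r \<le> 0" "det2 (V (Suc p)) r \<le> 0" using same_sign[OF r(1), of p] by auto
qed

text \<open>For a positive root other than \<open>V 1\<close> the determinant with
  \<open>V t\<close> is positive at \<open>t = 1\<close> and non-positive at \<open>t = p\<close>;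
  the sign change reveals the root as some \<open>V t\<close>.\<close>

lemma N_eq: "N = V ` {1..p}"
proof (intro equalityI subsetI)
  fix r assume r: "r \<in> N"
  then have rP: "r \<in> P" "0 \<le> fst r" "0 \<le> snd r" by (auto simp: N_def)
  show "r \<in> V ` {1..p}"
  proof (cases "snd r = 0")
    case True
    then have "r = V 1 \<or> r = - V 1" using simple[OF rP(1), of "Suc 0"] by (simp add: det2_start)
    then have "r = V 1" using rP(2) by (auto simp: V_1)
    then show ?thesis using p_pos by auto
  next
    case False
    then have "0 < det2 (V (Suc 0)) r" using rP by (simp add: det2_start)
    then obtain t where "Suc 0 < t" "t \<le> p" "V t = r"
      using sign_change_pos[OF rP(1) _ _ N_end(1)[OF r]] p_pos by auto
    then show ?thesis by (intro image_eqI[of _ _ t]) auto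
  qed
qed (use V_N in auto)

lemma card_N: "card N = p"
proof -
  have "inj_on V {1..p}"
  proof (rule inj_onI)
    fix k l assume "k \<in> {1..p}" "l \<in> {1..p}" "V k = V l"
    then show "k = l" using det2_V_pos[of k l] det2_V_pos[of l k] by (cases k l rule: linorder_cases) auto
  qed
  then show ?thesis by (simp add: N_eq card_image)
qed

text \<open>\<open>N_end\<close> is tested on \<open>- V 0\<close> and \<open>V 1\<close>, the
  simple roots at the start. One coordinate of each vector vanishes, and determinant 1 forces the
  remaining ones to be units.\<close>

lemma V_p: "V p = - V 0" and V_p1: "V (Suc p) = - V (Suc 0)"
proof -
  have "- V 0 \<in> N" "V (Suc 0) \<in> N"
    using uminus_in[OF V_in[of 0]] V_in[of "Suc 0"] by (auto simp: N_def V_0 V_1)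
  then have "fst (V p) \<le> 0" "0 \<le> snd (V (Suc p))"
    using N_end(1)[of "- V 0"] N_end(2)[of "V (Suc 0)"] by (simp_all add: V_0 V_1 det2_def)
  moreover have Vp: "0 \<le> fst (V p)" "0 \<le> snd (V p)" using V_N[of p] p_pos by (auto simp: N_def)
  ultimately have 0: "fst (V p) = 0" "snd (V (Suc p)) = 0" using V_Suc_p' by auto
  then have "snd (V p) * (- fst (V (Suc p))) = 1" using det2_V[of p] by (simp add: det2_def)
  then have "snd (V p) = 1" "fst (V (Suc p)) = -1"     using Vp(2) zmult_eq_1_iff[of "snd (V p)" "- fst (V (Suc p))"] by auto
  then show "V p = - V 0" "V (Suc p) = - V (Suc 0)" using 0 by (auto simp: V_0 V_1 prod_eq_iff)
qed

text \<open>What is missing is \<open>c (k + p) = c k\<close>; each inequality is an instance of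
  sign coherence.\<close>

lemma V_antiperiodic: "V (k + p) = - V k \<and> V (Suc k + p) = - V (Suc k)"
proof (induction k)
  case 0
  then show ?case using V_p V_p1 by simp
next
  case (Suc k)
  define r where "r = - V (Suc (Suc (k + p)))"
  have rP: "r \<in> P" unfolding r_def by (rule uminus_in[OF V_in])
  have IH: "V (k + p) = - V k" "V (Suc (k + p)) = - V (Suc k)" using Suc by auto
  have r: "fst r = c (k + p) * fst (V (Suc k)) - fst (V k)" "snd r = c (k + p) * snd (V (Suc k)) - snd (V k)"
    using fst_V[of "k + p"] snd_V[of "k + p"] IH by (simp_all add: r_def)
  have one: "fst (V k) * snd (V (Suc k)) - snd (V k) * fst (V (Suc k)) = 1"
    using det2_V[of k] by (simp add: det2_def)
  have "det2 (V (Suc k)) r = 1" unfolding det2_def r using one by algebra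
  moreover have diff: "det2 (V (Suc (Suc k))) r = c k - c (k + p)"
    unfolding det2_def r fst_V snd_V using one by algebra
  \<comment> \<open>At step \<open>Suc k\<close> the root \<open>r\<close> has the coordinates 1 and
    \<open>c k - c (k + p)\<close>, and the second cannot be negative.\<close>
  ultimately have "c (k + p) \<le> c k" using same_sign[OF rP, of "Suc k"] by auto
  \<comment> \<open>Now \<open>V (Suc (Suc k))\<close> is read at step \<open>Suc (k + p)\<close>,
    where its first coordinate is negative.\<close>
  moreover have "det2 (V (Suc (k + p))) (V (Suc (Suc k))) = -1"
    using det2_V[of "Suc k"] IH by simp
  then have "det2 (V (Suc (Suc (k + p)))) (V (Suc (Suc k))) \<le> 0"
    using same_sign[OF V_in[of "Suc (Suc k)"], of "Suc (k + p)"] by auto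
  then have "det2 (V (Suc (Suc k))) r \<le> 0"
    using det2_commute[of "V (Suc (Suc k))" r] by (simp add: r_def)
  then have "c k \<le> c (k + p)" using diff by simp
  ultimately have "r = V (Suc (Suc k))" using r by (simp add: prod_eq_iff fst_V snd_V)
  then have "V (Suc (Suc (k + p))) = - V (Suc (Suc k))" unfolding r_def by (metis minus_minus)
  then show ?case using IH by simp
qed

section \<open>The Farey polygon of the walk\<close>

lemma farey_window_V: "farey_window p (\<lambda>k. V (Suc k))"
proof -
  have "det2 (V (Suc 0)) (V (Suc (p - 1))) = 1" using V_p p_pos by (simp add: det2_start V_0)
  then show ?thesis using det2_V_pos det2_V by (auto simp: farey_window_def)
qed

text \<open>The index is shifted by one against \<open>V\<close>, so that the simple roots at the
  start are \<open>W 0\<close> and \<open>- W (- 1)\<close>.\<close>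

definition W :: "int \<Rightarrow> int \<times> int" where
  "W = antiperiodic p (\<lambda>k. V (Suc k))"

lemma farey_polygon_W: "2 \<le> p \<Longrightarrow> farey_polygon p W"
  unfolding W_def by (intro farey_polygon_antiperiodic farey_window_V)

lemma W_eq: "W (int k - 1) = V k"
proof -
  have mult: "V (q * p + k) = (if even q then V k else - V k)" for q k
  proof (induction q)
    case (Suc q)
    then show ?case using V_antiperiodic[of "q * p + k"] by (simp add: algebra_simps split: if_splits)
  qed simp
  show ?thesis
  proof (cases k)
    case 0
    have "W (- 1) = antiperiodic p (\<lambda>k. V (Suc k)) ((- 1) * int p + int (p - 1))"
      using p_pos by (simp add: W_def of_nat_diff)
    also have "\<dots> = - V p" using p_pos by (subst antiperiodic_eq) auto
    finally show ?thesis using 0 V_p by simp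
  next
    case (Suc l)
    have "int l = int (l div p) * int p + int (l mod p)"
      by (metis div_mult_mod_eq of_nat_add of_nat_mult)
    then have "W (int l) = antiperiodic p (\<lambda>k. V (Suc k)) (int (l div p) * int p + int (l mod p))"
      by (simp only: W_def)
    also have "\<dots> = (if even (l div p) then V (Suc (l mod p)) else - V (Suc (l mod p)))"
      using p_pos by (subst antiperiodic_eq) auto
    also have "\<dots> = V (l div p * p + Suc (l mod p))" by (simp only: mult)
    also have "\<dots> = V (Suc l)" by (simp only: add_Suc_right div_mult_mod_eq)
    finally show ?thesis using Suc by simp
  qed
qed

lemma quiddity_W: "quiddity W (int k) = c k"
proof -
  have "quiddity W (int k) = det2 (V k) (V (Suc (Suc k)))"
    using W_eq[of k] W_eq[of "Suc (Suc k)"] by (simp add: quiddity_def add.commute)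
  also have "\<dots> = c k"
    using det2_step[of k "V k"] det2_V[of k] det2_commute[of "V k" "V (Suc (Suc k))"]
      det2_commute[of "V (Suc k)" "V k"] by simp
  finally show ?thesis .
qed

text \<open>By universality, a walk returning to its k-th object after d steps would make these
  determinants agree for all r.\<close>

lemma V_return_even:
  assumes "2 \<le> p" "0 < d" "d < 2 * p"
  shows "\<exists>r. det2 (V (k + d)) r \<noteq> det2 (V k) r"
proof -
  have pos: "0 < det2 (V k) (V l)" if "k < l" "l < k + p" for k l
  proof -
    have "0 < det2 (W (int k - 1)) (W (int l - 1))"
      using farey_polygon_W[OF assms(1)] that by (simp add: farey_polygon_def)
    then show ?thesis by (simp add: W_eq)
  qed
  consider "d < p" | "d = p" | "p < d" by linarith
  then show ?thesis
  proof cases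
    case 1
    then show ?thesis using pos[of k "k + d"] assms det2_commute[of "V (k + d)" "V k"]
      by (intro exI[of _ "V k"]) simp
  next
    case 2
    then show ?thesis using V_antiperiodic[of k] det2_V[of k] by (intro exI[of _ "V (Suc k)"]) simp
  next
    case 3
    define l where "l = k + (d - p)"
    have l: "k < l" "l < k + p" "k + d = l + p" using 3 assms by (auto simp: l_def)
    then have "V (k + d) = - V l" using V_antiperiodic[of l] by simp
    then show ?thesis using pos[OF l(1,2)] det2_commute[of "V l" "V k"]
      by (intro exI[of _ "V k"]) simp
  qed
qed

text \<open>After an odd number of steps the labels are exchanged. A return would identify the pair
  \<open>V l\<close>, \<open>V (Suc l)\<close> of determinant 1 with the pair
  \<open>V (Suc k)\<close>, \<open>V k\<close> of determinant -1.\<close>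

lemma V_return_odd: "\<exists>r. det2 (V l) r \<noteq> det2 (V (Suc k)) r \<or> det2 (V (Suc l)) r \<noteq> det2 (V k) r"
proof (rule ccontr)
  assume "\<not> ?thesis"
  then have eq: "\<And>r. det2 (V l) r = det2 (V (Suc k)) r" "\<And>r. det2 (V (Suc l)) r = det2 (V k) r" by auto
  have "V l = V (Suc k)" "V (Suc l) = V k"
    using eq(1)[of "(1, 0)"] eq(1)[of "(0, 1)"] eq(2)[of "(1, 0)"] eq(2)[of "(0, 1)"]
    by (simp_all add: det2_def prod_eq_iff)
  then show False using det2_V[of l] det2_V[of k] det2_commute[of "V k" "V (Suc k)"] by simp
qed

end

section \<open>Universal schemes with a finite root system\<close>

locale finite_universal_scheme =
  fixes C :: "('i, 'a) cartan_data" and n :: nat and i j :: 'i and a :: 'a and R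
  assumes n3: "3 \<le> n" and C: "C \<in> weyl_groupoids n"
    and index_C: "index C = {i, j}" and i_neq_j: "i \<noteq> j" and a: "a \<in> objs C"
    and R: "root_system C R" and finite_R: "\<And>b. b \<in> objs C \<Longrightarrow> finite (R b)"
begin

lemma scheme: "cartan_scheme_rank_two C" and connected: "weyl_connected C"
  and universal: "weyl_universal C" and card_objs: "card (objs C) = 2 * n"
  using C by (simp_all add: weyl_groupoids_def)

lemma rho_in: "x \<in> index C \<Longrightarrow> b \<in> objs C \<Longrightarrow> rho C x b \<in> objs C"
  and rho_rho: "x \<in> index C \<Longrightarrow> b \<in> objs C \<Longrightarrow> rho C x (rho C x b) = b"
  and cartan_diag: "x \<in> index C \<Longrightarrow> b \<in> objs C \<Longrightarrow> cartan C b x x = 2"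
  and cartan_rho: "b \<in> objs C \<Longrightarrow> x \<in> index C \<Longrightarrow> y \<in> index C \<Longrightarrow>
         cartan C (rho C x b) x y = cartan C b x y"
  using scheme unfolding cartan_scheme_rank_two_def generalized_cartan_matrix_def by (blast, blast, blast, metis)

definition e :: "nat \<Rightarrow> 'i" where
  "e k = alt i j (int k)"

lemma e_simps: "e (Suc (Suc k)) = e k" "e k \<in> index C" "e k \<noteq> e (Suc k)"
  using i_neq_j by (auto simp: e_def alt_def index_C)

lemma index_e: "index C = {e k, e (Suc k)}"
  by (auto simp: e_def alt_def index_C)

primrec walk :: "nat \<Rightarrow> 'a" where
  "walk 0 = a"
| "walk (Suc k) = rho C (e k) (walk k)"

lemma walk_in: "walk k \<in> objs C"
  by (induction k) (auto simp: a rho_in e_simps)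

definition c :: "nat \<Rightarrow> int" where
  "c k = - cartan C (walk k) (e k) (e (Suc k))"

fun V :: "nat \<Rightarrow> int \<times> int" where
  "V 0 = (0, - 1)"
| "V (Suc 0) = (1, 0)"
| "V (Suc (Suc k)) = (c k * fst (V (Suc k)) - fst (V k), c k * snd (V (Suc k)) - snd (V k))"

definition coords :: "nat \<Rightarrow> ('i \<Rightarrow> int) \<Rightarrow> int \<times> int" where
  "coords k v = (v (e k), v (e (Suc k)))"

definition P :: "(int \<times> int) set" where
  "P = coords 0 ` R a"

lemma reflection_coords:
  "coords (Suc k) (reflection C (e k) (walk k) v) =
     (snd (coords k v), c k * snd (coords k v) - fst (coords k v))"
  using e_simps[of k] cartan_diag[OF e_simps(2)[of k] walk_in[of k]]
  by (simp add: coords_def reflection_def index_e[of k] simple_root_def c_def algebra_simps)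

lemmas R_axioms = R[unfolded root_system_def Let_def]

lemmas R_sub = R_axioms[THEN conjunct1, THEN bspec]
  and R_sign = R_axioms[THEN conjunct2, THEN conjunct1, THEN bspec]
  and R_simple = R_axioms[THEN conjunct2, THEN conjunct2, THEN conjunct1, THEN bspec, THEN bspec]
  and R_reflection =
    R_axioms[THEN conjunct2, THEN conjunct2, THEN conjunct2, THEN conjunct1, THEN bspec, THEN bspec]
  and R_power =
    R_axioms[THEN conjunct2, THEN conjunct2, THEN conjunct2, THEN conjunct2, THEN bspec, THEN bspec,
      THEN bspec, THEN mp, THEN mp]

text \<open>(R3) carries the roots along the walk, and each reflection advances the pair of
  determinants by one step of the recurrence.\<close>

lemma coords_R: "coords k ` R (walk k) = (\<lambda>r. (det2 (V k) r, det2 (V (Suc k)) r)) ` P"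
proof (induction k)
  case 0
  show ?case by (auto simp: P_def det2_def image_image)
next
  case (Suc k)
  have "coords (Suc k) ` R (walk (Suc k)) =
      (\<lambda>q. (snd q, c k * snd q - fst q)) ` coords k ` R (walk k)"
    using R_reflection[OF walk_in e_simps(2), of k k, symmetric]
    by (simp add: image_image reflection_coords)
  also have "\<dots> = (\<lambda>r. (det2 (V (Suc k)) r, det2 (V (Suc (Suc k))) r)) ` P"
    unfolding Suc image_image by (rule image_cong) (simp_all add: det2_def algebra_simps)
  finally show ?case .
qed

lemma in_P_coords:
  assumes "r \<in> P"
  obtains v where "v \<in> R (walk k)" "v (e k) = det2 (V k) r" "v (e (Suc k)) = det2 (V (Suc k)) r"
proof -
  have "(det2 (V k) r, det2 (V (Suc k)) r) \<in> coords k ` R (walk k)" unfolding coords_R using assms by blast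
  then show thesis using that by (auto simp: coords_def)
qed

lemma root_in_P:
  assumes "v \<in> R (walk k)"
  obtains r where "r \<in> P" "v (e k) = det2 (V k) r" "v (e (Suc k)) = det2 (V (Suc k)) r"
proof -
  have "coords k v \<in> (\<lambda>r. (det2 (V k) r, det2 (V (Suc k)) r)) ` P" using coords_R assms by blast
  then show thesis using that by (auto simp: coords_def)
qed

lemma det2_VV: "det2 (V k) (V (Suc k)) = 1"
  by (induction k) (simp_all add: det2_def algebra_simps)

lemma expand: "r = (det2 (V k) r * fst (V (Suc k)) - det2 (V (Suc k)) r * fst (V k),
                    det2 (V k) r * snd (V (Suc k)) - det2 (V (Suc k)) r * snd (V k))"
  using det2_expand[OF det2_VV, of r k] det2_commute[of r "V (Suc k)"] by (simp add: prod_eq_iff)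

lemma simple_in_R:
  assumes "x \<in> index C" "b \<in> objs C"
  shows "simple_root x \<in> R b" "(\<lambda>k. - simple_root x k) \<in> R b"
  using R_simple[OF assms(2,1)] by auto

text \<open>Sign coherence and closure under negation come from (R1), the condition on a vanishing
  coordinate from (R2).\<close>

sublocale root_walk V c P
proof
  show "V 0 = (0, - 1)" "V (Suc 0) = (1, 0)" by simp_all
  show "finite P" unfolding P_def using finite_R[OF a] by simp
next
  fix k
  show "fst (V (Suc (Suc k))) = c k * fst (V (Suc k)) - fst (V k)"
    "snd (V (Suc (Suc k))) = c k * snd (V (Suc k)) - snd (V k)" by simp_all
  \<comment> \<open>These are the coordinates of \<open>V k\<close> at the \<open>k\<close>-th
    object: it is the negative simple root of the second label.\<close>
  obtain r where r: "r \<in> P" "det2 (V k) r = 0" "det2 (V (Suc k)) r = - 1"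
    using root_in_P[OF simple_in_R(2)[OF e_simps(2)[of "Suc k"] walk_in[of k]]] e_simps[of k]
    by (metis simple_root_def neg_0_equal_iff_equal)
  then have "r = V k" using expand[of r k] by simp
  then show "V k \<in> P" using r by simp
next
  fix r assume "r \<in> P"
  then obtain v where "v \<in> R a" "r = coords 0 v" by (auto simp: P_def)
  moreover from this have "(\<lambda>k. - v k) \<in> R a"
  proof -
    obtain u where u: "u \<in> R a" "\<forall>x\<in>index C. 0 \<le> u x" "v = u \<or> v = (\<lambda>k. - u k)"
      using R_sign[OF a] \<open>v \<in> R a\<close> by blast
    have "(\<lambda>k. - u k) \<in> R a" using R_sign[OF a] u(1,2) by blast
    then show ?thesis using u by auto
  qed
  ultimately show "- r \<in> P" unfolding P_def by (intro image_eqI[of _ _ "\<lambda>k. - v k"]) (auto simp: coords_def)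
next
  fix r k assume r: "r \<in> P"
  obtain v where v: "v \<in> R (walk k)" "v (e k) = det2 (V k) r" "v (e (Suc k)) = det2 (V (Suc k)) r"
    using in_P_coords[OF r] by blast
  obtain u where u: "\<forall>x\<in>index C. 0 \<le> u x" "v = u \<or> v = (\<lambda>k. - u k)"
    using R_sign[OF walk_in] v(1) by blast
  have "0 \<le> u (e k)" "0 \<le> u (e (Suc k))" using u(1) e_simps(2) by auto
  then show "0 \<le> det2 (V k) r \<and> 0 \<le> det2 (V (Suc k)) r \<or> det2 (V k) r \<le> 0 \<and> det2 (V (Suc k)) r \<le> 0"
    using u(2) v(2,3) by auto
  assume 0: "det2 (V k) r = 0"
  have "v x = v (e (Suc k)) * simple_root (e (Suc k)) x" for x
    using R_sub[OF walk_in[of k]] v 0 index_e[of k]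
    by (cases "x \<in> index C") (auto simp: lattice_on_def simple_root_def)
  then have "v \<in> range (\<lambda>(z::int) x. z * simple_root (e (Suc k)) x)" by (metis ext rangeI)
  then have "v = simple_root (e (Suc k)) \<or> v = (\<lambda>x. - simple_root (e (Suc k)) x)"
    using R_simple[OF walk_in e_simps(2)] v(1) by blast
  then have "det2 (V (Suc k)) r = 1 \<or> det2 (V (Suc k)) r = -1"
    using v(3) by (auto simp: simple_root_def)
  then show "r = V k \<or> r = - V k" using expand[of r k] 0 by (auto simp: prod_eq_iff)
qed

section \<open>The walk closes up and visits every object exactly once\<close>

lemma walk_two: "((rho C j \<circ> rho C i) ^^ l) a = walk (2 * l)"
proof (induction l)
  case (Suc l)
  have "e (2 * l) = i" "e (Suc (2 * l)) = j" by (simp_all add: e_def alt_def)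
  then show ?case using Suc by simp
qed simp

lemma walk_period: "walk (k + 2 * p) = walk k"
proof (induction k)
  case 0
  \<comment> \<open>(R4) is used with \<open>j\<close> before \<open>i\<close>, because the walk
    applies \<open>rho C i\<close> first.\<close>
  let ?S = "R a \<inter> {(\<lambda>k. int p * simple_root j k + int q * simple_root i k) | p q. True}"
  have e0: "e 0 = i" "e (Suc 0) = j" by (simp_all add: e_def alt_def)
  have S: "v \<in> ?S \<longleftrightarrow> v \<in> R a \<and> 0 \<le> v i \<and> 0 \<le> v j" for v
  proof
    assume v: "v \<in> R a \<and> 0 \<le> v i \<and> 0 \<le> v j"
    then have "v = (\<lambda>k. int (nat (v j)) * simple_root j k + int (nat (v i)) * simple_root i k)"
      using R_sub[OF a] i_neq_j index_C by (auto simp: lattice_on_def simple_root_def fun_eq_iff)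
    then show "v \<in> ?S" using v by blast
  qed (auto simp: simple_root_def)
  have "bij_betw (coords 0) ?S N"
    unfolding bij_betw_def
  proof
    show "inj_on (coords 0) ?S"
    proof (rule inj_onI)
      fix u v assume uv: "u \<in> ?S" "v \<in> ?S" "coords 0 u = coords 0 v"
      then have "u i = v i" "u j = v j" by (simp_all add: coords_def e0)
      moreover have "u \<in> lattice_on {i, j}" "v \<in> lattice_on {i, j}" using uv R_sub[OF a] index_C by auto
      ultimately show "u = v" unfolding lattice_on_def mem_Collect_eq by (metis ext insertE singletonD)
    qed
    show "coords 0 ` ?S = N"
    proof (intro equalityI subsetI)
      fix r assume "r \<in> coords 0 ` ?S"
      then obtain v where v: "r = coords 0 v" "v \<in> R a" "0 \<le> v i" "0 \<le> v j" using S by blast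
      then have "r \<in> P" by (simp add: P_def)
      then show "r \<in> N" using v e0 by (simp add: N_def coords_def)
    next
      fix r assume "r \<in> N"
      then have r: "r \<in> P" "0 \<le> fst r" "0 \<le> snd r" by (simp_all add: N_def)
      then obtain v where v: "r = coords 0 v" "v \<in> R a" by (auto simp: P_def)
      then have "v \<in> ?S" unfolding S using r(2,3) e0 by (simp add: coords_def)
      then show "r \<in> coords 0 ` ?S" using v by blast
    qed
  qed
  from bij_betw_same_card[OF this] have "card ?S = p" by (simp only: card_N)
  then show ?case using R_power[OF a, of j i] finite_R[OF a] i_neq_j index_C walk_two[of p] by simp
next
  case (Suc k)
  then show ?case by (simp add: e_def alt_def)
qed

text \<open>Connectedness gives one inclusion once the walk is closed under both reflections; the
  backward one is reached by going round.\<close>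

lemma objs_walk: "objs C = walk ` {..<2 * p}"
proof
  show "walk ` {..<2 * p} \<subseteq> objs C" using walk_in by blast
  have walk_mod: "walk k = walk (k mod (2 * p))" for k
  proof -
    have "walk (k + 2 * p * q) = walk k" for k q
    proof (induction q)
      case (Suc q)
      then show ?case using walk_period[of "k + 2 * p * q"] by (simp add: algebra_simps)
    qed simp
    from this[of "k mod (2 * p)" "k div (2 * p)"] show ?thesis by simp
  qed
  have "f \<in> UNIV \<Longrightarrow> x \<in> range walk \<Longrightarrow> y \<in> range walk" if "weyl_hom C x y f" for x y f
    using that
  proof induction
    case (weyl_gen b x)
    then obtain k where k: "b = walk k" by blast
    \<comment> \<open>The place before \<open>k\<close>, moved up by a full period to stay a natural
      number.\<close>
    define m where "m = k + 2 * p - 1"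
    have b: "b = walk (Suc m)" using k walk_period[of k] p_pos by (simp add: m_def)
    then have "rho C (e m) b = walk m" using rho_rho[OF e_simps(2) walk_in] by simp
    moreover have "rho C (e (Suc m)) b = walk (Suc (Suc m))" using b by simp
    ultimately show ?case using index_e[of m] weyl_gen(2) by (metis insertE singletonD rangeI)
  qed auto
  then have "objs C \<subseteq> range walk"
    using connected a unfolding weyl_connected_def by (metis UNIV_I rangeI subsetI walk.simps(1))
  then show "objs C \<subseteq> walk ` {..<2 * p}" using walk_mod p_pos by force
qed

text \<open>The composed reflections keep \<open>r\<close> and only change the coordinates in which
  it is written. \<open>r\<close> is arbitrary, since universality speaks about all lattice
  vectors.\<close>

lemma walk_hom: "\<exists>f. weyl_hom C (walk k) (walk (k + d)) f \<and>
    (\<forall>v r. coords k v = (det2 (V k) r, det2 (V (Suc k)) r) \<longrightarrow>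
       coords (k + d) (f v) = (det2 (V (k + d)) r, det2 (V (Suc (k + d))) r))"
proof (induction d)
  case 0
  show ?case using weyl_id[OF walk_in, of k] by (intro exI[of _ id]) (simp add: id_def)
next
  case (Suc d)
  then obtain f where f: "weyl_hom C (walk k) (walk (k + d)) f"
    "\<And>v r. coords k v = (det2 (V k) r, det2 (V (Suc k)) r) \<Longrightarrow>
       coords (k + d) (f v) = (det2 (V (k + d)) r, det2 (V (Suc (k + d))) r)" by blast
  let ?g = "reflection C (e (k + d)) (walk (k + d))"
  have "weyl_hom C (walk (k + d)) (walk (k + Suc d)) ?g"
    using weyl_gen[OF walk_in e_simps(2)] by simp
  from weyl_comp[OF f(1) this] have "weyl_hom C (walk k) (walk (k + Suc d)) (?g \<circ> f)" .
  moreover have "coords (k + Suc d) ((?g \<circ> f) v) = (det2 (V (k + Suc d)) r, det2 (V (Suc (k + Suc d))) r)"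
    if "coords k v = (det2 (V k) r, det2 (V (Suc k)) r)" for v r
    using f(2)[OF that] by (simp add: reflection_coords del: V.simps) (simp add: det2_step del: V.simps)
  ultimately show ?case by blast
qed

lemma two_le_p: "2 \<le> p"
proof -
  have "2 * n \<le> 2 * p"
    unfolding card_objs[symmetric] objs_walk using card_image_le[of "{..<2 * p}" walk] by simp
  then show ?thesis using n3 by simp
qed

text \<open>A return yields an endomorphism, which universality makes trivial. The coordinates of
  every \<open>r\<close> then agree before and after, in exchanged order if \<open>d\<close> is
  odd.\<close>

lemma walk_distinct:
  assumes "0 < d" "d < 2 * p" shows "walk (k + d) \<noteq> walk k"
proof
  assume eq: "walk (k + d) = walk k"
  then obtain f where f: "weyl_hom C (walk k) (walk k) f"
    "\<And>v r. coords k v = (det2 (V k) r, det2 (V (Suc k)) r) \<Longrightarrow>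
       coords (k + d) (f v) = (det2 (V (k + d)) r, det2 (V (Suc (k + d))) r)" using walk_hom[of k d] by auto
  have "(det2 (V k) r, det2 (V (Suc k)) r) = (if even d
      then (det2 (V (k + d)) r, det2 (V (Suc (k + d))) r)
      else (det2 (V (Suc (k + d))) r, det2 (V (k + d)) r))" for r
  proof -
    define v where "v = (\<lambda>x. if x = e k then det2 (V k) r else if x = e (Suc k) then det2 (V (Suc k)) r else 0)"
    have v: "v \<in> lattice_on (index C)" using index_e[of k] by (auto simp: v_def lattice_on_def)
    have "coords k v = (det2 (V k) r, det2 (V (Suc k)) r)" using e_simps(3)[of k] by (auto simp: v_def coords_def)
    moreover have "f v = v" using universal f(1) v walk_in by (auto simp: weyl_universal_def)
    moreover have "coords (k + d) v = (if even d then coords k v else (snd (coords k v), fst (coords k v)))"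
      by (auto simp: coords_def e_def alt_def)
    ultimately show ?thesis using f(2)[of v r] by (simp split: if_splits)
  qed
  then have ev: "\<And>r. even d \<Longrightarrow> det2 (V (k + d)) r = det2 (V k) r"
    and od: "\<And>r. odd d \<Longrightarrow> det2 (V (k + d)) r = det2 (V (Suc k)) r \<and> det2 (V (Suc (k + d))) r = det2 (V k) r"
    by (auto split: if_splits)
  show False
  proof (cases "even d")
    case True
    then show ?thesis using V_return_even[OF two_le_p assms, of k] ev by auto
  next
    case False
    then show ?thesis using V_return_odd[of "k + d" k] od by blast
  qed
qed

lemma inj_walk: "inj_on walk {..<2 * p}"
proof (rule inj_onI)
  fix k l assume "k \<in> {..<2 * p}" "l \<in> {..<2 * p}" "walk k = walk l"
  then show "k = l" using walk_distinct[of "l - k" k] walk_distinct[of "k - l" l]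
    by (cases k l rule: linorder_cases) (auto simp: less_imp_diff_less)
qed

lemma p_eq: "p = n"
  using card_objs objs_walk inj_walk by (simp add: card_image)

section \<open>Cyclic numbering of the objects\<close>

definition h :: "int \<Rightarrow> 'a" where
  "h k = walk (nat (k mod (2 * int n)))"

lemma h_walk: "h (int k) = walk k"
proof -
  have "walk (r + 2 * n * q) = walk r" for r q
  proof (induction q)
    case (Suc q)
    then show ?case using walk_period[of "r + 2 * n * q"] p_eq by (simp add: algebra_simps)
  qed simp
  from this[of "k mod (2 * n)" "k div (2 * n)"] have "walk (k mod (2 * n)) = walk k" by simp
  moreover have "int k mod (2 * int n) = int (k mod (2 * n))" by (simp add: zmod_int)
  ultimately show ?thesis by (simp add: h_def)
qed

lemma h_cong: "h (k mod (2 * int n)) = h k"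
  by (simp add: h_def)

lemma alt_mod: "alt i j (k mod (2 * int n)) = alt i j k" "alt i j (k mod (2 * int n) + 1) = alt i j (k + 1)"
proof -
  have "even (k mod (2 * int n)) \<longleftrightarrow> even k" by (simp add: dvd_mod_iff)
  then show "alt i j (k mod (2 * int n)) = alt i j k" "alt i j (k mod (2 * int n) + 1) = alt i j (k + 1)"
    by (simp_all add: alt_def)
qed

theorem farey_scheme_walk: "farey_scheme n C i j h W" and h_0: "h 0 = a"
proof -
  have farey: "farey_polygon n W" using farey_polygon_W two_le_p p_eq by simp
  define r where "r k = nat (k mod (2 * int n))" for k
  have r: "int (r k) = k mod (2 * int n)" for k using n3 by (simp add: r_def)
  have h_r: "h k = walk (r k)" for k by (simp add: h_def r_def)
  have h_in: "h k \<in> objs C" for k by (simp add: h_def walk_in)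
  have e_r: "e (r k) = alt i j k" "e (Suc (r k)) = alt i j (k + 1)" for k
    using alt_mod[of k] by (simp_all add: e_def r add.commute)
  have alt_in: "alt i j k \<in> index C" for k by (auto simp: alt_def index_C)
  have up: "rho C (alt i j k) (h k) = h (k + 1)" for k
  proof -
    have "rho C (alt i j k) (h k) = h (int (Suc (r k)))" using h_walk[of "Suc (r k)"] h_r e_r by simp
    also have "\<dots> = h (k + 1)" using h_cong[of "k + 1"] h_cong[of "int (Suc (r k))"]
      by (simp add: r mod_simps add.commute)
    finally show ?thesis .
  qed
  \<comment> \<open>A step down undoes the step up from \<open>h (k - 1)\<close>.\<close>
  have down: "rho C (alt i j (k + 1)) (h k) = h (k - 1)" for k
    using rho_rho[OF alt_in h_in, of "k - 1" "k - 1"] up[of "k - 1"] by simp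
  have quid: "quiddity W k = c (r k)" for k
  proof -
    have "quiddity W (int (r k)) = quiddity W k"
      using quiddity_mod[OF _ farey, of k] quiddity_mod[OF _ farey, of "int (r k)"] n3
      by (simp add: r mod_mod_cancel)
    then show ?thesis by (simp add: quiddity_W)
  qed
  have cup: "cartan C (h k) (alt i j k) (alt i j (k + 1)) = - quiddity W k" for k
    using quid[of k] by (simp add: c_def h_r e_r)
  \<comment> \<open>The row is read across the wall, at \<open>h (k - 1)\<close>, where the scheme
    has the same entries.\<close>
  have cdown: "cartan C (h k) (alt i j (k + 1)) (alt i j k) = - quiddity W (k - 1)" for k
    using cup[of "k - 1"] cartan_rho[OF h_in[of k] alt_in[of "k + 1"] alt_in[of k]] down[of k] by simp
  have inj: "h k = h m \<longleftrightarrow> 2 * int n dvd k - m" for k m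
  proof -
    have "h k = h m \<longleftrightarrow> r k = r m"
      using inj_walk n3 by (auto simp: h_r p_eq r_def nat_less_iff inj_on_eq_iff)
    also have "\<dots> \<longleftrightarrow> int (r k) = int (r m)" by simp
    finally show ?thesis unfolding r mod_eq_dvd_iff .
  qed
  have "objs C = range h"
  proof
    show "objs C \<subseteq> range h" unfolding objs_walk using h_walk by (metis image_subset_iff rangeI)
  qed (use h_in in blast)
  then have "cyclic_chart n C i j h (quiddity W)"
    unfolding cyclic_chart_def
    using index_C i_neq_j inj up down cup cdown cartan_diag[OF alt_in h_in] by simp
  then show "farey_scheme n C i j h W" using farey n3 by (simp add: farey_scheme_def)
  show "h 0 = a" using h_walk[of 0] by simp
qed

end

lemma farey_scheme_exists:
  assumes "3 \<le> n" "C \<in> weyl_groupoids n" "index C = {i, j}" "i \<noteq> j" "a \<in> objs C"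
  shows "\<exists>h W. farey_scheme n C i j h W \<and> h 0 = a"
proof -
  obtain R where "root_system C R" "\<forall>b\<in>objs C. finite (R b)"
    using assms(2) by (auto simp: weyl_groupoids_def admits_finite_root_system_def)
  then interpret finite_universal_scheme C n i j a R using assms by unfold_locales auto
  show ?thesis using farey_scheme_walk h_0 by blast
qed

section \<open>The correspondence\<close>

lemma (in farey_scheme) char_seq_up:
  "char_seq C (alt i j m) (alt i j (m + 1)) (h m) k = quiddity W (m + int k)"
proof (induction k arbitrary: m)
  case 0
  then show ?case by (simp add: cartan_up)
next
  case (Suc k)
  have "alt i j (m + 1 + 1) = alt i j m" by (simp add: alt_def)
  then show ?case using Suc[of "m + 1"] by (simp add: rho_up algebra_simps)
qed

text \<open>Walking the other way reads the quiddities backwards, beginning with the wall behind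
  \<open>h m\<close>, hence with index \<open>m - 1\<close>.\<close>

lemma (in farey_scheme) char_seq_down:
  "char_seq C (alt i j (m + 1)) (alt i j m) (h m) k = quiddity W (m - 1 - int k)"
proof (induction k arbitrary: m)
  case 0
  then show ?case by (simp add: cartan_down)
next
  case (Suc k)
  have eq: "m - 2 - int k = m - int k - 2" by simp
  show ?case using Suc[of "m - 1"] by (simp add: rho_down eq)
qed

lemma triangle_count_cong:
  "k mod int n = m mod int n \<Longrightarrow> triangle_count n T k = triangle_count n T m"
  by (simp add: triangle_count_def)

lemma belongs_toI:
  assumes "a \<in> objs C" "i \<in> index C" "j \<in> index C" "i \<noteq> j"
    and "\<And>k. char_seq C i j a k = triangle_count n T (int k)"
  shows "belongs_to n C T"
proof -
  have "triangle_count n T (int k) = int (triangles_at n T (k mod n))" for k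
    by (simp add: triangle_count_def nat_int flip: zmod_int)
  then show ?thesis using assms unfolding belongs_to_def by metis
qed

lemma belongs_toE:
  assumes "3 \<le> n" "C \<in> weyl_groupoids n" "T \<in> triangulations n" "belongs_to n C T"
  obtains i j h W where "farey_scheme n C i j h W" "realises n W T"
proof -
  obtain a i j where a: "a \<in> objs C" "i \<in> index C" "j \<in> index C" "i \<noteq> j"
    and seq: "\<And>k. char_seq C i j a k = int (triangles_at n T (k mod n))"
    using assms(4) unfolding belongs_to_def by blast
  have "card (index C) = 2" using assms(2) by (simp add: weyl_groupoids_def cartan_scheme_rank_two_def)
  then have "index C = {i, j}" using a by (auto simp: card_2_iff)
  then obtain h W where fs: "farey_scheme n C i j h W" and h0: "h 0 = a"
    using farey_scheme_exists[OF assms(1,2)] a by blast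
  interpret farey_scheme n C i j h W by (rule fs)
  have "quiddity W (int k) = int (triangles_at n T k)" if "k < n" for k
    using char_seq_up[of 0 k] seq[of k] that h0 by (simp add: alt_def)
  then have "realises n W T" using realises_windowI[OF _ farey assms(3)] assms(1) by simp
  then show thesis using that fs by blast
qed

text \<open>\<open>T\<close> fixes the chart. The place and the direction used for \<open>T'\<close>
  then amount to a rotation by \<open>m\<close> or a reflection with parameter
  \<open>m - 1\<close>.\<close>

lemma belongs_to_dihedral:
  assumes "3 \<le> n" "C \<in> weyl_groupoids n" "T \<in> triangulations n" "T' \<in> triangulations n"
    and "belongs_to n C T" "belongs_to n C T'"
  shows "(T', T) \<in> dihedral_rel n"
proof -
  obtain i j h W where fs: "farey_scheme n C i j h W" and rl: "realises n W T"
    using belongs_toE[OF assms(1-3,5)] .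
  interpret farey_scheme n C i j h W by (rule fs)
  obtain a i' j' where a: "a \<in> objs C" "i' \<in> index C" "j' \<in> index C" "i' \<noteq> j'"
    and seq: "\<And>k. char_seq C i' j' a k = int (triangles_at n T' (k mod n))"
    using assms(6) unfolding belongs_to_def by blast
  obtain m where m: "a = h m" using a objs_C by auto
  have T: "quiddity W k = triangle_count n T k" for k using rl by (simp add: realises_def)
  have T': "triangle_count n T' k = char_seq C i' j' (h m) (nat (k mod int n))" for k
    using seq[of "nat (k mod int n)"] m assms(1) by (simp add: triangle_count_def nat_less_iff)
  have r: "int (nat (k mod int n)) = k mod int n" for k using assms(1) by simp
  have "\<exists>s z. (s = 1 \<or> s = -1) \<and> (\<forall>k. triangle_count n T (s * k + z) = triangle_count n T' k)"
  proof (cases rule: index_cases[OF a(2), of m])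
    case 1
    then have j': "j' = alt i j (m + 1)" by (cases rule: index_cases[OF a(3), of m]) (use a(4) in auto)
    have "triangle_count n T (1 * k + m) = triangle_count n T' k" for k
      unfolding T' 1 j' char_seq_up T r by (rule triangle_count_cong) (simp add: mod_simps add.commute)
    then show ?thesis by blast
  next
    case 2
    then have j': "j' = alt i j m" by (cases rule: index_cases[OF a(3), of m]) (use a(4) in auto)
    have "triangle_count n T (- 1 * k + (m - 1)) = triangle_count n T' k" for k
      unfolding T' 2 j' char_seq_down T r by (rule triangle_count_cong) (metis mod_diff_right_eq minus_mult_commute mult_1 uminus_add_conv_diff add_diff_eq add.commute)
    then show ?thesis by blast
  qed
  then show ?thesis unfolding dihedral_rel_iff[OF assms(1)] using assms by blast
qed

lemma belongs_to_dihedral_transfer: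
  assumes "3 \<le> n" "C \<in> weyl_groupoids n" "(T, T') \<in> dihedral_rel n" "belongs_to n C T"
  shows "belongs_to n C T'"
proof -
  obtain s z where T: "T \<in> triangulations n" and sz: "s = 1 \<or> s = -1"
    "\<And>k. triangle_count n T' (s * k + z) = triangle_count n T k"
    using assms(3) unfolding dihedral_rel_iff[OF assms(1)] by blast
  obtain i j h W where fs: "farey_scheme n C i j h W" and rl: "realises n W T"
    using belongs_toE[OF assms(1,2) T assms(4)] .
  interpret farey_scheme n C i j h W by (rule fs)
  have q: "quiddity W k = triangle_count n T' (s * k + z)" for k using rl sz(2) by (simp add: realises_def)
  have in_index: "alt i j k \<in> index C" for k by (auto simp: alt_def index_C)
  have in_objs: "h k \<in> objs C" for k by (simp add: objs_C)
  \<comment> \<open>The starting object is chosen so that the sequence begins with the count of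
    \<open>T'\<close> at vertex 0: \<open>h (- z)\<close> read upwards or \<open>h (z + 1)\<close>
    read downwards.\<close>
  from sz(1) show ?thesis
  proof
    assume "s = 1"
    then show ?thesis
      using belongs_toI[OF in_objs[of "- z"] in_index in_index alt_neq[OF i_neq_j, of "- z"]]
      unfolding char_seq_up q by simp
  next
    assume "s = -1"
    then show ?thesis
      using belongs_toI[OF in_objs[of "z + 1"] in_index in_index alt_neq[OF i_neq_j, of "z + 1", symmetric]]
      unfolding char_seq_down q by simp
  qed
qed

lemma equivalent_belongs_to:
  assumes "equivalent_schemes C D" "C \<in> weyl_groupoids n" "belongs_to n C T"
  shows "belongs_to n D T"
proof -
  obtain f g where f: "bij_betw f (index C) (index D)" and g: "bij_betw g (objs C) (objs D)"
    and rho: "\<And>i a. i \<in> index C \<Longrightarrow> a \<in> objs C \<Longrightarrow> g (rho C i a) = rho D (f i) (g a)"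
    and cartan: "\<And>i j a. i \<in> index C \<Longrightarrow> j \<in> index C \<Longrightarrow> a \<in> objs C \<Longrightarrow>
                   cartan C a i j = cartan D (g a) (f i) (f j)"
    using assms(1) unfolding equivalent_schemes_def by blast
  have rho_in: "rho C i a \<in> objs C" if "i \<in> index C" "a \<in> objs C" for i a
    using assms(2) that by (simp add: weyl_groupoids_def cartan_scheme_rank_two_def)
  have seq: "char_seq D (f i) (f j) (g a) k = char_seq C i j a k"
    if "i \<in> index C" "j \<in> index C" "a \<in> objs C" for i j a k
    using that
  proof (induction k arbitrary: i j a)
    case 0
    then show ?case using cartan by simp
  next
    case (Suc k)
    then show ?case using Suc.IH[of j i "rho C i a"] rho rho_in by simp
  qed
  obtain a i j where a: "a \<in> objs C" "i \<in> index C" "j \<in> index C" "i \<noteq> j"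
    "\<forall>k. char_seq C i j a k = int (triangles_at n T (k mod n))"
    using assms(3) unfolding belongs_to_def by blast
  have "g a \<in> objs D" "f i \<in> index D" "f j \<in> index D" "f i \<noteq> f j"
    using a f g by (auto simp: bij_betw_def inj_on_def)
  then show ?thesis using a(5) seq[OF a(2,3,1)] unfolding belongs_to_def by metis
qed

text \<open>A chart determines its scheme from the quiddities alone, and both schemes have charts
  with the quiddities of \<open>T\<close>; matching places is an equivalence.\<close>

lemma belongs_to_equivalent:
  assumes "3 \<le> n" "C \<in> weyl_groupoids n" "D \<in> weyl_groupoids n" "T \<in> triangulations n"
    and "belongs_to n C T" "belongs_to n D T"
  shows "equivalent_schemes C D"
proof -
  obtain i j h W where fC: "farey_scheme n C i j h W" and "realises n W T"
    using belongs_toE[OF assms(1,2,4,5)] .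
  moreover obtain i' j' h' W' where fD: "farey_scheme n D i' j' h' W'" and "realises n W' T"
    using belongs_toE[OF assms(1,3,4,6)] .
  ultimately have W: "quiddity W k = quiddity W' k" for k by (simp add: realises_def)
  interpret c: farey_scheme n C i j h W by (rule fC)
  interpret d: farey_scheme n D i' j' h' W' by (rule fD)
  define f where "f x = (if x = i then i' else j')" for x
  \<comment> \<open>The choice is harmless: both charts identify places exactly modulo
    \<open>2 * n\<close>.\<close>
  define g where "g a = h' (SOME k. h k = a)" for a
  have g: "g (h k) = h' k" for k
  proof -
    have "h (SOME m. h m = h k) = h k" by (rule someI[of _ k]) simp
    then show ?thesis unfolding g_def c.h_eq_iff d.h_eq_iff .
  qed
  have f: "f (alt i j k) = alt i' j' k" for k using c.i_neq_j by (simp add: f_def alt_def)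
  have "bij_betw f (index C) (index D)"
    using c.i_neq_j d.i_neq_j by (auto simp: bij_betw_def inj_on_def f_def c.index_C d.index_C)
  moreover have "bij_betw g (objs C) (objs D)"
    unfolding c.objs_C d.objs_C bij_betw_def inj_on_def using g c.h_eq_iff d.h_eq_iff
    by (auto simp: image_image)
  moreover have "g (rho C x a) = rho D (f x) (g a)" if "x \<in> index C" "a \<in> objs C" for x a
  proof -
    obtain k where k: "a = h k" using \<open>a \<in> objs C\<close> c.objs_C by auto
    show ?thesis
      by (cases rule: c.index_cases[OF \<open>x \<in> index C\<close>, of k])
        (simp_all add: k c.rho_up c.rho_down d.rho_up d.rho_down f g)
  qed
  moreover have "cartan C a x y = cartan D (g a) (f x) (f y)"
    if "x \<in> index C" "y \<in> index C" "a \<in> objs C" for x y a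
  proof -
    obtain k where k: "a = h k" using \<open>a \<in> objs C\<close> c.objs_C by auto
    show ?thesis
      by (cases rule: c.index_cases[OF \<open>x \<in> index C\<close>, of k];
          cases rule: c.index_cases[OF \<open>y \<in> index C\<close>, of k])
        (simp_all add: k f g W c.cartan_up c.cartan_down c.cartan_diag d.cartan_up d.cartan_down d.cartan_diag)
  qed
  ultimately show ?thesis unfolding equivalent_schemes_def by blast
qed

lemma belongs_to_exists:
  assumes "3 \<le> n" "C \<in> weyl_groupoids n"
  obtains T where "T \<in> triangulations n" "belongs_to n C T"
proof -
  have "card (index C) = 2" "objs C \<noteq> {}"
    using assms(2) unfolding weyl_groupoids_def cartan_scheme_rank_two_def by blast+
  then obtain i j a where ij: "index C = {i, j}" "i \<noteq> j" and "a \<in> objs C"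
    unfolding card_2_iff by blast
  then obtain h W where fs: "farey_scheme n C i j h W"
    using farey_scheme_exists[OF assms ij] by blast
  interpret farey_scheme n C i j h W by (rule fs)
  obtain T where T: "realises n W T" using farey_polygon_realises[OF assms(1) farey] by blast
  have "char_seq C i j (h 0) k = triangle_count n T (int k)" for k
    using char_seq_up[of 0 k] T by (simp add: alt_def realises_def)
  then have "belongs_to n C T" using ij objs_C by (intro belongs_toI[of "h 0" C i j]) auto
  then show thesis using that[of T] T by (simp add: realises_def)
qed

text \<open>The quiddities of a polygon realising \<open>T\<close> are laid out on a circle of
  \<open>2 * n\<close> objects taken from \<open>A\<close>.\<close>

lemma scheme_exists:
  fixes I :: "'i set" and A :: "'a set"
  assumes "3 \<le> n" "card I = 2" "card A = 2 * n" "T \<in> triangulations n"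
  shows "\<exists>C :: ('i, 'a) cartan_data. C \<in> weyl_groupoids n \<and> belongs_to n C T"
proof -
  obtain W where rl: "realises n W T" using triangulation_realised[OF assms(1,4)] by blast
  then have farey: "farey_polygon n W" by (simp add: realises_def)
  obtain i j :: 'i where ij: "i \<noteq> j" using assms(2) by (auto simp: card_2_iff)
  have "finite A" using assms(1,3) by (intro card_ge_0_finite) simp
  then obtain f where f: "bij_betw f {0..<2 * n} A" using ex_bij_betw_nat_finite assms(3) by metis
  define h where "h k = f (nat (k mod (2 * int n)))" for k
  have h: "h k = h m \<longleftrightarrow> 2 * int n dvd k - m" for k m
  proof -
    have "nat (k mod (2 * int n)) \<in> {0..<2 * n}" for k using assms(1) by (simp add: nat_less_iff)
    then have "h k = h m \<longleftrightarrow> nat (k mod (2 * int n)) = nat (m mod (2 * int n))"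
      using f unfolding h_def bij_betw_def by (metis inj_on_eq_iff)
    also have "\<dots> \<longleftrightarrow> k mod (2 * int n) = m mod (2 * int n)" using assms(1) by (simp add: nat_eq_iff)
    finally show ?thesis unfolding mod_eq_dvd_iff .
  qed
  \<comment> \<open>Some place of the object. Labels and entries do not depend on the choice, since
    \<open>2 * n\<close> is even and a multiple of the period of the quiddities.\<close>
  define num where "num a = (SOME k. h k = a)" for a
  define C :: "('i, 'a) cartan_data" where "C = \<lparr>index = {i, j}, objs = range h,
     rho = (\<lambda>x a. if x = alt i j (num a) then h (num a + 1) else h (num a - 1)),
     cartan = (\<lambda>a x y. if x = y then 2 else if x = alt i j (num a) then - quiddity W (num a)
                       else - quiddity W (num a - 1))\<rparr>"
  have num: "2 * int n dvd num (h k) - k" for k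
    unfolding h[symmetric] num_def by (rule someI[of _ k]) simp
  have parity: "even (num (h k)) \<longleftrightarrow> even k" for k
    using dvd_trans[OF dvd_triv_left num[of k]] by auto
  have alt_num: "alt i j (num (h k)) = alt i j k" for k by (simp add: alt_def parity)
  have h_num: "h (num (h k) + 1) = h (k + 1)" "h (num (h k) - 1) = h (k - 1)" for k
    unfolding h using num[of k] by simp_all
  have quid: "quiddity W k = quiddity W m" if "2 * int n dvd k - m" for k m
  proof -
    have "k mod int n = m mod int n" unfolding mod_eq_dvd_iff using that dvd_mult_right by blast
    then show ?thesis using quiddity_mod[OF _ farey] assms(1) by (metis less_le_trans zero_less_numeral)
  qed
  have q_num: "quiddity W (num (h k)) = quiddity W k" "quiddity W (num (h k) - 1) = quiddity W (k - 1)" for k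
    using num[of k] by (auto intro!: quid)
  have "alt i j k \<noteq> alt i j (k + 1)" for k by (rule alt_neq[OF ij])
  then have "cyclic_chart n C i j h (quiddity W)"
    unfolding cyclic_chart_def using ij h by (auto simp: C_def alt_num h_num q_num dest: sym)
  then have fs: "farey_scheme n C i j h W" using assms(1) farey by (simp add: farey_scheme_def)
  interpret farey_scheme n C i j h W by (rule fs)
  have "char_seq C i j (h 0) k = triangle_count n T (int k)" for k
    using char_seq_up[of 0 k] rl by (simp add: alt_def realises_def)
  then have "belongs_to n C T" using ij objs_C index_C by (intro belongs_toI[of "h 0" C i j]) auto
  then show ?thesis using mem_weyl_groupoids by blast
qed

text \<open>A common triangulation replaces the bijections of an equivalence, so symmetry is
  immediate and transitivity needs no composition of bijections.\<close>

lemma weyl_iso_iff: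
  assumes "3 \<le> n"
  shows "(C, D) \<in> weyl_iso n \<longleftrightarrow> C \<in> weyl_groupoids n \<and> D \<in> weyl_groupoids n \<and>
    (\<exists>T\<in>triangulations n. belongs_to n C T \<and> belongs_to n D T)"
  using belongs_to_exists[OF assms, of C] equivalent_belongs_to[of C D n] belongs_to_equivalent[OF assms, of C D]
  unfolding weyl_iso_def by blast

section \<open>Passage to classes\<close>

lemma equiv_weyl_iso:
  assumes "3 \<le> n" shows "equiv (weyl_groupoids n) (weyl_iso n)"
proof (rule equivI)
  show "weyl_iso n \<subseteq> weyl_groupoids n \<times> weyl_groupoids n" by (auto simp: weyl_iso_def)
  show "refl_on (weyl_groupoids n) (weyl_iso n)"
    unfolding refl_on_def weyl_iso_iff[OF assms] using belongs_to_exists[OF assms] by blast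
  show "sym (weyl_iso n)" unfolding sym_def weyl_iso_iff[OF assms] by blast
  show "trans (weyl_iso n)"
  proof (rule transI)
    fix C D E assume CD: "(C, D) \<in> weyl_iso n" and DE: "(D, E) \<in> weyl_iso n"
    obtain T where "T \<in> triangulations n" "belongs_to n C T" "belongs_to n D T"
      using CD unfolding weyl_iso_iff[OF assms] by blast
    moreover from this have "belongs_to n E T"
      using DE equivalent_belongs_to unfolding weyl_iso_def by blast
    ultimately show "(C, E) \<in> weyl_iso n" using CD DE unfolding weyl_iso_iff[OF assms] by blast
  qed
qed

lemma natural_map_class:
  assumes "3 \<le> n" "C \<in> weyl_groupoids n" "T \<in> triangulations n" "belongs_to n C T"
  shows "natural_map n (weyl_iso n `` {C}) = dihedral_rel n `` {T}"
proof (intro equalityI subsetI)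
  fix T' assume "T' \<in> natural_map n (weyl_iso n `` {C})"
  then obtain D where D: "T' \<in> triangulations n" "(C, D) \<in> weyl_iso n" "belongs_to n D T'"
    by (auto simp: natural_map_def)
  then have "D \<in> weyl_groupoids n" "belongs_to n D T"
    using equivalent_belongs_to[OF _ assms(2,4)] by (auto simp: weyl_iso_def)
  then show "T' \<in> dihedral_rel n `` {T}" using belongs_to_dihedral[OF assms(1) _ D(1) assms(3) D(3)] by simp
next
  fix T' assume T': "T' \<in> dihedral_rel n `` {T}"
  then have "belongs_to n C T'" using belongs_to_dihedral_transfer assms by blast
  moreover have "(C, C) \<in> weyl_iso n" using assms unfolding weyl_iso_iff[OF assms(1)] by blast
  ultimately show "T' \<in> natural_map n (weyl_iso n `` {C})"
    using T' by (auto simp: natural_map_def dihedral_rel_def)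
qed

text \<open>The existence hypotheses give the two types room for two labels and \<open>2 * n\<close>
  objects, so that every triangulation is reached.\<close>

theorem theorem1p1:
  fixes n :: nat
  assumes "n \<ge> 3"
    and "\<exists>I :: 'i set. card I = 2"
    and "\<exists>A :: 'a set. card A = 2 * n"
  shows "bij_betw (natural_map n)
           (weyl_classes n :: ('i, 'a) cartan_data set set) (triangulation_classes n)"
proof (rule bij_betw_imageI)
  note classE = quotientE[of _ "weyl_groupoids n" "weyl_iso n", folded weyl_classes_def]
  have self: "T \<in> dihedral_rel n `` {T}" if "T \<in> triangulations n" for T
    using equiv_class_self[OF equiv_dihedral_rel[OF assms(1)] that] .
  show "inj_on (natural_map n) (weyl_classes n :: ('i, 'a) cartan_data set set)"
  proof (rule inj_onI)
    fix X Y :: "('i, 'a) cartan_data set"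
    assume X: "X \<in> weyl_classes n" and Y: "Y \<in> weyl_classes n" and eq: "natural_map n X = natural_map n Y"
    obtain C where C: "C \<in> weyl_groupoids n" "X = weyl_iso n `` {C}" using X by (rule classE)
    obtain D where D: "D \<in> weyl_groupoids n" "Y = weyl_iso n `` {D}" using Y by (rule classE)
    obtain T where T: "T \<in> triangulations n" "belongs_to n C T" using belongs_to_exists[OF assms(1) C(1)] .
    obtain S where S: "S \<in> triangulations n" "belongs_to n D S" using belongs_to_exists[OF assms(1) D(1)] .
    have "dihedral_rel n `` {T} = dihedral_rel n `` {S}"
      using eq natural_map_class[OF assms(1) C(1) T] natural_map_class[OF assms(1) D(1) S] C(2) D(2) by simp
    then have "(S, T) \<in> dihedral_rel n" using self[OF T(1)] by blast
    then have "belongs_to n D T" using belongs_to_dihedral_transfer[OF assms(1) D(1) _ S(2)] by blast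
    then have "(C, D) \<in> weyl_iso n" using C(1) D(1) T unfolding weyl_iso_iff[OF assms(1)] by blast
    then show "X = Y" using equiv_class_eq[OF equiv_weyl_iso[OF assms(1)]] C(2) D(2) by simp
  qed
  show "natural_map n ` (weyl_classes n :: ('i, 'a) cartan_data set set) = triangulation_classes n"
  proof (intro equalityI subsetI)
    fix Z assume "Z \<in> natural_map n ` (weyl_classes n :: ('i, 'a) cartan_data set set)"
    then obtain X :: "('i, 'a) cartan_data set" where X: "X \<in> weyl_classes n" "Z = natural_map n X" by blast
    obtain C where C: "C \<in> weyl_groupoids n" "X = weyl_iso n `` {C}" using X(1) by (rule classE)
    obtain T where T: "T \<in> triangulations n" "belongs_to n C T" using belongs_to_exists[OF assms(1) C(1)] .
    show "Z \<in> triangulation_classes n"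
      using natural_map_class[OF assms(1) C(1) T] X(2) C(2) T(1)
      by (simp add: triangulation_classes_def quotientI)
  next
    fix Z assume "Z \<in> triangulation_classes n"
    then obtain T where T: "T \<in> triangulations n" "Z = dihedral_rel n `` {T}"
      unfolding triangulation_classes_def by (rule quotientE)
    obtain C :: "('i, 'a) cartan_data" where C: "C \<in> weyl_groupoids n" "belongs_to n C T"
      using scheme_exists[OF assms(1) _ _ T(1)] assms(2,3) by blast
    have "weyl_iso n `` {C} \<in> weyl_classes n" unfolding weyl_classes_def by (rule quotientI[OF C(1)])
    then show "Z \<in> natural_map n ` (weyl_classes n :: ('i, 'a) cartan_data set set)"
      using natural_map_class[OF assms(1) C(1) T(1) C(2)] T(2) by (metis image_eqI)
  qed
qed

end
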